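(* Let $I$ be a measurable subset of $[-1,1]$, and suppose that every Gabor field over $I$ with lattice parameters $1,1$ is an $I$-wavelet. Then the following hold. (a) $I$ is dilation congruent with the Shannon set $[-1,-1/2)\cup[1/2,1)$. (b) For any lattice parameters $\alpha,\beta>0$ with $I\subset[-1/\alpha\beta,1/\alpha\beta]$, for any Gabor field $g$ over $I$ with lattice parameters $\alpha$ and $\beta$, and for any unitary multiplier $\chi$, the system $$\widehat{\mathcal U}(g,\alpha,\beta,\chi)=\{\hat D^\chi_j\hat T_{k,l,m}g: j\in\mathbb{Z},k\in\alpha\mathbb{Z},l\in\beta\mathbb{Z},m\in\mathbb{Z}\}$$ is a Parseval frame for $L^2(\Lambda\times\mathbb{R})$.
   Context: All sets and functions are Lebesgue measurable, and subsets of $\mathbb{R}$ whose symmetric difference has Lebesgue measure zero are identified. $\Lambda=\mathbb{R}\setminus\{0\}$. For $I\subseteq\Lambda$, $L^2(I\times\mathbb{R})$ is taken with respect to $|\lambda|\,d\lambda\,dt$ and is regarded as the subspace of $L^2(\Lambda\times\mathbb{R})$ of functions supported on $I\times\mathbb{R}$. A system $\{\psi_j\}$ in a separable Hilbert space $\mathcal{H}$ is a Parseval frame for $\mathcal{H}$ if $\|f\|^2=\sum_j|\langle f,\psi_j\rangle|^2$ for all $f\in\mathcal{H}$. For real $k,l,m$: $\hat T_{k,l,m}f(\lambda,t)=e^{2\pi i\lambda m}e^{-2\pi i\lambda lt}f(\lambda,t-k)$. A unitary multiplier is a family $\chi=\{\chi_a\}_{a>0}$ of measurable functions $\Lambda\to\{z\in\mathbb{C}:|z|=1\}$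 with $\chi_{a^{-1}}=\overline{\chi_a}$; put $\hat D^\chi_af(\lambda,t)=\chi_a(\lambda)\,a^{3/4}f(a\lambda,a^{-1/2}t)$ and $\hat D^\chi_j:=\hat D^\chi_{2^j}$, $j\in\mathbb{Z}$; write $\chi=1$ for the trivial family $\chi_a\equiv1$. $g\in L^2(I\times\mathbb{R})$ is a Gabor field over $I$ with lattice parameters $\alpha,\beta$ if for a.e. $\lambda\in I$ the system $\{t\mapsto|\lambda|^{1/2}e^{-2\pi i\lambda lt}g(\lambda,t-k):k\in\alpha\mathbb{Z},l\in\beta\mathbb{Z}\}$ is a Parseval frame for $L^2(\mathbb{R})$. $g\in L^2(I\times\mathbb{R})$ is an $I$-wavelet if $\widehat{\mathcal U}(g,1,1,1)$ (i.e. $\alpha=\beta=1$, $\chi=1$) is a Parseval frame for $L^2(\Lambda\times\mathbb{R})$. Subsets $I,J$ of $\mathbb{R}$ are dilation congruent if there is a bijection $\delta:I\to J$ and an integer-valued function $j$ on $I$ with $\delta(\lambda)=2^{j(\lambda)}\lambda$. *)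

theory Defs
  imports "HOL-Analysis.Analysis"
begin

definition ae_subset :: "real set \<Rightarrow> real set \<Rightarrow> bool" where
  "ae_subset A B \<longleftrightarrow> (AE x in lebesgue. x \<in> A \<longrightarrow> x \<in> B)"

definition ae_eq :: "real set \<Rightarrow> real set \<Rightarrow> bool" where
  "ae_eq A B \<longleftrightarrow> (AE x in lebesgue. x \<in> A \<longleftrightarrow> x \<in> B)"

text \<open>Elements of an L2 space are represented by functions, not by classes of functions
  agreeing almost everywhere.\<close>

definition L2 :: "'a measure \<Rightarrow> ('a \<Rightarrow> complex) set" where
  "L2 M = {f \<in> borel_measurable M. integrable M (\<lambda>x. (cmod (f x))\<^sup>2)}"

definition L2_inner :: "'a measure \<Rightarrow> ('a \<Rightarrow> complex) \<Rightarrow> ('a \<Rightarrow> complex) \<Rightarrow> complex" where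
  "L2_inner M f g = (\<integral>x. f x * cnj (g x) \<partial>M)"

definition L2_norm :: "'a measure \<Rightarrow> ('a \<Rightarrow> complex) \<Rightarrow> real" where
  "L2_norm M f = sqrt (\<integral>x. (cmod (f x))\<^sup>2 \<partial>M)"

definition parseval_frame :: "'a measure \<Rightarrow> ('i \<Rightarrow> 'a \<Rightarrow> complex) \<Rightarrow> bool" where
  "parseval_frame M \<psi> \<longleftrightarrow>
     (\<forall>j. \<psi> j \<in> L2 M) \<and>
     (\<forall>f\<in>L2 M. ((\<lambda>j. (cmod (L2_inner M f (\<psi> j)))\<^sup>2) has_sum (L2_norm M f)\<^sup>2) UNIV)"

text \<open>The real variable \<open>\<xi>\<close> below is the variable of the punctured line, usually written as lambda;
  \<open>u\<close> is the unitary multiplier, usually written as chi.\<close>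

definition Lam :: "real set" where
  "Lam = UNIV - {0}"

definition field_measure :: "(real \<times> real) measure" where
  "field_measure = density (lebesgue_on (Lam \<times> UNIV)) (\<lambda>(\<xi>, t). ennreal \<bar>\<xi>\<bar>)"

definition L2_over :: "real set \<Rightarrow> (real \<times> real \<Rightarrow> complex) set" where
  "L2_over I = {f \<in> L2 field_measure. AE z in field_measure. fst z \<notin> I \<longrightarrow> f z = 0}"

definition That :: "real \<Rightarrow> real \<Rightarrow> real \<Rightarrow> (real \<times> real \<Rightarrow> complex) \<Rightarrow> real \<times> real \<Rightarrow> complex" where
  "That k l m f = (\<lambda>(\<xi>, t). cis (2 * pi * \<xi> * m) * cis (- 2 * pi * \<xi> * l * t) * f (\<xi>, t - k))"

definition unitary_multiplier :: "(real \<Rightarrow> real \<Rightarrow> complex) \<Rightarrow> bool" where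
  "unitary_multiplier u \<longleftrightarrow>
     (\<forall>a>0. u a \<in> borel_measurable (lebesgue_on Lam) \<and>
        (\<forall>\<xi>\<in>Lam. cmod (u a \<xi>) = 1 \<and> u (inverse a) \<xi> = cnj (u a \<xi>)))"

definition Dhat :: "(real \<Rightarrow> real \<Rightarrow> complex) \<Rightarrow> real \<Rightarrow> (real \<times> real \<Rightarrow> complex)
    \<Rightarrow> real \<times> real \<Rightarrow> complex" where
  "Dhat u a f = (\<lambda>(\<xi>, t). u a \<xi> * of_real (a powr (3/4)) * f (a * \<xi>, a powr (-1/2) * t))"

text \<open>The translation parameters in \<open>\<alpha>\<int>\<close> and \<open>\<beta>\<int>\<close> are \<open>\<alpha> * p\<close> and \<open>\<beta> * q\<close>
  with \<open>p\<close> and \<open>q\<close> integers.\<close>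

definition Uhat :: "(real \<times> real \<Rightarrow> complex) \<Rightarrow> real \<Rightarrow> real \<Rightarrow> (real \<Rightarrow> real \<Rightarrow> complex)
    \<Rightarrow> int \<times> int \<times> int \<times> int \<Rightarrow> real \<times> real \<Rightarrow> complex" where
  "Uhat g \<alpha> \<beta> u = (\<lambda>(j, p, q, m).
     Dhat u (2 powi j) (That (\<alpha> * of_int p) (\<beta> * of_int q) (of_int m) g))"

definition gabor_field :: "real set \<Rightarrow> real \<Rightarrow> real \<Rightarrow> (real \<times> real \<Rightarrow> complex) \<Rightarrow> bool" where
  "gabor_field I \<alpha> \<beta> g \<longleftrightarrow> g \<in> L2_over I \<and>
     (AE \<xi> in lebesgue. \<xi> \<in> I \<longrightarrow>
        parseval_frame lebesgue (\<lambda>(p :: int, q :: int) t.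
          of_real (\<bar>\<xi>\<bar> powr (1/2)) * cis (- 2 * pi * \<xi> * (\<beta> * of_int q) * t)
            * g (\<xi>, t - \<alpha> * of_int p)))"

definition is_wavelet :: "real set \<Rightarrow> (real \<times> real \<Rightarrow> complex) \<Rightarrow> bool" where
  "is_wavelet I g \<longleftrightarrow> g \<in> L2_over I \<and> parseval_frame field_measure (Uhat g 1 1 (\<lambda>_ _. 1))"

text \<open>Sets of reals are identified when they differ by a null set, so the bijection is only
  required between suitable representatives of the two classes.\<close>

definition dilation_congruent :: "real set \<Rightarrow> real set \<Rightarrow> bool" where
  "dilation_congruent I J \<longleftrightarrow>
     (\<exists>I'\<in>sets lebesgue. \<exists>J'\<in>sets lebesgue. ae_eq I' I \<and> ae_eq J' J \<and>
       (\<exists>(\<delta> :: real \<Rightarrow> real) (j :: real \<Rightarrow> int).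
          \<delta> \<in> borel_measurable (lebesgue_on I') \<and>
          j \<in> measurable (lebesgue_on I') (count_space UNIV) \<and>
          bij_betw \<delta> I' J' \<and> (\<forall>\<xi>\<in>I'. \<delta> \<xi> = 2 powi (j \<xi>) * \<xi>)))"

definition shannon_set :: "real set" where
  "shannon_set = {-1..<-1/2} \<union> {1/2..<1}"

end

theory Submission imports Defs begin

text \<open>The sum over a whole system is computed one dilation level at a time. The dilation at
  level \<open>j\<close> is unitary, so the coefficients of \<open>f\<close> at this level are the inner products of
  \<open>F\<close> with the translates \<open>T\<^bsub>k,l,m\<^esub> g\<close>, where \<open>F\<close> is the adjoint dilate of \<open>f\<close>. Such an inner
  product is the \<open>m\<close>-th Fourier coefficient, with period 1, of a function \<open>h\<^bsub>k,l\<^esub>\<close> of \<open>\<xi>\<close> that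
  vanishes off \<open>I\<close>. If the integer translates of \<open>I\<close> are disjoint up to null sets, the sum over \<open>m\<close> is the
  squared \<open>L\<^sup>2\<close> norm of \<open>h\<^bsub>k,l\<^esub>\<close> (\<open>parseval_disjoint_translates\<close>). The sum over \<open>k\<close> and \<open>l\<close>
  is then Parseval's identity of the Gabor system in the fibre over \<open>\<xi>\<close>, so that the level contributes the
  squared norm of \<open>F\<close> over \<open>I\<close> (\<open>gabor_translates_sum\<close>). Undoing the dilation and adding up the levels
  gives the integral of \<open>N |f|\<^sup>2\<close>, where \<open>N(\<xi>)\<close> is the number of integers \<open>j\<close> with
  \<open>2\<^sup>j \<xi>\<close> in \<open>I\<close> (\<open>Uhat_sum\<close>). This integral is determined by \<open>I\<close> and \<open>f\<close>, so (b) holds for all lattice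
  parameters, Gabor fields and multipliers as soon as \<open>N = 1\<close> almost everywhere and the integer translates of \<open>I\<close> are disjoint
  up to null sets.

  Both properties are read off from the hypothesis with explicit Gabor fields: over \<open>\<xi>\<close> the window is the
  indicator of \<open>[0,1)\<close> for positive \<open>\<xi>\<close> and of \<open>(-1,0]\<close> for negative \<open>\<xi>\<close>.

  For \<open>N = 1\<close>, take this window once as it stands and once with its sign changed for negative \<open>\<xi>\<close>.
  The parallelogram law turns the sum of the two frame sums into twice the frame sums of the restrictions to the two half-lines.
  Each half of \<open>I\<close> lies in a half-open interval of length 1, so its integer translates are disjoint and
  the computation above applies to it. The result is \<open>\<integral> |f|\<^sup>2 = \<integral> N |f|\<^sup>2\<close> for every \<open>f\<close>, and
  \<open>N = 1\<close> almost everywhere (\<open>wavelet_dilation_tiling\<close>). Since the Shannon set also meets every dyadic orbit exactly once,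
  moving each point of \<open>I\<close> along its orbit to the Shannon set is the bijection asked for in (a).

  For the translates, suppose that \<open>\<eta>\<close> and \<open>\<eta> + 1\<close> both belong to \<open>I\<close> for all \<open>\<eta>\<close> in a set
  \<open>B\<close> of positive measure in \<open>(-1,0)\<close>. The change of variable \<open>s = \<xi> t\<close> maps the windows over \<open>\<eta>\<close> and over
  \<open>\<eta> + 1\<close> to the intervals \<open>[0,|\<eta>|)\<close> and \<open>[0,1 - |\<eta>|)\<close>, which overlap; this is what the orientation of the window is for.
  A field that is \<open>-1\<close> over \<open>\<eta>\<close> and \<open>+1\<close> over \<open>\<eta> + 1\<close> on a common part of these intervals therefore
  has cancelling contributions in every coefficient, because the characters in \<open>\<xi>\<close> have period 1.
  It is a nonzero field orthogonal to the whole system, which is impossible for a Parseval frame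
  (\<open>wavelet_translation_packing\<close>).\<close>

section \<open>Sums over index sets and Fourier series on the unit interval\<close>

text \<open>Nonnegative sums are handled as extended nonnegative integrals over counting measure: there they can be
  reordered and exchanged with Lebesgue integrals without summability side conditions.\<close>

lemma has_sum_iff_nn_integral_count_space:
  fixes f :: "'i \<Rightarrow> real"
  assumes f: "\<And>i. 0 \<le> f i" and s: "0 \<le> s"
  shows "(f has_sum s) UNIV \<longleftrightarrow> (\<integral>\<^sup>+ i. ennreal (f i) \<partial>count_space UNIV) = ennreal s"
proof
  assume hs: "(f has_sum s) UNIV"
  then have "(\<lambda>i. norm (f i)) summable_on UNIV"
    using f by (simp add: has_sum_imp_summable)
  then have a: "Infinite_Set_Sum.abs_summable_on f UNIV"
    using abs_summable_equivalent[of f UNIV] by blast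
  show "(\<integral>\<^sup>+ i. ennreal (f i) \<partial>count_space UNIV) = ennreal s"
    using nn_integral_conv_infsetsum[OF a] f infsetsum_infsum[OF a] infsumI[OF hs] by simp
next
  assume eq: "(\<integral>\<^sup>+ i. ennreal (f i) \<partial>count_space UNIV) = ennreal s"
  have "integrable (count_space UNIV) f"
    by (rule integrableI_nonneg) (use f eq in auto)
  then have a: "Infinite_Set_Sum.abs_summable_on f UNIV"
    by (simp add: Infinite_Set_Sum.abs_summable_on_def)
  have "ennreal (infsum f UNIV) = ennreal s"
    using nn_integral_conv_infsetsum[OF a] f infsetsum_infsum[OF a] eq by simp
  moreover have "0 \<le> infsum f UNIV"
    using f by (rule infsum_nonneg)
  ultimately have "infsum f UNIV = s"
    using s by simp
  moreover have "f summable_on UNIV"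
    using a f by (simp add: abs_summable_equivalent[symmetric])
  ultimately show "(f has_sum s) UNIV"
    by (metis has_sum_infsum)
qed

lemma borel_measurable_cnj [measurable (raw)]:
  "f \<in> borel_measurable M \<Longrightarrow> (\<lambda>x. cnj (f x)) \<in> borel_measurable M"
  by (rule measurable_compose[OF _ borel_measurable_continuous_onI[OF continuous_on_cnj[OF continuous_on_id]]])

definition fourier_char :: "int \<Rightarrow> real \<Rightarrow> complex" where
  "fourier_char m x = cis (2 * pi * of_int m * x)"

lemma fourier_char_0 [simp]: "fourier_char 0 x = 1"
  by (simp add: fourier_char_def)

lemma norm_fourier_char [simp]: "cmod (fourier_char m x) = 1"
  by (simp add: fourier_char_def)

lemma fourier_char_mult: "fourier_char m x * fourier_char n x = fourier_char (m + n) x"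
  by (simp add: fourier_char_def cis_mult algebra_simps)

lemma cnj_fourier_char: "cnj (fourier_char m x) = fourier_char (- m) x"
  by (simp add: fourier_char_def cis_cnj)

lemma fourier_char_add_int [simp]: "fourier_char m (x + of_int n) = fourier_char m x"
proof -
  have "fourier_char m (x + of_int n) = fourier_char m x * cis (2 * pi * of_int (m * n))"
    by (simp add: fourier_char_def cis_mult algebra_simps)
  also have "cis (2 * pi * of_int (m * n)) = 1"
    by (rule cis_multiple_2pi) simp
  finally show ?thesis by simp
qed

lemma fourier_char_diff_int [simp]: "fourier_char m (x - of_int n) = fourier_char m x"
  using fourier_char_add_int[of m "x - of_int n" n] by simp

lemma continuous_fourier_char: "continuous_on S (fourier_char m)"
  unfolding fourier_char_def[abs_def] by (intro continuous_intros)

lemma fourier_char_measurable [measurable]: "fourier_char m \<in> borel_measurable borel"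
  by (rule borel_measurable_continuous_onI[OF continuous_fourier_char])

abbreviation unit_measure :: "real measure" where
  "unit_measure \<equiv> restrict_space lborel {0..<1}"

lemma finite_unit_measure: "finite_measure unit_measure"
  by (rule finite_measureI) (simp add: emeasure_restrict_space)

lemma unit_measurable [measurable (raw)]:
  "f \<in> borel_measurable borel \<Longrightarrow> f \<in> borel_measurable unit_measure"
  by (simp add: measurable_restrict_space1)

lemma integrable_unit_bounded:
  fixes f :: "real \<Rightarrow> complex"
  assumes [measurable]: "f \<in> borel_measurable borel" and B: "\<And>x. x \<in> {0..<1} \<Longrightarrow> cmod (f x) \<le> B"
  shows "integrable unit_measure f"
  by (rule finite_measure.integrable_const_bound[OF finite_unit_measure, where B = B])
    (auto simp: space_restrict_space intro!: AE_I2 B)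

lemma integral_fourier_char:
  "(\<integral>x. fourier_char k x \<partial>unit_measure) = (if k = 0 then 1 else 0)"
proof -
  have "(\<integral>x. fourier_char k x \<partial>unit_measure) = (LINT x:{0..<1}|lborel. fourier_char k x)"
    unfolding set_lebesgue_integral_def by (rule integral_restrict_space) simp
  also have "\<dots> = (LINT x:{0..1}|lborel. fourier_char k x)"
    unfolding set_lebesgue_integral_def
  proof (rule integral_cong_AE)
    show "AE x in lborel. indicator {0..<1} x *\<^sub>R fourier_char k x = indicator {0..1} x *\<^sub>R fourier_char k x"
      using AE_lborel_singleton[of "1::real"] by eventually_elim (auto simp: indicator_def)
  qed auto
  also have "\<dots> = (if k = 0 then 1 else 0)"
  proof (cases "k = 0")
    case True
    then show ?thesis by (simp add: set_lebesgue_integral_def)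
  next
    case False
    define F where "F x = fourier_char k x / (2 * pi * of_int k * \<i>)" for x
    have "(LINT x:{0..1}|lborel. fourier_char k x) = F 1 - F 0"
      unfolding set_lebesgue_integral_def
    proof (rule integral_FTC_Icc)
      fix x :: real
      have "((\<lambda>x. exp (x *\<^sub>R (2 * pi * of_int k * \<i>))) has_vector_derivative
          exp (x *\<^sub>R (2 * pi * of_int k * \<i>)) * (2 * pi * of_int k * \<i>)) (at x within {0..1})"
        by (rule exp_scaleR_has_vector_derivative_right)
      then have "(fourier_char k has_vector_derivative
          fourier_char k x * (2 * pi * of_int k * \<i>)) (at x within {0..1})"
        by (simp add: fourier_char_def[abs_def] cis_conv_exp scaleR_conv_of_real mult_ac)
      then show "(F has_vector_derivative fourier_char k x) (at x within {0..1})"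
        unfolding F_def[abs_def]
        by (rule has_vector_derivative_eq_rhs[OF has_vector_derivative_divide])
          (use False in \<open>simp add: field_simps\<close>)
    qed (auto intro: continuous_fourier_char)
    also have "\<dots> = 0"
      using fourier_char_add_int[of k 0 1] by (simp add: F_def)
    finally show ?thesis using False by simp
  qed
  finally show ?thesis .
qed

definition trig_poly :: "(real \<Rightarrow> complex) \<Rightarrow> bool" where
  "trig_poly f \<longleftrightarrow> (\<exists>A c. finite A \<and> f = (\<lambda>x. \<Sum>m\<in>A. c m * fourier_char m x))"

text \<open>The frequencies \<open>\<phi> k\<close> may repeat; this freedom is what makes closure under products immediate.\<close>

lemma trig_poly_sum:
  assumes "finite K"
  shows "trig_poly (\<lambda>x. \<Sum>k\<in>K. c k * fourier_char (\<phi> k) x)"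
  unfolding trig_poly_def
proof (intro exI conjI ext)
  show "finite (\<phi> ` K)" using assms by simp
  fix x
  show "(\<Sum>k\<in>K. c k * fourier_char (\<phi> k) x) =
      (\<Sum>m\<in>\<phi> ` K. (\<Sum>k | k \<in> K \<and> \<phi> k = m. c k) * fourier_char m x)"
    by (subst sum.image_gen[OF assms, of _ \<phi>]) (auto simp: sum_distrib_right intro!: sum.cong)
qed

lemma trig_poly_const: "trig_poly (\<lambda>x. a)"
  using trig_poly_sum[of "{()}" "\<lambda>_. a" "\<lambda>_. 0"] by simp

lemma trig_poly_add:
  assumes "trig_poly f" "trig_poly g"
  shows "trig_poly (\<lambda>x. f x + g x)"
proof -
  obtain A c B d where "finite A" "finite B" and
    f: "f = (\<lambda>x. \<Sum>m\<in>A. c m * fourier_char m x)" and g: "g = (\<lambda>x. \<Sum>m\<in>B. d m * fourier_char m x)"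
    using assms unfolding trig_poly_def by blast
  then show ?thesis
    using trig_poly_sum[of "A <+> B" "case_sum c d" "case_sum id id"] by (simp add: sum.Plus)
qed

lemma trig_poly_mult:
  assumes "trig_poly f" "trig_poly g"
  shows "trig_poly (\<lambda>x. f x * g x)"
proof -
  obtain A c B d where "finite A" "finite B" and
    f: "f = (\<lambda>x. \<Sum>m\<in>A. c m * fourier_char m x)" and g: "g = (\<lambda>x. \<Sum>m\<in>B. d m * fourier_char m x)"
    using assms unfolding trig_poly_def by blast
  then show ?thesis
    using trig_poly_sum[of "A \<times> B" "\<lambda>(m, n). c m * d n" "\<lambda>(m, n). m + n"]
    by (simp add: sum_product sum.cartesian_product fourier_char_mult[symmetric] mult_ac case_prod_unfold)
qed

lemma trig_poly_real_polynomial: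
  assumes "real_polynomial_function p"
  shows "trig_poly (\<lambda>x. of_real (p (cis (2 * pi * x))))"
  using assms
proof induction
  case (linear f)
  interpret bounded_linear f by fact
  have f: "f z = f 1 * Re z + f \<i> * Im z" for z
  proof -
    have "f z = f (Re z *\<^sub>R 1 + Im z *\<^sub>R \<i>)"
      by (rule arg_cong[of _ _ f]) (simp add: complex_eq_iff)
    then show ?thesis by (simp add: add scaleR)
  qed
  have "of_real (f (cis (2 * pi * x))) =
      (\<Sum>m\<in>{1, - 1}. (of_real (f 1) / 2 - of_int m * \<i> * of_real (f \<i>) / 2) * fourier_char m x)" for x
    by (subst f) (simp add: fourier_char_def complex_eq_iff field_simps)
  then show ?case
    using trig_poly_sum[of "{1, - 1}" "\<lambda>m. of_real (f 1) / 2 - of_int m * \<i> * of_real (f \<i>) / 2" "\<lambda>m. m"]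
    by simp
qed (auto intro: trig_poly_const trig_poly_add trig_poly_mult)

text \<open>A continuous loop on \<open>[0,1]\<close> is a continuous function on the circle, and polynomials in the real and
  imaginary part of a point of the circle are trigonometric polynomials; so this is the Stone--Weierstrass theorem.\<close>

lemma trig_poly_approx:
  assumes cont: "continuous_on {0..1} \<phi>" and loop: "\<phi> 0 = \<phi> 1" and e: "0 < e"
  shows "\<exists>p. trig_poly p \<and> (\<forall>x\<in>{0..<1}. cmod (\<phi> x - p x) < e)"
proof -
  define F where "F = \<phi> \<circ> (\<lambda>z. Arg2pi z / (2 * pi))"
  have "homotopic_loops UNIV \<phi> \<phi>"
    using cont loop by (simp add: homotopic_loops_refl path_def pathstart_def pathfinish_def)
  then have "continuous_on (sphere 0 1) F"
    unfolding F_def by (metis homotopic_loops_imp_homotopic_circlemaps homotopic_with_imp_continuous)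
  then obtain q where q: "polynomial_function q" "\<forall>z\<in>sphere 0 1. cmod (F z - q z) < e"
    using Stone_Weierstrass_polynomial_function[of "sphere 0 1" F e] e by auto
  define p where "p x = of_real ((Re \<circ> q) (cis (2 * pi * x))) + \<i> * of_real ((Im \<circ> q) (cis (2 * pi * x)))" for x
  have "real_polynomial_function (Re \<circ> q)" "real_polynomial_function (Im \<circ> q)"
    using q(1) bounded_linear_Re bounded_linear_Im unfolding polynomial_function_def by blast+
  then have "trig_poly p"
    unfolding p_def[abs_def]
    by (intro trig_poly_add trig_poly_mult trig_poly_const trig_poly_real_polynomial)
  moreover have "cmod (\<phi> x - p x) < e" if "x \<in> {0..<1}" for x
  proof -
    have "Arg2pi (cis (2 * pi * x)) = 2 * pi * x"
      by (rule Arg2pi_unique[of 1]) (use that in \<open>auto simp: cis_conv_exp\<close>)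
    then have "F (cis (2 * pi * x)) = \<phi> x"
      by (simp add: F_def)
    moreover have "q (cis (2 * pi * x)) = p x"
      by (simp add: p_def complex_eq_iff)
    ultimately show ?thesis
      using q(2)[rule_format, of "cis (2 * pi * x)"] by simp
  qed
  ultimately show ?thesis by blast
qed

text \<open>Bounds on all finite partial sums are the form in which Bessel's inequality and the Cauchy--Schwarz inequality
  deliver an estimate of the sum.\<close>

lemma nn_integral_count_space_le_iff:
  fixes f :: "'i \<Rightarrow> real"
  assumes f: "\<And>i. 0 \<le> f i" and C: "0 \<le> C"
  shows "(\<integral>\<^sup>+ i. ennreal (f i) \<partial>count_space UNIV) \<le> ennreal C \<longleftrightarrow> (\<forall>A. finite A \<longrightarrow> sum f A \<le> C)"
proof (intro iffI allI impI)
  fix A :: "'i set"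
  assume le: "(\<integral>\<^sup>+ i. ennreal (f i) \<partial>count_space UNIV) \<le> ennreal C" and A: "finite A"
  have "ennreal (sum f A) = (\<integral>\<^sup>+ i. ennreal (f i) \<partial>count_space A)"
    using A f by (simp add: nn_integral_count_space_finite sum_ennreal)
  also have "\<dots> = (\<integral>\<^sup>+ i. ennreal (f i) * indicator A i \<partial>count_space UNIV)"
    by (simp add: nn_integral_count_space_indicator)
  also have "\<dots> \<le> (\<integral>\<^sup>+ i. ennreal (f i) \<partial>count_space UNIV)"
    by (rule nn_integral_mono) (simp add: indicator_def)
  also note le
  finally show "sum f A \<le> C"
    using C by simp
next
  assume fin: "\<forall>A. finite A \<longrightarrow> sum f A \<le> C"
  then have "f summable_on UNIV"
    using f by (intro nonneg_bdd_above_summable_on) (auto intro!: bdd_aboveI[of _ C])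
  then have "(f has_sum infsum f UNIV) UNIV" "infsum f UNIV \<le> C"
    using fin by (auto intro: infsum_le_finite_sums)
  then show "(\<integral>\<^sup>+ i. ennreal (f i) \<partial>count_space UNIV) \<le> ennreal C"
    using has_sum_iff_nn_integral_count_space[of f "infsum f UNIV"] f
    by (simp add: infsum_nonneg ennreal_leI)
qed

lemma integrable_mult_char:
  assumes "integrable unit_measure H"
  shows "integrable unit_measure (\<lambda>x. H x * cnj (fourier_char m x))"
proof (rule Bochner_Integration.integrable_bound[OF assms])
  have [measurable]: "H \<in> borel_measurable unit_measure" using assms by auto
  show "(\<lambda>x. H x * cnj (fourier_char m x)) \<in> borel_measurable unit_measure" by measurable
qed (simp add: norm_mult)

lemma integral_trig_pairing:
  assumes H: "integrable unit_measure H" 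
  shows "(\<integral>x. H x * cnj (\<Sum>m\<in>A. c m * fourier_char m x) \<partial>unit_measure) =
    (\<Sum>m\<in>A. cnj (c m) * (\<integral>x. H x * cnj (fourier_char m x) \<partial>unit_measure))"
proof -
  have "(\<integral>x. H x * cnj (\<Sum>m\<in>A. c m * fourier_char m x) \<partial>unit_measure) =
     (\<integral>x. (\<Sum>m\<in>A. cnj (c m) * (H x * cnj (fourier_char m x))) \<partial>unit_measure)"
    by (simp add: sum_distrib_left mult_ac)
  also have "\<dots> = (\<Sum>m\<in>A. \<integral>x. cnj (c m) * (H x * cnj (fourier_char m x)) \<partial>unit_measure)"
    by (intro Bochner_Integration.integral_sum integrable_mult_right integrable_mult_char H)
  finally show ?thesis
    by simp
qed

lemma integral_trig_poly_norm:
  assumes "finite A"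
  shows "(\<integral>x. (cmod (\<Sum>m\<in>A. c m * fourier_char m x))\<^sup>2 \<partial>unit_measure) = (\<Sum>m\<in>A. (cmod (c m))\<^sup>2)"
proof -
  define p where "p x = (\<Sum>m\<in>A. c m * fourier_char m x)" for x
  have [measurable]: "p \<in> borel_measurable borel"
    unfolding p_def[abs_def] by measurable
  have p_int: "integrable unit_measure p"
    by (rule integrable_unit_bounded[where B = "\<Sum>m\<in>A. cmod (c m)"])
      (auto simp: p_def norm_mult intro!: sum_norm_le)
  have coeff: "(\<integral>x. p x * cnj (fourier_char n x) \<partial>unit_measure) = c n" if "n \<in> A" for n
  proof -
    have "(\<integral>x. p x * cnj (fourier_char n x) \<partial>unit_measure) =
        (\<integral>x. (\<Sum>m\<in>A. c m * fourier_char (m - n) x) \<partial>unit_measure)"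
      by (simp add: p_def sum_distrib_right cnj_fourier_char mult.assoc fourier_char_mult)
    also have "\<dots> = (\<Sum>m\<in>A. c m * (\<integral>x. fourier_char (m - n) x \<partial>unit_measure))"
      by (subst Bochner_Integration.integral_sum)
        (auto intro!: integrable_mult_right integrable_unit_bounded[where B = 1])
    also have "\<dots> = c n"
      using that assms by (simp add: integral_fourier_char if_distrib[of "\<lambda>u. c _ * u"] cong: if_cong)
    finally show ?thesis .
  qed
  have "of_real (\<integral>x. (cmod (p x))\<^sup>2 \<partial>unit_measure) = (\<integral>x. p x * cnj (p x) \<partial>unit_measure)"
    unfolding complex_norm_square[symmetric] integral_complex_of_real ..
  also have "\<dots> = (\<Sum>m\<in>A. cnj (c m) * (\<integral>x. p x * cnj (fourier_char m x) \<partial>unit_measure))"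
    unfolding p_def[of "_"] 
    by (subst integral_trig_pairing[symmetric]) (use p_int in \<open>simp_all add: p_def[abs_def]\<close>)
  also have "\<dots> = of_real (\<Sum>m\<in>A. (cmod (c m))\<^sup>2)"
    using coeff by (simp add: complex_norm_square mult.commute del: of_real_power)
  finally show ?thesis
    unfolding p_def of_real_eq_iff .
qed

text \<open>The nontrivial half of Parseval's identity is obtained by duality: a bound \<open>C\<close> for the sums of the squared
  Fourier coefficients of \<open>H\<close> bounds the pairing of \<open>H\<close> with test functions in the \<open>L\<^sup>2\<close> norm. For trigonometric
  polynomials this is the Cauchy--Schwarz inequality. The bound is then carried to continuous and to
  bounded measurable test functions, and finally tested against truncations of \<open>H\<close> itself. The
  argument also shows that an integrable \<open>H\<close> with square-summable coefficients is square integrable.\<close>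

lemma pairing_bound_trig_poly:
  assumes H: "integrable unit_measure H"
    and C: "\<And>A. finite A \<Longrightarrow> (\<Sum>m\<in>A. (cmod (\<integral>x. H x * cnj (fourier_char m x) \<partial>unit_measure))\<^sup>2) \<le> C"
    and p: "trig_poly p"
  shows "(cmod (\<integral>x. H x * cnj (p x) \<partial>unit_measure))\<^sup>2 \<le> C * (\<integral>x. (cmod (p x))\<^sup>2 \<partial>unit_measure)"
proof -
  obtain A c where A: "finite A" and p: "p = (\<lambda>x. \<Sum>m\<in>A. c m * fourier_char m x)"
    using p unfolding trig_poly_def by blast
  let ?h = "\<lambda>m. \<integral>x. H x * cnj (fourier_char m x) \<partial>unit_measure"
  have "cmod (\<integral>x. H x * cnj (p x) \<partial>unit_measure) \<le> (\<Sum>m\<in>A. cmod (c m) * cmod (?h m))"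
    unfolding p integral_trig_pairing[OF H] by (rule sum_norm_le) (simp add: norm_mult)
  then have "(cmod (\<integral>x. H x * cnj (p x) \<partial>unit_measure))\<^sup>2 \<le> (\<Sum>m\<in>A. cmod (c m) * cmod (?h m))\<^sup>2"
    by (rule power_mono) simp
  also have "\<dots> \<le> (\<Sum>m\<in>A. (cmod (c m))\<^sup>2) * (\<Sum>m\<in>A. (cmod (?h m))\<^sup>2)"
    by (rule Cauchy_Schwarz_ineq_sum)
  also have "\<dots> \<le> (\<Sum>m\<in>A. (cmod (c m))\<^sup>2) * C"
    by (intro mult_left_mono C A sum_nonneg) simp
  finally show ?thesis
    unfolding p integral_trig_poly_norm[OF A] by (simp add: mult.commute)
qed

lemma pairing_bound_limit:
  assumes H: "integrable unit_measure H"
    and meas [measurable]: "\<And>n. g n \<in> borel_measurable borel" "\<phi> \<in> borel_measurable borel"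
    and bnd: "\<And>n x. x \<in> {0..<1} \<Longrightarrow> cmod (g n x) \<le> B"
    and lim: "AE x in unit_measure. (\<lambda>n. g n x) \<longlonglongrightarrow> \<phi> x"
    and le: "\<And>n. (cmod (\<integral>x. H x * cnj (g n x) \<partial>unit_measure))\<^sup>2 \<le> C * (\<integral>x. (cmod (g n x))\<^sup>2 \<partial>unit_measure)"
  shows "(cmod (\<integral>x. H x * cnj (\<phi> x) \<partial>unit_measure))\<^sup>2 \<le> C * (\<integral>x. (cmod (\<phi> x))\<^sup>2 \<partial>unit_measure)"
proof (rule LIMSEQ_le)
  have [measurable]: "H \<in> borel_measurable unit_measure" using H by auto
  have bnd': "AE x in unit_measure. cmod (g n x) \<le> B" for n
    by (auto simp: space_restrict_space intro!: AE_I2 bnd)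
  have "(\<lambda>n. \<integral>x. H x * cnj (g n x) \<partial>unit_measure) \<longlonglongrightarrow> (\<integral>x. H x * cnj (\<phi> x) \<partial>unit_measure)"
  proof (rule integral_dominated_convergence[where w = "\<lambda>x. B * cmod (H x)"])
    show "AE x in unit_measure. (\<lambda>n. H x * cnj (g n x)) \<longlonglongrightarrow> H x * cnj (\<phi> x)"
      using lim by eventually_elim (intro tendsto_intros)
    show "AE x in unit_measure. cmod (H x * cnj (g n x)) \<le> B * cmod (H x)" for n
      using bnd'[of n] by eventually_elim (simp add: norm_mult mult.commute[of B] mult_left_mono)
  qed (use H in auto)
  then show "(\<lambda>n. (cmod (\<integral>x. H x * cnj (g n x) \<partial>unit_measure))\<^sup>2) \<longlonglongrightarrow>
      (cmod (\<integral>x. H x * cnj (\<phi> x) \<partial>unit_measure))\<^sup>2"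
    by (intro tendsto_intros)
  have "(\<lambda>n. \<integral>x. (cmod (g n x))\<^sup>2 \<partial>unit_measure) \<longlonglongrightarrow> (\<integral>x. (cmod (\<phi> x))\<^sup>2 \<partial>unit_measure)"
  proof (rule integral_dominated_convergence[where w = "\<lambda>x. B\<^sup>2"])
    show "AE x in unit_measure. (\<lambda>n. (cmod (g n x))\<^sup>2) \<longlonglongrightarrow> (cmod (\<phi> x))\<^sup>2"
      using lim by eventually_elim (intro tendsto_intros)
    show "AE x in unit_measure. norm ((cmod (g n x))\<^sup>2) \<le> B\<^sup>2" for n
      using bnd'[of n] by eventually_elim (simp add: power_mono)
    show "integrable unit_measure (\<lambda>x. B\<^sup>2)"
      using finite_measure.integrable_const[OF finite_unit_measure] by blast
  qed auto
  then show "(\<lambda>n. C * (\<integral>x. (cmod (g n x))\<^sup>2 \<partial>unit_measure)) \<longlonglongrightarrow> C * (\<integral>x. (cmod (\<phi> x))\<^sup>2 \<partial>unit_measure)"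
    by (intro tendsto_intros)
qed (use le in blast)

lemma trig_poly_measurable: "trig_poly p \<Longrightarrow> p \<in> borel_measurable borel"
  unfolding trig_poly_def by auto

lemma pairing_bound_continuous:
  assumes H: "integrable unit_measure H"
    and C: "\<And>A. finite A \<Longrightarrow> (\<Sum>m\<in>A. (cmod (\<integral>x. H x * cnj (fourier_char m x) \<partial>unit_measure))\<^sup>2) \<le> C"
    and cont: "continuous_on UNIV \<phi>" and loop: "\<phi> 0 = \<phi> 1"
  shows "(cmod (\<integral>x. H x * cnj (\<phi> x) \<partial>unit_measure))\<^sup>2 \<le> C * (\<integral>x. (cmod (\<phi> x))\<^sup>2 \<partial>unit_measure)"
proof -
  have cont': "continuous_on {0..1} \<phi>"
    using cont by (rule continuous_on_subset) simp
  have "\<exists>p. trig_poly p \<and> (\<forall>x\<in>{0..<1}. cmod (\<phi> x - p x) < inverse (real (Suc n)))" for n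
    by (rule trig_poly_approx[OF cont' loop]) simp
  then obtain p where p: "\<And>n. trig_poly (p n)"
      "\<And>n x. x \<in> {0..<1} \<Longrightarrow> cmod (\<phi> x - p n x) < inverse (real (Suc n))"
    by metis
  have "bounded (\<phi> ` {0..1})"
    by (intro compact_imp_bounded compact_continuous_image cont') simp
  then obtain B where B: "\<And>x. x \<in> {0..1} \<Longrightarrow> cmod (\<phi> x) \<le> B"
    unfolding bounded_iff by blast
  show ?thesis
  proof (rule pairing_bound_limit[OF H, where B = "B + 1" and g = p])
    show "cmod (p n x) \<le> B + 1" if "x \<in> {0..<1}" for n x
    proof -
      have "cmod (\<phi> x - p n x) \<le> 1"
        using p(2)[OF that, of n] inverse_le_1_iff[of "real (Suc n)"] by linarith
      then show ?thesis
        using B[of x] that norm_triangle_ineq2[of "p n x" "\<phi> x"] by (simp add: norm_minus_commute)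
    qed
    show "AE x in unit_measure. (\<lambda>n. p n x) \<longlonglongrightarrow> \<phi> x"
    proof (rule AE_I2)
      fix x assume "x \<in> space unit_measure"
      then have x: "x \<in> {0..<1}" by (simp add: space_restrict_space)
      have "(\<lambda>n. \<phi> x - p n x) \<longlonglongrightarrow> 0"
        by (rule Lim_null_comparison[OF _ LIMSEQ_inverse_real_of_nat]) (use p(2)[OF x] in \<open>auto intro!: always_eventually less_imp_le simp del: of_nat_Suc\<close>)
      from tendsto_diff[OF tendsto_const this, of "\<phi> x"] show "(\<lambda>n. p n x) \<longlonglongrightarrow> \<phi> x" by simp
    qed
  qed (use p(1) trig_poly_measurable pairing_bound_trig_poly[OF H C p(1)] borel_measurable_continuous_onI[OF cont]
       in auto)
qed

text \<open>A measurable function is almost everywhere the limit of continuous functions; cutting these off in modulus and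
  forcing them to vanish at 0 and 1 makes them a bounded sequence of loops.\<close>

lemma pairing_bound_bounded:
  assumes H: "integrable unit_measure H"
    and C: "\<And>A. finite A \<Longrightarrow> (\<Sum>m\<in>A. (cmod (\<integral>x. H x * cnj (fourier_char m x) \<partial>unit_measure))\<^sup>2) \<le> C"
    and [measurable]: "\<phi> \<in> borel_measurable borel" and B: "\<And>x. cmod (\<phi> x) \<le> B"
  shows "(cmod (\<integral>x. H x * cnj (\<phi> x) \<partial>unit_measure))\<^sup>2 \<le> C * (\<integral>x. (cmod (\<phi> x))\<^sup>2 \<partial>unit_measure)"
proof -
  have B': "cmod (\<phi> x) \<le> B + 1" for x
    using B[of x] by simp
  have B1: "0 < B + 1"
    using B[of 0] norm_ge_zero[of "\<phi> 0"] by linarith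
  have "\<phi> measurable_on UNIV"
    by (subst measurable_on_iff_borel_measurable) (auto simp: lebesgue_on_UNIV_eq intro!: measurable_completion)
  then obtain N g where N: "negligible N" and g: "\<And>n. continuous_on UNIV (g n)"
      and lim: "\<And>x. x \<notin> N \<Longrightarrow> (\<lambda>n. g n x) \<longlonglongrightarrow> \<phi> x"
    unfolding measurable_on_def by auto
  \<comment> \<open>The first factor is a trapezoid that is 0 at both endpoints and tends to 1 inside \<open>(0,1)\<close>; the second
    truncates the modulus at \<open>B + 1\<close>, which leaves the limit unchanged.\<close>
  define k where "k n x = of_real (max 0 (min 1 (real n * (x * (1 - x)))) * ((B + 1) / max (B + 1) (cmod (g n x)))) * g n x" for n x
  have cont: "continuous_on UNIV (k n)" for n
    unfolding k_def using B1 by (intro continuous_intros g) (auto simp: max_def)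
  show ?thesis
  proof (rule pairing_bound_limit[OF H, where B = "B + 1" and g = k])
    show "cmod (k n x) \<le> B + 1" for n x
    proof -
      have "(B + 1) / max (B + 1) (cmod (g n x)) * cmod (g n x) \<le> B + 1"
        using B1 by (cases "B + 1 \<le> cmod (g n x)") (auto simp: max_def)
      moreover have "cmod (k n x) = max 0 (min 1 (real n * (x * (1 - x)))) *
          ((B + 1) / max (B + 1) (cmod (g n x)) * cmod (g n x))"
        using B1 unfolding k_def norm_mult norm_of_real abs_mult by simp
      moreover have "max 0 (min 1 (real n * (x * (1 - x)))) \<le> 1"
        by simp
      ultimately show ?thesis
        using B1 mult_mono[of "max 0 (min 1 (real n * (x * (1 - x))))" 1
            "(B + 1) / max (B + 1) (cmod (g n x)) * cmod (g n x)" "B + 1"] by simp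
    qed
    have "AE x in lebesgue. x \<notin> N"
      using N by (simp add: negligible_iff_null_sets AE_not_in)
    then have "AE x in lborel. x \<notin> N"
      by (simp add: AE_completion_iff)
    then have "AE x in lborel. x \<in> {0..<1} \<longrightarrow> (\<lambda>n. k n x) \<longlonglongrightarrow> \<phi> x"
      using AE_lborel_singleton[of "0::real"]
    proof eventually_elim
      case (elim x)
      show ?case
      proof
        assume "x \<in> {0..<1}"
        with elim have x: "0 < x * (1 - x)" by simp
        have "\<forall>\<^sub>F n in sequentially. 1 \<le> real n * (x * (1 - x))"
          using eventually_ge_at_top[of "nat \<lceil>1 / (x * (1 - x))\<rceil>"]
          by eventually_elim (use x in \<open>simp add: field_simps nat_ceiling_le_eq\<close>)
        then have "\<forall>\<^sub>F n in sequentially. max 0 (min 1 (real n * (x * (1 - x)))) = 1"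
          by eventually_elim simp
        then have "(\<lambda>n. max 0 (min 1 (real n * (x * (1 - x))))) \<longlonglongrightarrow> 1"
          by (rule tendsto_eventually)
        moreover have "(\<lambda>n. g n x) \<longlonglongrightarrow> \<phi> x" using lim elim by blast
        ultimately have "(\<lambda>n. k n x) \<longlonglongrightarrow>
            of_real (1 * ((B + 1) / max (B + 1) (cmod (\<phi> x)))) * \<phi> x"
          unfolding k_def using B1 by (intro tendsto_intros) auto
        also have "of_real (1 * ((B + 1) / max (B + 1) (cmod (\<phi> x)))) * \<phi> x = \<phi> x"
          using B'[of x] B1 by (simp add: max_absorb1)
        finally show "(\<lambda>n. k n x) \<longlonglongrightarrow> \<phi> x" .
      qed
    qed
    then show "AE x in unit_measure. (\<lambda>n. k n x) \<longlonglongrightarrow> \<phi> x"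
      by (simp add: AE_restrict_space_iff)
    show "k n \<in> borel_measurable borel" for n
      by (rule borel_measurable_continuous_onI[OF cont])
    show "(cmod (\<integral>x. H x * cnj (k n x) \<partial>unit_measure))\<^sup>2 \<le> C * (\<integral>x. (cmod (k n x))\<^sup>2 \<partial>unit_measure)" for n
      by (rule pairing_bound_continuous[OF H C cont]) (simp_all add: k_def)
  qed auto
qed

text \<open>The inequality from left to right is Bessel's. For the other one, testing with \<open>H\<close> cut off at the
  height \<open>k\<close> gives \<open>a\<^sup>2 \<le> C a\<close> for \<open>a\<close> the squared norm of the truncation; then \<open>k\<close> tends to infinity.\<close>

theorem parseval_unit_interval:
  assumes H: "integrable unit_measure H" and [measurable]: "H \<in> borel_measurable borel"
  shows "(\<integral>\<^sup>+ m. ennreal ((cmod (\<integral>x. H x * cnj (fourier_char m x) \<partial>unit_measure))\<^sup>2) \<partial>count_space UNIV)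
    = (\<integral>\<^sup>+ x. ennreal ((cmod (H x))\<^sup>2) \<partial>unit_measure)" (is "?S = ?I")
proof (rule antisym)
  let ?h = "\<lambda>m. \<integral>x. H x * cnj (fourier_char m x) \<partial>unit_measure"
  show "?S \<le> ?I"
  proof (cases "?I = \<infinity>")
    case False
    then have H2: "integrable unit_measure (\<lambda>x. (cmod (H x))\<^sup>2)"
      by (intro integrableI_nonneg) (auto simp: less_top)
    then have I: "?I = ennreal (\<integral>x. (cmod (H x))\<^sup>2 \<partial>unit_measure)"
      by (intro nn_integral_eq_integral) auto
    have "(\<Sum>m\<in>A. (cmod (?h m))\<^sup>2) \<le> (\<integral>x. (cmod (H x))\<^sup>2 \<partial>unit_measure)" if A: "finite A" for A
    proof -
      define s where "s = (\<Sum>m\<in>A. (cmod (?h m))\<^sup>2)"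
      define p where "p x = (\<Sum>m\<in>A. ?h m * fourier_char m x)" for x
      have [measurable]: "p \<in> borel_measurable borel"
        unfolding p_def[abs_def] by measurable
      have bp: "cmod (p x) \<le> (\<Sum>m\<in>A. cmod (?h m))" for x
        by (auto simp: p_def norm_mult intro!: sum_norm_le)
      have [measurable]: "H \<in> borel_measurable unit_measure" using H by auto
      have Hp: "integrable unit_measure (\<lambda>x. H x * cnj (p x))"
        by (rule Bochner_Integration.integrable_bound[where f = "\<lambda>x. (\<Sum>m\<in>A. cmod (?h m)) *\<^sub>R H x"])
          (use H bp in \<open>auto simp: norm_mult abs_of_nonneg[OF sum_nonneg] mult.commute[of "sum _ _"] intro!: mult_left_mono AE_I2\<close>)
      have pp: "integrable unit_measure (\<lambda>x. (cmod (p x))\<^sup>2)"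
        by (rule finite_measure.integrable_const_bound[OF finite_unit_measure, where B = "(\<Sum>m\<in>A. cmod (?h m))\<^sup>2"])
          (use bp in \<open>auto intro!: power_mono AE_I2\<close>)
      have "(\<integral>x. H x * cnj (p x) \<partial>unit_measure) = of_real s"
        unfolding p_def integral_trig_pairing[OF H] s_def by (simp add: complex_norm_square mult.commute del: of_real_power)
      then have "(\<integral>x. Re (H x * cnj (p x)) \<partial>unit_measure) = s"
        using Hp by (simp add: integral_Re del: times_complex.sel)
      moreover have "(\<integral>x. (cmod (p x))\<^sup>2 \<partial>unit_measure) = s"
        unfolding p_def s_def by (rule integral_trig_poly_norm[OF A])
      moreover have "(\<integral>x. (cmod (H x - p x))\<^sup>2 \<partial>unit_measure) =
          (\<integral>x. (cmod (H x))\<^sup>2 - 2 * Re (H x * cnj (p x)) + (cmod (p x))\<^sup>2 \<partial>unit_measure)"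
        by (rule Bochner_Integration.integral_cong) (simp_all add: cmod_power2, algebra)
      moreover have "\<dots> = (\<integral>x. (cmod (H x))\<^sup>2 \<partial>unit_measure) - 2 * (\<integral>x. Re (H x * cnj (p x)) \<partial>unit_measure)
          + (\<integral>x. (cmod (p x))\<^sup>2 \<partial>unit_measure)"
        by (subst Bochner_Integration.integral_add Bochner_Integration.integral_diff,
            (intro Bochner_Integration.integrable_diff integrable_mult_right integrable_Re H2 Hp pp)+)+
          (simp only: integral_mult_right_zero)
      moreover have "0 \<le> (\<integral>x. (cmod (H x - p x))\<^sup>2 \<partial>unit_measure)"
        by (rule Bochner_Integration.integral_nonneg) simp
      ultimately show ?thesis
        unfolding s_def[symmetric] by linarith
    qed
    then show ?thesis
      unfolding I by (subst nn_integral_count_space_le_iff) (auto intro!: Bochner_Integration.integral_nonneg)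
  qed simp
next
  let ?h = "\<lambda>m. \<integral>x. H x * cnj (fourier_char m x) \<partial>unit_measure"
  show "?I \<le> ?S"
  proof (cases "?S = \<infinity>")
    case False
    then obtain C where S: "?S = ennreal C" and C0: "0 \<le> C"
      by (cases ?S) auto
    then have C: "(\<Sum>m\<in>A. (cmod (?h m))\<^sup>2) \<le> C" if "finite A" for A
      using nn_integral_count_space_le_iff[of "\<lambda>m. (cmod (?h m))\<^sup>2" C] that by simp
    define \<phi> where "\<phi> k x = (if cmod (H x) \<le> real k then H x else 0)" for k x
    have [measurable]: "\<phi> k \<in> borel_measurable borel" for k
      unfolding \<phi>_def[abs_def] by measurable
    have bound: "(\<integral>\<^sup>+ x. ennreal ((cmod (\<phi> k x))\<^sup>2) \<partial>unit_measure) \<le> ennreal C" for k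
    proof -
      let ?a = "\<integral>x. (cmod (\<phi> k x))\<^sup>2 \<partial>unit_measure"
      have b: "cmod (\<phi> k x) \<le> real k" for x
        by (simp add: \<phi>_def)
      have int: "integrable unit_measure (\<lambda>x. (cmod (\<phi> k x))\<^sup>2)"
        by (rule finite_measure.integrable_const_bound[OF finite_unit_measure, where B = "(real k)\<^sup>2"])
          (use b in \<open>auto intro!: AE_I2 power_mono\<close>)
      have "(\<integral>x. H x * cnj (\<phi> k x) \<partial>unit_measure) = of_real ?a"
        unfolding integral_complex_of_real[symmetric]
        by (rule Bochner_Integration.integral_cong) (auto simp: \<phi>_def complex_norm_square simp del: of_real_power)
      then have "?a\<^sup>2 \<le> C * ?a"
        using pairing_bound_bounded[OF H C, of "\<phi> k" "real k"] b by simp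
      then have "?a \<le> C"
        using C0 by (cases "?a \<le> 0") (auto simp: power2_eq_square)
      then show ?thesis
        using int C0 by (subst nn_integral_eq_integral) auto
    qed
    have "?I = (\<integral>\<^sup>+ x. (SUP k. ennreal ((cmod (\<phi> k x))\<^sup>2)) \<partial>unit_measure)"
    proof (rule nn_integral_cong)
      fix x
      obtain k where k: "cmod (H x) \<le> real k" using real_arch_simple by blast
      show "ennreal ((cmod (H x))\<^sup>2) = (SUP k. ennreal ((cmod (\<phi> k x))\<^sup>2))"
      proof (rule antisym)
        show "ennreal ((cmod (H x))\<^sup>2) \<le> (SUP k. ennreal ((cmod (\<phi> k x))\<^sup>2))"
          by (rule SUP_upper2[of k]) (use k in \<open>auto simp: \<phi>_def\<close>)
        show "(SUP k. ennreal ((cmod (\<phi> k x))\<^sup>2)) \<le> ennreal ((cmod (H x))\<^sup>2)"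
          by (rule SUP_least) (auto simp: \<phi>_def)
      qed
    qed
    also have "\<dots> = (SUP k. \<integral>\<^sup>+ x. ennreal ((cmod (\<phi> k x))\<^sup>2) \<partial>unit_measure)"
    proof (rule nn_integral_monotone_convergence_SUP)
      show "incseq (\<lambda>k x. ennreal ((cmod (\<phi> k x))\<^sup>2))"
        by (auto simp: incseq_def le_fun_def \<phi>_def)
    qed measurable
    also have "\<dots> \<le> ?S"
      unfolding S by (rule SUP_least) (rule bound)
    finally show ?thesis .
  qed simp
qed

section \<open>Fourier coefficients of functions with disjoint integer translates\<close>

lemma cmod_sum_squared_single:
  assumes "finite J" and J: "\<And>m n. m \<in> J \<Longrightarrow> n \<in> J \<Longrightarrow> m \<noteq> n \<Longrightarrow> a m = 0 \<or> a n = 0"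
  shows "(cmod (\<Sum>n\<in>J. a n))\<^sup>2 = (\<Sum>n\<in>J. (cmod (a n))\<^sup>2)"
proof (cases "\<forall>n\<in>J. a n = 0")
  case False
  then obtain k where k: "k \<in> J" "a k \<noteq> 0" by blast
  have "a n = 0" if "n \<in> J - {k}" for n
    using J[of n k] k that by auto
  then have "(\<Sum>n\<in>J. a n) = a k" "(\<Sum>n\<in>J. (cmod (a n))\<^sup>2) = (cmod (a k))\<^sup>2"
    using k(1) assms(1) by (simp_all add: sum.remove[of J k])
  then show ?thesis by simp
qed simp

lemma sum_indicator_unit_intervals:
  "(\<Sum>n\<in>{- int N..<int N}. indicator {of_int n..<of_int n + 1} y) = (indicator {- real N..<real N} y :: real)"
proof -
  have "indicator {of_int n..<of_int n + 1} y = (if n = \<lfloor>y\<rfloor> then 1 else 0 :: real)" for n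
    by (auto simp: indicator_def floor_eq_iff floor_unique[symmetric])
  then show ?thesis
    by (auto simp: indicator_def le_floor_iff floor_less_iff)
qed

lemma integral_unit_shift:
  fixes f :: "real \<Rightarrow> complex"
  shows "(\<integral>x. f (x + of_int n) \<partial>unit_measure) = (\<integral>x. indicator {of_int n..<of_int n + 1} x *\<^sub>R f x \<partial>lborel)"
  by (subst integral_restrict_space, simp, subst lborel_integral_real_affine[where c = 1 and t = "of_int n"])
    (auto simp: indicator_def add.commute intro!: Bochner_Integration.integral_cong)

lemma nn_integral_unit_shift:
  assumes [measurable]: "f \<in> borel_measurable borel"
  shows "(\<integral>\<^sup>+x. f (x + of_int n) \<partial>unit_measure) = (\<integral>\<^sup>+x. f x * indicator {of_int n..<of_int n + 1} x \<partial>lborel)"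
  by (subst nn_integral_restrict_space, simp, subst nn_integral_real_affine[where c = 1 and t = "of_int n"])
    (auto simp: indicator_def add.commute intro!: nn_integral_cong)

lemma integrable_unit_shift:
  fixes h :: "real \<Rightarrow> complex"
  assumes "integrable lborel h"
  shows "integrable unit_measure (\<lambda>x. h (x + c))"
proof -
  have "integrable lborel (\<lambda>x. h (c + 1 * x))"
    using assms by (rule lborel_integrable_real_affine) simp
  then show ?thesis
    by (subst integrable_restrict_space)
      (auto simp: add.commute intro!: integrable_mult_indicator)
qed

text \<open>Periodizing \<open>h\<close> does not change the coefficients at integer frequencies. When the integer translates of the
  support are disjoint it also preserves the squared norm, because at almost every point only one summand of the
  periodization is nonzero.\<close>

theorem parseval_disjoint_translates:
  fixes h :: "real \<Rightarrow> complex"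
  assumes h: "integrable lborel h"
    and supp: "AE x in lborel. h x \<noteq> 0 \<longrightarrow> x \<in> {- real N..<real N}"
    and disj: "\<And>n::int. n \<noteq> 0 \<Longrightarrow> AE x in lborel. h x = 0 \<or> h (x + of_int n) = 0"
  shows "(\<integral>\<^sup>+ m. ennreal ((cmod (\<integral>x. h x * cnj (fourier_char m x) \<partial>lborel))\<^sup>2) \<partial>count_space UNIV)
    = (\<integral>\<^sup>+ x. ennreal ((cmod (h x))\<^sup>2) \<partial>lborel)"
proof -
  have h_meas [measurable]: "h \<in> borel_measurable borel" using h by auto
  define J where "J = {- int N..<int N}"
  define H where "H x = (\<Sum>n\<in>J. h (x + of_int n))" for x
  have [measurable]: "H \<in> borel_measurable borel"
    unfolding H_def[abs_def] by measurable
  have H: "integrable unit_measure H"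
    unfolding H_def[abs_def] by (intro Bochner_Integration.integrable_sum integrable_unit_shift h)
  have hc: "integrable lborel (\<lambda>x. h x * cnj (fourier_char m x))" for m
    by (rule Bochner_Integration.integrable_bound[OF h]) (auto simp: norm_mult)
  have coeff: "(\<integral>x. H x * cnj (fourier_char m x) \<partial>unit_measure) = (\<integral>x. h x * cnj (fourier_char m x) \<partial>lborel)" for m
  proof -
    let ?F = "\<lambda>x. h x * cnj (fourier_char m x)"
    have "(\<integral>x. H x * cnj (fourier_char m x) \<partial>unit_measure) = (\<integral>x. (\<Sum>n\<in>J. ?F (x + of_int n)) \<partial>unit_measure)"
      by (simp add: H_def sum_distrib_right)
    also have "\<dots> = (\<Sum>n\<in>J. \<integral>x. ?F (x + of_int n) \<partial>unit_measure)"
      by (intro Bochner_Integration.integral_sum integrable_unit_shift[OF hc])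
    also have "\<dots> = (\<Sum>n\<in>J. \<integral>x. indicator {of_int n..<of_int n + 1} x *\<^sub>R ?F x \<partial>lborel)"
      by (intro sum.cong refl integral_unit_shift)
    also have "\<dots> = (\<integral>x. (\<Sum>n\<in>J. indicator {of_int n..<of_int n + 1} x *\<^sub>R ?F x) \<partial>lborel)"
      by (intro Bochner_Integration.integral_sum[symmetric] integrable_mult_indicator hc) simp
    also have "\<dots> = (\<integral>x. indicator {- real N..<real N} x *\<^sub>R ?F x \<partial>lborel)"
      unfolding J_def scaleR_sum_left[symmetric] sum_indicator_unit_intervals ..
    also have "\<dots> = (\<integral>x. ?F x \<partial>lborel)"
    proof (rule integral_cong_AE)
      show "AE x in lborel. indicator {- real N..<real N} x *\<^sub>R ?F x = ?F x"
        using supp by eventually_elim (auto simp: indicator_def)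
    qed auto
    finally show ?thesis .
  qed
  have "AE x in lborel. \<forall>p\<in>J \<times> J. fst p \<noteq> snd p \<longrightarrow> h (x + of_int (fst p)) = 0 \<or> h (x + of_int (snd p)) = 0"
  proof (rule AE_finite_allI)
    fix p assume "p \<in> J \<times> J"
    show "AE x in lborel. fst p \<noteq> snd p \<longrightarrow> h (x + of_int (fst p)) = 0 \<or> h (x + of_int (snd p)) = 0"
    proof (cases "fst p = snd p")
      case False
      have "AE x in lborel. h (of_int (fst p) + 1 * x) = 0 \<or> h (of_int (fst p) + 1 * x + of_int (snd p - fst p)) = 0"
        by (rule AE_borel_affine[OF _ _ disj]) (use False in auto)
      then show ?thesis
        by eventually_elim (simp add: add_ac)
    qed simp
  qed (simp add: J_def)
  then have "AE x in lborel. x \<in> {0..<1} \<longrightarrow> ennreal ((cmod (H x))\<^sup>2) = (\<Sum>n\<in>J. ennreal ((cmod (h (x + of_int n)))\<^sup>2))"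
  proof eventually_elim
    case (elim x)
    have "(cmod (H x))\<^sup>2 = (\<Sum>n\<in>J. (cmod (h (x + of_int n)))\<^sup>2)"
      unfolding H_def by (rule cmod_sum_squared_single) (use elim in \<open>auto simp: J_def\<close>)
    then show ?case by (simp add: sum_ennreal)
  qed
  then have "AE x in unit_measure. ennreal ((cmod (H x))\<^sup>2) = (\<Sum>n\<in>J. ennreal ((cmod (h (x + of_int n)))\<^sup>2))"
    by (simp add: AE_restrict_space_iff)
  then have "(\<integral>\<^sup>+ x. ennreal ((cmod (H x))\<^sup>2) \<partial>unit_measure) =
      (\<integral>\<^sup>+ x. (\<Sum>n\<in>J. ennreal ((cmod (h (x + of_int n)))\<^sup>2)) \<partial>unit_measure)"
    by (rule nn_integral_cong_AE)
  also have "\<dots> = (\<Sum>n\<in>J. \<integral>\<^sup>+ x. ennreal ((cmod (h (x + of_int n)))\<^sup>2) \<partial>unit_measure)"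
    by (rule nn_integral_sum) measurable
  also have "\<dots> = (\<Sum>n\<in>J. \<integral>\<^sup>+ x. ennreal ((cmod (h x))\<^sup>2) * indicator {of_int n..<of_int n + 1} x \<partial>lborel)"
    by (intro sum.cong refl nn_integral_unit_shift) measurable
  also have "\<dots> = (\<integral>\<^sup>+ x. (\<Sum>n\<in>J. ennreal ((cmod (h x))\<^sup>2) * indicator {of_int n..<of_int n + 1} x) \<partial>lborel)"
    by (rule nn_integral_sum[symmetric]) measurable
  also have "\<dots> = (\<integral>\<^sup>+ x. ennreal ((cmod (h x))\<^sup>2) \<partial>lborel)"
  proof (rule nn_integral_cong_AE)
    show "AE x in lborel. (\<Sum>n\<in>J. ennreal ((cmod (h x))\<^sup>2) * indicator {of_int n..<of_int n + 1} x) = ennreal ((cmod (h x))\<^sup>2)"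
      using supp
    proof eventually_elim
      case (elim x)
      have "(\<Sum>n\<in>J. ennreal ((cmod (h x))\<^sup>2) * indicator {of_int n..<of_int n + 1} x) =
          ennreal ((cmod (h x))\<^sup>2) * ennreal (\<Sum>n\<in>J. indicator {of_int n..<of_int n + 1} x)"
        by (simp add: sum_distrib_left sum_ennreal[symmetric] ennreal_indicator)
      then show ?case
        using elim unfolding J_def sum_indicator_unit_intervals by (cases "h x = 0") auto
    qed
  qed
  finally show ?thesis
    using parseval_unit_interval[OF H] by (simp add: coeff)
qed

section \<open>Lebesgue measure on the plane and the field measure\<close>

lemma AE_lebesgue_iff: "(AE x in lebesgue. P x) \<longleftrightarrow> (AE x in lborel. P x)"
  by (rule AE_completion_iff)

lemma null_sets_lborel_fst:
  assumes "N \<in> null_sets (lborel :: real measure)"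
  shows "N \<times> UNIV \<in> null_sets (lborel :: (real \<times> real) measure)"
  using lborel.times_in_null_sets1[OF assms, of UNIV] by (simp add: lborel_prod)

lemma borel_measurable_fst_prod [measurable]: "fst \<in> borel_measurable (borel :: (real \<times> real) measure)"
  and borel_measurable_snd_prod [measurable]: "snd \<in> borel_measurable (borel :: (real \<times> real) measure)"
  by (intro borel_measurable_continuous_onI continuous_intros)+

text \<open>Lebesgue measure is complete. Together with \<open>lebesgue_ex_borel\<close> this allows passing freely between Lebesgue
  measurable functions and Borel representatives, for which Fubini's theorem is available.\<close>

lemma lebesgue_measurable_AE:
  fixes f f' :: "'a::euclidean_space \<Rightarrow> 'b::topological_space"
  assumes f': "f' \<in> borel_measurable lebesgue" and ae: "AE x in lebesgue. f x = f' x"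
  shows "f \<in> borel_measurable lebesgue"
proof (rule measurableI)
  fix A :: "'b set" assume A: "A \<in> sets borel"
  have "f -` A \<in> sets lebesgue"
  proof (rule completion.in_sets_AE)
    show "f' -` A \<in> sets lebesgue"
      using measurable_sets[OF f' A] by simp
    show "AE x in lebesgue. (x \<in> f' -` A) = (x \<in> f -` A)"
      using ae by eventually_elim simp
  qed simp
  then show "f -` A \<inter> space lebesgue \<in> sets lebesgue" by simp
qed simp

lemma AE_lborel_fst:
  assumes "AE x in (lborel :: real measure). P x"
  shows "AE z in (lborel :: (real \<times> real) measure). P (fst z)"
proof -
  obtain N where N: "N \<in> null_sets lborel" "{x \<in> space lborel. \<not> P x} \<subseteq> N"
    using assms unfolding eventually_ae_filter by blast
  show ?thesis
    by (rule AE_I'[OF null_sets_lborel_fst[OF N(1)]]) (use N(2) in auto)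
qed

lemma AE_lborel_sections:
  assumes "AE z in (lborel :: (real \<times> real) measure). P z"
  shows "AE x in lborel. AE y in lborel. P (x, y)"
proof (rule lborel_pair.AE_pair)
  show "AE z in (lborel :: real measure) \<Otimes>\<^sub>M (lborel :: real measure). P z"
    using assms unfolding lborel_prod .
qed

text \<open>Not a consequence of Borel measurability of the projection: the preimage of a null set has to be a null set as well.\<close>

lemma measurable_fst_lebesgue: "fst \<in> (lebesgue :: (real \<times> real) measure) \<rightarrow>\<^sub>M (lebesgue :: real measure)"
proof (rule measurableI)
  fix A assume "A \<in> sets (lebesgue :: real measure)"
  then obtain S N N' where A: "A = S \<union> N" "N \<subseteq> N'" "N' \<in> null_sets lborel" "S \<in> sets lborel"
    by (rule sets_completionE)
  have "fst -` A \<inter> space (lebesgue :: (real \<times> real) measure) = S \<times> UNIV \<union> N \<times> UNIV"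
    using A(1) by auto
  moreover have "S \<times> UNIV \<in> sets (lborel :: (real \<times> real) measure)"
    using A(4) by (simp add: borel_Times)
  ultimately show "fst -` A \<inter> space lebesgue \<in> sets (lebesgue :: (real \<times> real) measure)"
    using A(2) null_sets_lborel_fst[OF A(3)] by (intro sets_completionI[where N' = "N' \<times> UNIV" and S = "S \<times> UNIV" and N = "N \<times> UNIV"]) auto
qed simp

lemma lebesgue_ex_borel:
  fixes f :: "'a::euclidean_space \<Rightarrow> complex"
  assumes "f \<in> borel_measurable lebesgue"
  obtains f' where "f' \<in> borel_measurable borel" "AE x in lborel. f x = f' x"
proof -
  have "(\<lambda>x. Re (f x)) \<in> borel_measurable lebesgue" "(\<lambda>x. Im (f x)) \<in> borel_measurable lebesgue"
    using assms by (simp_all add: borel_measurable_complex_iff)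
  then obtain r i where ri: "r \<in> borel_measurable borel" "i \<in> borel_measurable borel"
      and ae: "AE x in lborel. Re (f x) = r x" "AE x in lborel. Im (f x) = i x"
    using completion_ex_borel_measurable_real[of "\<lambda>x. Re (f x)" lborel]
      completion_ex_borel_measurable_real[of "\<lambda>x. Im (f x)" lborel] by auto
  show thesis
  proof (rule that[of "\<lambda>x. Complex (r x) (i x)"])
    show "(\<lambda>x. Complex (r x) (i x)) \<in> borel_measurable borel"
      using ri by (simp add: borel_measurable_complex_iff)
    show "AE x in lborel. f x = Complex (r x) (i x)"
      using ae by eventually_elim (simp add: complex_eq_iff)
  qed
qed

lemma lebesgue_prod_affine:
  fixes a b c :: real
  assumes "a \<noteq> 0" "b \<noteq> 0"
  defines "T \<equiv> \<lambda>z :: real \<times> real. (a * fst z, b * snd z + c)"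
  shows measurable_prod_affine: "T \<in> lebesgue \<rightarrow>\<^sub>M lebesgue"
    and lebesgue_prod_affine_eq: "lebesgue = density (distr lebesgue lebesgue T) (\<lambda>_. ennreal \<bar>a * b\<bar>)"
proof -
  define k where "k j = (if j = (1::real, 0::real) then a else b)" for j
  have T: "T = (\<lambda>z. (0, c) + (\<Sum>j\<in>Basis. (k j * (z \<bullet> j)) *\<^sub>R j))"
    by (auto simp: T_def k_def Basis_prod_def fun_eq_iff)
  have k: "\<And>j. j \<in> Basis \<Longrightarrow> k j \<noteq> 0"
    using assms by (simp add: k_def)
  have "(\<Prod>j\<in>Basis. \<bar>k j\<bar>) = \<bar>a * b\<bar>"
    by (simp add: k_def Basis_prod_def abs_mult)
  then show "T \<in> lebesgue \<rightarrow>\<^sub>M lebesgue"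
    "lebesgue = density (distr lebesgue lebesgue T) (\<lambda>_. ennreal \<bar>a * b\<bar>)"
    unfolding T using lebesgue_affine_measurable[of k "(0, c)", OF k] lebesgue_affine_euclidean[of k "(0, c)", OF k]
    by simp_all
qed

lemma nn_integral_prod_affine:
  fixes a b c :: real
  assumes ab: "a \<noteq> 0" "b \<noteq> 0" and f [measurable]: "f \<in> borel_measurable lebesgue"
  shows "(\<integral>\<^sup>+z. f z \<partial>lebesgue) = ennreal \<bar>a * b\<bar> * (\<integral>\<^sup>+z. f (a * fst z, b * snd z + c) \<partial>lebesgue)"
proof -
  note [measurable] = measurable_prod_affine[OF ab, of c]
  show ?thesis
    by (subst lebesgue_prod_affine_eq[OF ab, of c])
      (simp add: nn_integral_density nn_integral_distr nn_integral_cmult)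
qed

lemma integral_prod_affine:
  fixes a b c :: real and f :: "real \<times> real \<Rightarrow> complex"
  assumes ab: "a \<noteq> 0" "b \<noteq> 0" and f [measurable]: "f \<in> borel_measurable lebesgue"
  shows "(\<integral>z. f z \<partial>lebesgue) = \<bar>a * b\<bar> *\<^sub>R (\<integral>z. f (a * fst z, b * snd z + c) \<partial>lebesgue)"
proof -
  note [measurable] = measurable_prod_affine[OF ab, of c]
  show ?thesis
    by (subst lebesgue_prod_affine_eq[OF ab, of c])
      (simp add: integral_density integral_distr)
qed

lemma AE_prod_affine:
  fixes a b c :: real
  assumes ab: "a \<noteq> 0" "b \<noteq> 0" and P: "AE z in lebesgue. P z"
  shows "AE z in lebesgue. P (a * fst z, b * snd z + c)"
proof -
  note [measurable] = measurable_prod_affine[OF ab, of c]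
  obtain N where N: "N \<in> null_sets lebesgue" "{z \<in> space lebesgue. \<not> P z} \<subseteq> N"
    using P unfolding eventually_ae_filter by blast
  have [measurable]: "N \<in> sets lebesgue" using N by auto
  have "ennreal \<bar>a * b\<bar> * (\<integral>\<^sup>+z. indicator N (a * fst z, b * snd z + c) \<partial>lebesgue) = 0"
    using N(1) by (subst nn_integral_prod_affine[symmetric, OF ab]) auto
  then have "(\<integral>\<^sup>+z. indicator N (a * fst z, b * snd z + c) \<partial>lebesgue) = 0"
    using ab by simp
  then have "AE z in lebesgue. indicator N (a * fst z, b * snd z + c) = (0::ennreal)"
    by (subst (asm) nn_integral_0_iff_AE) auto
  then show ?thesis
    by eventually_elim (use N(2) in \<open>auto simp: indicator_def split: if_splits\<close>)
qed

lemma AE_fst_nonzero: "AE z in lebesgue. fst (z :: real \<times> real) \<noteq> 0"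
  using AE_lborel_fst[OF AE_lborel_singleton[of "0::real"]] by (simp add: AE_lebesgue_iff)

lemma Lam_sets: "Lam \<times> (UNIV :: real set) \<in> sets lebesgue"
proof -
  have "Lam \<times> (UNIV :: real set) \<in> sets (borel :: (real \<times> real) measure)"
    by (rule borel_Times) (auto simp: Lam_def)
  then show ?thesis by simp
qed

lemma field_density_measurable [measurable]:
  "(\<lambda>z :: real \<times> real. \<bar>fst z\<bar>) \<in> borel_measurable lebesgue"
  by (intro measurable_completion) simp

lemma field_measure_alt:
  "field_measure = density (lebesgue_on (Lam \<times> UNIV)) (\<lambda>z. ennreal \<bar>fst z\<bar>)"
  by (simp add: field_measure_def case_prod_unfold)

text \<open>The density \<open>|\<xi>|\<close> vanishes only on the null set \<open>\<xi> = 0\<close>, which has been removed from the space anyway.\<close>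

lemma AE_field_measure_iff: "(AE z in field_measure. P z) \<longleftrightarrow> (AE z in lebesgue. P z)"
proof -
  have "(AE z in field_measure. P z) \<longleftrightarrow> (AE z in lebesgue. z \<in> Lam \<times> UNIV \<longrightarrow> 0 < ennreal \<bar>fst z\<bar> \<longrightarrow> P z)"
    unfolding field_measure_alt using Lam_sets
    by (subst AE_density) (auto simp: AE_restrict_space_iff intro!: measurable_restrict_space1)
  also have "\<dots> \<longleftrightarrow> (AE z in lebesgue. P z)"
  proof
    assume "AE z in lebesgue. z \<in> Lam \<times> UNIV \<longrightarrow> 0 < ennreal \<bar>fst z\<bar> \<longrightarrow> P z"
    then show "AE z in lebesgue. P z"
      using AE_fst_nonzero by eventually_elim (auto simp: Lam_def mem_Times_iff)
  qed (auto elim: eventually_mono)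
  finally show ?thesis .
qed

lemma borel_measurable_field_measure_iff:
  fixes f :: "real \<times> real \<Rightarrow> complex"
  shows "f \<in> borel_measurable field_measure \<longleftrightarrow> f \<in> borel_measurable lebesgue"
proof
  assume "f \<in> borel_measurable field_measure"
  then have "f \<in> borel_measurable (lebesgue_on (Lam \<times> UNIV))"
    by (simp add: field_measure_alt)
  then have "(\<lambda>z. indicator (Lam \<times> UNIV) z *\<^sub>R f z) \<in> borel_measurable lebesgue"
    by (subst (asm) borel_measurable_restrict_space_iff) (use Lam_sets in auto)
  then show "f \<in> borel_measurable lebesgue"
  proof (rule lebesgue_measurable_AE)
    show "AE z in lebesgue. f z = indicator (Lam \<times> UNIV) z *\<^sub>R f z"
      using AE_fst_nonzero by eventually_elim (auto simp: Lam_def indicator_def mem_Times_iff)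
  qed
next
  assume "f \<in> borel_measurable lebesgue"
  then show "f \<in> borel_measurable field_measure"
    by (simp add: field_measure_alt measurable_restrict_space1)
qed

lemma nn_integral_field_measure:
  assumes [measurable]: "f \<in> borel_measurable lebesgue"
  shows "(\<integral>\<^sup>+z. f z \<partial>field_measure) = (\<integral>\<^sup>+z. ennreal \<bar>fst z\<bar> * f z \<partial>lebesgue)"
proof -
  have "(\<integral>\<^sup>+z. f z \<partial>field_measure) = (\<integral>\<^sup>+z. ennreal \<bar>fst z\<bar> * f z * indicator (Lam \<times> UNIV) z \<partial>lebesgue)"
    unfolding field_measure_alt using Lam_sets
    by (subst nn_integral_density) (auto simp: nn_integral_restrict_space intro!: measurable_restrict_space1)
  also have "\<dots> = (\<integral>\<^sup>+z. ennreal \<bar>fst z\<bar> * f z \<partial>lebesgue)"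
    by (rule nn_integral_cong) (auto simp: Lam_def indicator_def)
  finally show ?thesis .
qed

lemma integral_field_measure:
  fixes f :: "real \<times> real \<Rightarrow> complex"
  assumes [measurable]: "f \<in> borel_measurable lebesgue"
  shows "(\<integral>z. f z \<partial>field_measure) = (\<integral>z. \<bar>fst z\<bar> *\<^sub>R f z \<partial>lebesgue)"
proof -
  have "(\<integral>z. f z \<partial>field_measure) = (\<integral>z. indicator (Lam \<times> UNIV) z *\<^sub>R (\<bar>fst z\<bar> *\<^sub>R f z) \<partial>lebesgue)"
    unfolding field_measure_alt using Lam_sets
    by (subst integral_density) (auto simp: integral_restrict_space intro!: measurable_restrict_space1)
  also have "\<dots> = (\<integral>z. \<bar>fst z\<bar> *\<^sub>R f z \<partial>lebesgue)"
    by (rule Bochner_Integration.integral_cong) (auto simp: Lam_def indicator_def)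
  finally show ?thesis .
qed

lemma L2_iff: "f \<in> L2 M \<longleftrightarrow> f \<in> borel_measurable M \<and> (\<integral>\<^sup>+z. ennreal ((cmod (f z))\<^sup>2) \<partial>M) < \<infinity>"
proof -
  have "(\<lambda>z. (cmod (f z))\<^sup>2) \<in> borel_measurable M" if [measurable]: "f \<in> borel_measurable M"
    by measurable
  then show ?thesis
    unfolding L2_def integrable_iff_bounded by auto
qed

lemma L2_norm_squared: "f \<in> L2 M \<Longrightarrow> ennreal ((L2_norm M f)\<^sup>2) = (\<integral>\<^sup>+z. ennreal ((cmod (f z))\<^sup>2) \<partial>M)"
proof -
  assume "f \<in> L2 M"
  then have "(\<integral>\<^sup>+z. ennreal ((cmod (f z))\<^sup>2) \<partial>M) = ennreal (\<integral>z. (cmod (f z))\<^sup>2 \<partial>M)"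
    by (intro nn_integral_eq_integral) (auto simp: L2_def)
  then show ?thesis
    by (simp add: L2_norm_def)
qed

lemma parseval_frame_iff:
  "parseval_frame M \<psi> \<longleftrightarrow> (\<forall>j. \<psi> j \<in> L2 M) \<and>
    (\<forall>f\<in>L2 M. (\<integral>\<^sup>+j. ennreal ((cmod (L2_inner M f (\<psi> j)))\<^sup>2) \<partial>count_space UNIV) =
      (\<integral>\<^sup>+z. ennreal ((cmod (f z))\<^sup>2) \<partial>M))"
proof -
  have "((\<lambda>j. (cmod (L2_inner M f (\<psi> j)))\<^sup>2) has_sum (L2_norm M f)\<^sup>2) UNIV \<longleftrightarrow>
      (\<integral>\<^sup>+j. ennreal ((cmod (L2_inner M f (\<psi> j)))\<^sup>2) \<partial>count_space UNIV) = (\<integral>\<^sup>+z. ennreal ((cmod (f z))\<^sup>2) \<partial>M)"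
    if "f \<in> L2 M" for f
    unfolding L2_norm_squared[OF that, symmetric]
    by (rule has_sum_iff_nn_integral_count_space) simp_all
  then show ?thesis
    unfolding parseval_frame_def by blast
qed

lemma L2_mult_cnj_integrable:
  assumes "f \<in> L2 M" "g \<in> L2 M"
  shows "integrable M (\<lambda>z. f z * cnj (g z))"
proof (rule Bochner_Integration.integrable_bound)
  show "integrable M (\<lambda>z. (cmod (f z))\<^sup>2 + (cmod (g z))\<^sup>2)"
    using assms by (simp add: L2_def)
  have [measurable]: "f \<in> borel_measurable M" "g \<in> borel_measurable M"
    using assms by (auto simp: L2_def)
  show "(\<lambda>z. f z * cnj (g z)) \<in> borel_measurable M"
    by measurable
  have "cmod (f z) * cmod (g z) \<le> (cmod (f z))\<^sup>2 + (cmod (g z))\<^sup>2" for z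
  proof -
    have "0 \<le> cmod (f z) * cmod (g z)" by simp
    then show ?thesis
      using sum_squares_bound[of "cmod (f z)" "cmod (g z)"] by linarith
  qed
  then show "AE z in M. cmod (f z * cnj (g z)) \<le> norm ((cmod (f z))\<^sup>2 + (cmod (g z))\<^sup>2)"
    by (simp add: norm_mult)
qed

section \<open>Translations and dilations of fields\<close>

lemma measurable_compose_prod_affine:
  fixes f :: "real \<times> real \<Rightarrow> 'b::topological_space"
  assumes "a \<noteq> 0" "b \<noteq> 0" "f \<in> borel_measurable lebesgue"
  shows "(\<lambda>z. f (a * fst z, b * snd z + c)) \<in> borel_measurable lebesgue"
  by (rule measurable_compose[OF measurable_prod_affine[OF assms(1,2)] assms(3)])

lemma That_apply:
  "That k l m f z = cis (2 * pi * fst z * m) * cis (- 2 * pi * fst z * l * snd z) * f (fst z, snd z - k)"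
  by (simp add: That_def case_prod_unfold)

lemma Dhat_apply:
  "Dhat u a f z = u a (fst z) * of_real (a powr (3/4)) * f (a * fst z, a powr (-1/2) * snd z)"
  by (simp add: Dhat_def case_prod_unfold)

lemma borel_measurable_cis_comp [measurable (raw)]:
  "f \<in> borel_measurable M \<Longrightarrow> (\<lambda>x. cis (f x)) \<in> borel_measurable M"
  by (rule measurable_compose[OF _ borel_measurable_continuous_onI]) (auto intro!: continuous_intros)

lemma fst_lebesgue [measurable]: "fst \<in> borel_measurable (lebesgue :: (real \<times> real) measure)"
  and snd_lebesgue [measurable]: "snd \<in> borel_measurable (lebesgue :: (real \<times> real) measure)"
  by (auto intro: measurable_completion)

lemma That_measurable [measurable (raw)]:
  assumes "f \<in> borel_measurable lebesgue"
  shows "That k l m f \<in> borel_measurable lebesgue"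
proof -
  have [measurable]: "(\<lambda>z. f (fst z, snd z - k)) \<in> borel_measurable lebesgue"
    using measurable_compose_prod_affine[of 1 1 f "- k"] assms by simp
  show ?thesis
    unfolding That_apply[abs_def] by measurable
qed

lemma cmod_That: "cmod (That k l m f z) = cmod (f (fst z, snd z - k))"
  by (simp add: That_apply norm_mult)

lemma L2_field_iff:
  "f \<in> L2 field_measure \<longleftrightarrow> f \<in> borel_measurable lebesgue \<and>
    (\<integral>\<^sup>+z. ennreal \<bar>fst z\<bar> * ennreal ((cmod (f z))\<^sup>2) \<partial>lebesgue) < \<infinity>"
proof (cases "f \<in> borel_measurable lebesgue")
  case True
  then have [measurable]: "f \<in> borel_measurable lebesgue" .
  show ?thesis
    unfolding L2_iff borel_measurable_field_measure_iff
    by (subst nn_integral_field_measure) auto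
qed (simp add: L2_iff borel_measurable_field_measure_iff)

lemma That_L2:
  assumes "f \<in> L2 field_measure"
  shows "That k l m f \<in> L2 field_measure"
proof -
  have [measurable]: "f \<in> borel_measurable lebesgue"
    using assms by (simp add: L2_field_iff)
  have "(\<integral>\<^sup>+z. ennreal \<bar>fst z\<bar> * ennreal ((cmod (f z))\<^sup>2) \<partial>lebesgue) =
      (\<integral>\<^sup>+z. ennreal \<bar>fst z\<bar> * ennreal ((cmod (That k l m f z))\<^sup>2) \<partial>lebesgue)"
    by (subst nn_integral_prod_affine[of 1 1 _ "- k"]) (auto simp: cmod_That)
  then show ?thesis
    using assms by (simp add: L2_field_iff)
qed

definition unimodular_weight :: "(real \<Rightarrow> complex) \<Rightarrow> bool" where
  "unimodular_weight w \<longleftrightarrow> w \<in> borel_measurable (lebesgue_on Lam) \<and> (\<forall>\<xi>\<in>Lam. cmod (w \<xi>) = 1)"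

lemma unimodular_weight_multiplier: "unitary_multiplier u \<Longrightarrow> 0 < a \<Longrightarrow> unimodular_weight (u a)"
  by (auto simp: unitary_multiplier_def unimodular_weight_def)

lemma Lam_lebesgue: "Lam \<in> sets lebesgue"
  by (simp add: Lam_def)

lemma unimodular_weight_fst_measurable:
  assumes "unimodular_weight w"
  shows "(\<lambda>z. w (fst z)) \<in> borel_measurable (lebesgue :: (real \<times> real) measure)"
proof -
  have "(\<lambda>x. indicator Lam x *\<^sub>R w x) \<in> borel_measurable lebesgue"
    using assms Lam_lebesgue
    by (subst borel_measurable_restrict_space_iff[symmetric]) (auto simp: unimodular_weight_def)
  then have "(\<lambda>z. indicator Lam (fst z) *\<^sub>R w (fst z)) \<in> borel_measurable (lebesgue :: (real \<times> real) measure)"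
    by (rule measurable_compose[OF measurable_fst_lebesgue])
  then show ?thesis
  proof (rule lebesgue_measurable_AE)
    show "AE z in lebesgue. w (fst z) = indicator Lam (fst z) *\<^sub>R w (fst (z :: real \<times> real))"
      using AE_fst_nonzero by eventually_elim (simp add: Lam_def)
  qed
qed

lemma unimodular_weight_adjoint:
  assumes w: "unimodular_weight w" and a: "0 < a"
  shows "unimodular_weight (\<lambda>\<xi>. cnj (w (\<xi> / a)))"
  unfolding unimodular_weight_def
proof
  have "(\<lambda>\<xi>. \<xi> / a) \<in> lebesgue_on Lam \<rightarrow>\<^sub>M lebesgue"
  proof (rule measurable_restrict_space1)
    have "(*\<^sub>R) (inverse a) = (\<lambda>\<xi>. \<xi> / a)"
      by (simp add: fun_eq_iff divide_inverse mult.commute)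
    then show "(\<lambda>\<xi>. \<xi> / a) \<in> lebesgue \<rightarrow>\<^sub>M lebesgue"
      by (metis lebesgue_measurable_scaling)
  qed
  then have "(\<lambda>\<xi>. \<xi> / a) \<in> lebesgue_on Lam \<rightarrow>\<^sub>M lebesgue_on Lam"
    using a by (intro measurable_restrict_space2) (auto simp: space_restrict_space Lam_def)
  then have "(\<lambda>\<xi>. w (\<xi> / a)) \<in> borel_measurable (lebesgue_on Lam)"
    by (rule measurable_compose) (use w in \<open>simp add: unimodular_weight_def\<close>)
  then show "(\<lambda>\<xi>. cnj (w (\<xi> / a))) \<in> borel_measurable (lebesgue_on Lam)"
    by (rule borel_measurable_cnj)
  show "\<forall>\<xi>\<in>Lam. cmod (cnj (w (\<xi> / a))) = 1"
    using w a by (auto simp: unimodular_weight_def Lam_def)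
qed

lemma Dhat_measurable:
  assumes "unimodular_weight (u a)" "0 < a" "f \<in> borel_measurable lebesgue"
  shows "Dhat u a f \<in> borel_measurable lebesgue"
proof -
  note [measurable] = unimodular_weight_fst_measurable[OF assms(1)]
  have [measurable]: "(\<lambda>z. f (a * fst z, a powr (-1/2) * snd z)) \<in> borel_measurable lebesgue"
    using measurable_compose_prod_affine[of a "a powr (-1/2)" f 0] assms by simp
  show ?thesis
    unfolding Dhat_apply[abs_def] by measurable
qed

text \<open>Dilations are unitary on every band of frequencies; the weight \<open>G\<close> records how the band moves. The exponent
  \<open>3/4\<close> compensates the Jacobian \<open>a * a powr (-1/2)\<close> of the substitution and the factor \<open>a\<close> in \<open>|\<xi>|\<close>.\<close>

lemma nn_integral_Dhat:
  assumes u: "unimodular_weight (u a)" and a: "0 < a"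
    and f [measurable]: "f \<in> borel_measurable lebesgue"
    and G: "(\<lambda>z :: real \<times> real. G (fst z)) \<in> borel_measurable lebesgue"
  shows "(\<integral>\<^sup>+z. G (fst z) * ennreal ((cmod (Dhat u a f z))\<^sup>2) \<partial>field_measure) =
    (\<integral>\<^sup>+z. G (fst z / a) * ennreal ((cmod (f z))\<^sup>2) \<partial>field_measure)"
proof -
  let ?b = "a powr (-1/2)"
  note [measurable] = G Dhat_measurable[where u = u, OF u a f]
  have [measurable]: "(\<lambda>z :: real \<times> real. G (fst z / a)) \<in> borel_measurable lebesgue"
    using measurable_compose_prod_affine[of "1 / a" 1 "\<lambda>z. G (fst z)" 0] G a by simp
  have ab: "a powr (3/4) * a powr (3/4) = a * \<bar>a * ?b\<bar>"
  proof -
    have "a powr (3/4) * a powr (3/4) = a powr (1 + (1 + -1/2))"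
      by (simp add: powr_add[symmetric])
    also have "\<dots> = a powr 1 * (a powr 1 * ?b)"
      by (simp only: powr_add)
    finally show ?thesis using a by simp
  qed
  have "(\<integral>\<^sup>+z. G (fst z / a) * ennreal ((cmod (f z))\<^sup>2) \<partial>field_measure) =
      (\<integral>\<^sup>+z. ennreal \<bar>fst z\<bar> * (G (fst z / a) * ennreal ((cmod (f z))\<^sup>2)) \<partial>lebesgue)"
    by (rule nn_integral_field_measure) measurable
  also have "\<dots> = ennreal \<bar>a * ?b\<bar> * (\<integral>\<^sup>+z. ennreal \<bar>a * fst z\<bar> *
      (G (fst z) * ennreal ((cmod (f (a * fst z, ?b * snd z)))\<^sup>2)) \<partial>lebesgue)"
    using a by (subst nn_integral_prod_affine[of a ?b _ 0]) auto
  also have "\<dots> = (\<integral>\<^sup>+z. ennreal \<bar>a * ?b\<bar> * (ennreal \<bar>a * fst z\<bar> *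
      (G (fst z) * ennreal ((cmod (f (a * fst z, ?b * snd z)))\<^sup>2))) \<partial>lebesgue)"
    using measurable_compose_prod_affine[of a ?b f 0] a by (intro nn_integral_cmult[symmetric]) auto
  also have "\<dots> = (\<integral>\<^sup>+z. ennreal \<bar>fst z\<bar> * (G (fst z) * ennreal ((cmod (Dhat u a f z))\<^sup>2)) \<partial>lebesgue)"
  proof (rule nn_integral_cong_AE)
    show "AE z in lebesgue. ennreal \<bar>a * ?b\<bar> * (ennreal \<bar>a * fst z\<bar> *
      (G (fst z) * ennreal ((cmod (f (a * fst z, ?b * snd z)))\<^sup>2))) =
      ennreal \<bar>fst z\<bar> * (G (fst z) * ennreal ((cmod (Dhat u a f z))\<^sup>2))"
      using AE_fst_nonzero
    proof eventually_elim
      case (elim z)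
      let ?F = "(cmod (f (a * fst z, ?b * snd z)))\<^sup>2"
      have "cmod (u a (fst z)) = 1"
        using u elim by (simp add: unimodular_weight_def Lam_def)
      then have "(cmod (Dhat u a f z))\<^sup>2 = a powr (3/4) * a powr (3/4) * ?F"
        by (simp add: Dhat_apply norm_mult power2_eq_square)
      then have D: "(cmod (Dhat u a f z))\<^sup>2 = a * \<bar>a * ?b\<bar> * ?F"
        unfolding ab .
      have "ennreal \<bar>a * ?b\<bar> * (ennreal \<bar>a * fst z\<bar> * (G (fst z) * ennreal ?F)) =
          (ennreal \<bar>a * ?b\<bar> * ennreal \<bar>a * fst z\<bar> * ennreal ?F) * G (fst z)"
        by (simp only: ac_simps)
      also have "ennreal \<bar>a * ?b\<bar> * ennreal \<bar>a * fst z\<bar> * ennreal ?F = ennreal (\<bar>fst z\<bar> * (a * \<bar>a * ?b\<bar> * ?F))"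
        using a by (simp add: ennreal_mult[symmetric] abs_mult mult_ac)
      also have "\<dots> = ennreal \<bar>fst z\<bar> * ennreal ((cmod (Dhat u a f z))\<^sup>2)"
        unfolding D using a by (subst ennreal_mult) auto
      finally show ?case by (simp only: ac_simps)
    qed
  qed
  also have "\<dots> = (\<integral>\<^sup>+z. G (fst z) * ennreal ((cmod (Dhat u a f z))\<^sup>2) \<partial>field_measure)"
    by (rule nn_integral_field_measure[symmetric]) measurable
  finally show ?thesis ..
qed

lemma Dhat_L2:
  assumes "unimodular_weight (u a)" "0 < a" "f \<in> L2 field_measure"
  shows "Dhat u a f \<in> L2 field_measure"
  using nn_integral_Dhat[where u = u, OF assms(1,2), of f "\<lambda>_. 1"] Dhat_measurable[where u = u, OF assms(1,2), of f] assms(3)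
  by (simp add: L2_iff borel_measurable_field_measure_iff)

text \<open>The adjoint of a dilation is again a dilation, by \<open>1/a\<close>, but its phase is \<open>\<xi> \<mapsto> cnj (u a (\<xi> / a))\<close>, which in
  general is not a member of the family \<open>u\<close>. Hence \<open>unimodular_weight\<close> describes the phase of a single dilation.\<close>

lemma L2_inner_Dhat:
  assumes u: "unimodular_weight (u a)" and a: "0 < a"
    and f [measurable]: "f \<in> borel_measurable lebesgue" and \<psi> [measurable]: "\<psi> \<in> borel_measurable lebesgue"
  shows "L2_inner field_measure f (Dhat u a \<psi>) =
    L2_inner field_measure (Dhat (\<lambda>_ \<xi>. cnj (u a (\<xi> / a))) (1 / a) f) \<psi>"
proof -
  let ?b = "a powr (-1/2)" and ?f = "Dhat (\<lambda>_ \<xi>. cnj (u a (\<xi> / a))) (1 / a) f"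
  have [measurable]: "?f \<in> borel_measurable lebesgue" 
    using Dhat_measurable[of "\<lambda>_ \<xi>. cnj (u a (\<xi> / a))" "1 / a" f] unimodular_weight_adjoint[OF u a] a by simp
  note [measurable] = Dhat_measurable[where u = u, OF u a \<psi>]
  have ab: "a * ?b * a * (1 / a) powr (3/4) = a powr (3/4)"
  proof -
    have "a * ?b * a * (1 / a) powr (3/4) = a powr 1 * a powr (-1/2) * a powr 1 * a powr (-3/4)"
      using a by (simp add: powr_divide powr_minus_divide)
    also have "\<dots> = a powr (3/4)"
      by (simp only: powr_add[symmetric]) simp
    finally show ?thesis .
  qed
  have bb: "(1 / a) powr (-1/2) * (?b * t) = t" for t
    using a by (simp add: powr_divide powr_minus_divide)
  have "L2_inner field_measure ?f \<psi> = (\<integral>z. \<bar>fst z\<bar> *\<^sub>R (?f z * cnj (\<psi> z)) \<partial>lebesgue)"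
    unfolding L2_inner_def by (rule integral_field_measure) measurable
  also have "\<dots> = \<bar>a * ?b\<bar> *\<^sub>R (\<integral>z. \<bar>a * fst z\<bar> *\<^sub>R (?f (a * fst z, ?b * snd z) * cnj (\<psi> (a * fst z, ?b * snd z))) \<partial>lebesgue)"
    using a by (subst integral_prod_affine[of a ?b _ 0]) auto
  also have "\<dots> = (\<integral>z. \<bar>a * ?b\<bar> *\<^sub>R (\<bar>a * fst z\<bar> *\<^sub>R (?f (a * fst z, ?b * snd z) * cnj (\<psi> (a * fst z, ?b * snd z)))) \<partial>lebesgue)"
    by (rule integral_scaleR_right[symmetric])
  also have "\<dots> = (\<integral>z. \<bar>fst z\<bar> *\<^sub>R (f z * cnj (Dhat u a \<psi> z)) \<partial>lebesgue)"
  proof (rule Bochner_Integration.integral_cong[OF refl])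
    fix z :: "real \<times> real"
    have "?f (a * fst z, ?b * snd z) = cnj (u a (fst z)) * of_real ((1 / a) powr (3/4)) * f z"
      unfolding Dhat_apply fst_conv snd_conv bb using a by simp
    then have "\<bar>a * ?b\<bar> *\<^sub>R (\<bar>a * fst z\<bar> *\<^sub>R (?f (a * fst z, ?b * snd z) * cnj (\<psi> (a * fst z, ?b * snd z)))) =
       of_real (a * ?b * a * (1 / a) powr (3/4)) * of_real \<bar>fst z\<bar> * (f z * cnj (u a (fst z)) * cnj (\<psi> (a * fst z, ?b * snd z)))"
      using a by (simp add: scaleR_conv_of_real abs_mult mult_ac)
    then show "\<bar>a * ?b\<bar> *\<^sub>R (\<bar>a * fst z\<bar> *\<^sub>R (?f (a * fst z, ?b * snd z) * cnj (\<psi> (a * fst z, ?b * snd z)))) =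
       \<bar>fst z\<bar> *\<^sub>R (f z * cnj (Dhat u a \<psi> z))"
      unfolding ab by (simp add: Dhat_apply scaleR_conv_of_real mult_ac)
  qed
  also have "\<dots> = L2_inner field_measure f (Dhat u a \<psi>)"
    unfolding L2_inner_def by (rule integral_field_measure[symmetric]) measurable
  finally show ?thesis ..
qed

section \<open>Summing over one dilation level\<close>

lemma nn_integral_count_space_Pair:
  "(\<integral>\<^sup>+j. f j \<partial>count_space UNIV) = (\<integral>\<^sup>+a. \<integral>\<^sup>+b. f (a, b) \<partial>count_space UNIV \<partial>count_space UNIV)"
  by (rule nn_integral_fst_count_space[symmetric])

lemma AE_lborel_affine:
  fixes P :: "real \<Rightarrow> bool"
  assumes "AE x in lborel. P x" "c \<noteq> 0"
  shows "AE x in lborel. P (t + c * x)"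
proof -
  obtain N where N: "N \<in> null_sets lborel" "{x \<in> space lborel. \<not> P x} \<subseteq> N"
    using assms(1) unfolding eventually_ae_filter by blast
  have "AE x in lborel. t + c * x \<notin> N"
    using N(1) assms(2) by (intro AE_borel_affine AE_not_in) auto
  then show ?thesis
    by eventually_elim (use N(2) in auto)
qed

lemma AE_lborel_shift:
  fixes P :: "real \<Rightarrow> bool"
  assumes "AE x in lborel. P x"
  shows "AE x in lborel. P (x + t)"
  using AE_lborel_affine[OF assms, of 1 t] by (simp add: add.commute)

text \<open>Parseval's identity of the Gabor system over a single \<open>\<xi>\<close>, with the normalization \<open>|\<xi>| dt\<close> that the field measure induces
  in the fibre, and for a Borel representative \<open>G'\<close> of the window.\<close>

lemma gabor_fiber:
  fixes \<alpha> \<beta> \<xi> :: real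
  assumes pf: "parseval_frame lebesgue (\<lambda>(p :: int, q :: int) t.
          of_real (\<bar>\<xi>\<bar> powr (1/2)) * cis (- 2 * pi * \<xi> * (\<beta> * of_int q) * t) * G (t - \<alpha> * of_int p))"
    and G: "AE t in lborel. G t = G' t" and [measurable]: "G' \<in> borel_measurable borel"
    and F [measurable]: "F \<in> borel_measurable borel" and F2: "(\<integral>\<^sup>+t. ennreal ((cmod (F t))\<^sup>2) \<partial>lborel) < \<infinity>"
  shows "(\<integral>\<^sup>+(p :: int, q :: int). ennreal ((cmod (\<integral>t. \<bar>\<xi>\<bar> *\<^sub>R (F t *
      cnj (cis (- 2 * pi * \<xi> * (\<beta> * of_int q) * t) * G' (t - \<alpha> * of_int p))) \<partial>lborel))\<^sup>2) \<partial>count_space UNIV) =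
    ennreal \<bar>\<xi>\<bar> * (\<integral>\<^sup>+t. ennreal ((cmod (F t))\<^sup>2) \<partial>lborel)"
proof -
  define \<psi> where "\<psi> = (\<lambda>(p :: int, q :: int) t.
          of_real (\<bar>\<xi>\<bar> powr (1/2)) * cis (- 2 * pi * \<xi> * (\<beta> * of_int q) * t) * G (t - \<alpha> * of_int p))"
  have FL: "F \<in> L2 lebesgue"
    using F2 by (auto simp: L2_iff nn_integral_completion intro: measurable_completion)
  have fm: "F \<in> borel_measurable lebesgue"
    by (auto intro: measurable_completion)
  have eq: "ennreal ((cmod (\<integral>t. \<bar>\<xi>\<bar> *\<^sub>R (F t *
      cnj (cis (- 2 * pi * \<xi> * (\<beta> * of_int q) * t) * G' (t - \<alpha> * of_int p))) \<partial>lborel))\<^sup>2) =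
      ennreal \<bar>\<xi>\<bar> * ennreal ((cmod (L2_inner lebesgue F (\<psi> (p, q))))\<^sup>2)" for p q
  proof -
    let ?k = "\<lambda>t. F t * cnj (cis (- 2 * pi * \<xi> * (\<beta> * of_int q) * t) * G' (t - \<alpha> * of_int p))"
    have \<psi>L: "\<psi> (p, q) \<in> borel_measurable lebesgue"
      using pf unfolding \<psi>_def[symmetric] parseval_frame_def L2_def by auto
    have k: "?k \<in> borel_measurable borel"
      by measurable
    have "AE t in lborel. G (t - \<alpha> * of_int p) = G' (t - \<alpha> * of_int p)"
      using AE_lborel_shift[OF G, of "- (\<alpha> * of_int p)"] by simp
    then have "AE t in lebesgue. F t * cnj (\<psi> (p, q) t) = of_real (\<bar>\<xi>\<bar> powr (1/2)) * ?k t"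
      unfolding AE_lebesgue_iff by eventually_elim (simp add: \<psi>_def mult_ac)
    then have "L2_inner lebesgue F (\<psi> (p, q)) = (\<integral>t. of_real (\<bar>\<xi>\<bar> powr (1/2)) * ?k t \<partial>lebesgue)"
      unfolding L2_inner_def
    proof (rule integral_cong_AE[rotated 2])
      show "(\<lambda>t. F t * cnj (\<psi> (p, q) t)) \<in> borel_measurable lebesgue"
        using fm \<psi>L by (intro borel_measurable_times borel_measurable_cnj)
      show "(\<lambda>t. of_real (\<bar>\<xi>\<bar> powr (1/2)) * ?k t) \<in> borel_measurable lebesgue"
        by (rule measurable_completion) measurable
    qed
    also have "\<dots> = of_real (\<bar>\<xi>\<bar> powr (1/2)) * (\<integral>t. ?k t \<partial>lborel)"
      using k by (simp add: integral_completion)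
    finally have "(cmod (L2_inner lebesgue F (\<psi> (p, q))))\<^sup>2 = \<bar>\<xi>\<bar> * (cmod (\<integral>t. ?k t \<partial>lborel))\<^sup>2"
      by (simp add: norm_mult power_mult_distrib powr_half_sqrt)
    then have "\<bar>\<xi>\<bar> * (cmod (L2_inner lebesgue F (\<psi> (p, q))))\<^sup>2 = (cmod (\<integral>t. \<bar>\<xi>\<bar> *\<^sub>R ?k t \<partial>lborel))\<^sup>2"
      unfolding integral_scaleR_right by (simp add: power2_eq_square)
    then show ?thesis
      by (simp add: ennreal_mult[symmetric])
  qed
  have "(\<integral>\<^sup>+(p :: int, q :: int). ennreal ((cmod (\<integral>t. \<bar>\<xi>\<bar> *\<^sub>R (F t *
      cnj (cis (- 2 * pi * \<xi> * (\<beta> * of_int q) * t) * G' (t - \<alpha> * of_int p))) \<partial>lborel))\<^sup>2) \<partial>count_space UNIV) =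
      (\<integral>\<^sup>+j. ennreal \<bar>\<xi>\<bar> * ennreal ((cmod (L2_inner lebesgue F (\<psi> j)))\<^sup>2) \<partial>count_space UNIV)"
    by (intro nn_integral_cong) (simp only: eq split: prod.split, simp)
  also have "\<dots> = ennreal \<bar>\<xi>\<bar> * (\<integral>\<^sup>+j. ennreal ((cmod (L2_inner lebesgue F (\<psi> j)))\<^sup>2) \<partial>count_space UNIV)"
    by (rule nn_integral_cmult) simp
  also have "(\<integral>\<^sup>+j. ennreal ((cmod (L2_inner lebesgue F (\<psi> j)))\<^sup>2) \<partial>count_space UNIV) =
      (\<integral>\<^sup>+t. ennreal ((cmod (F t))\<^sup>2) \<partial>lebesgue)"
    using pf FL unfolding \<psi>_def[symmetric] parseval_frame_iff by blast
  finally show ?thesis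
    by (simp add: nn_integral_completion)
qed

lemma nn_integral_field_borel:
  assumes [measurable]: "f \<in> borel_measurable (borel :: (real \<times> real) measure)"
  shows "(\<integral>\<^sup>+z. ennreal \<bar>fst z\<bar> * f z \<partial>lebesgue) = (\<integral>\<^sup>+\<xi>. ennreal \<bar>\<xi>\<bar> * (\<integral>\<^sup>+t. f (\<xi>, t) \<partial>lborel) \<partial>lborel)"
proof -
  have "(\<lambda>z. ennreal \<bar>fst z\<bar> * f z) \<in> borel_measurable (lborel \<Otimes>\<^sub>M lborel)"
    unfolding lborel_prod by measurable
  from lborel.nn_integral_fst[OF this]
  have "(\<integral>\<^sup>+z. ennreal \<bar>fst z\<bar> * f z \<partial>lebesgue) = (\<integral>\<^sup>+\<xi>. \<integral>\<^sup>+t. ennreal \<bar>\<xi>\<bar> * f (\<xi>, t) \<partial>lborel \<partial>lborel)"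
    by (simp add: lborel_prod nn_integral_completion)
  also have "\<dots> = (\<integral>\<^sup>+\<xi>. ennreal \<bar>\<xi>\<bar> * (\<integral>\<^sup>+t. f (\<xi>, t) \<partial>lborel) \<partial>lborel)"
    by (intro nn_integral_cong nn_integral_cmult) measurable
  finally show ?thesis .
qed

lemma integrable_field_measure:
  fixes f :: "real \<times> real \<Rightarrow> complex"
  assumes "integrable field_measure f"
  shows "integrable lebesgue (\<lambda>z. \<bar>fst z\<bar> *\<^sub>R f z)"
proof -
  have [measurable]: "f \<in> borel_measurable lebesgue"
    using borel_measurable_integrable[OF assms] by (simp only: borel_measurable_field_measure_iff)
  have "(\<integral>\<^sup>+z. ennreal (cmod (f z)) \<partial>field_measure) < \<infinity>"
    using assms by (simp add: integrable_iff_bounded)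
  then have "(\<integral>\<^sup>+z. ennreal (cmod (\<bar>fst z\<bar> *\<^sub>R f z)) \<partial>lebesgue) < \<infinity>"
    by (subst (asm) nn_integral_field_measure) (auto simp: ennreal_mult)
  then show ?thesis
    by (intro integrableI_bounded) auto
qed

lemma L2_inner_field_fubini:
  assumes F: "F \<in> L2 field_measure" and \<psi>: "\<psi> \<in> L2 field_measure"
    and F' [measurable]: "F' \<in> borel_measurable borel" and \<psi>' [measurable]: "\<psi>' \<in> borel_measurable borel"
    and eq: "AE z in lebesgue. F z = F' z" "AE z in lebesgue. \<psi> z = \<psi>' z"
  shows "integrable (lborel \<Otimes>\<^sub>M lborel) (\<lambda>z. \<bar>fst z\<bar> *\<^sub>R (F' z * cnj (\<psi>' z)))"
    and "L2_inner field_measure F \<psi> = (\<integral>\<xi>. \<integral>t. \<bar>\<xi>\<bar> *\<^sub>R (F' (\<xi>, t) * cnj (\<psi>' (\<xi>, t))) \<partial>lborel \<partial>lborel)"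
proof -
  let ?k = "\<lambda>z. \<bar>fst z\<bar> *\<^sub>R (F' z * cnj (\<psi>' z))"
  have [measurable]: "F \<in> borel_measurable lebesgue" "\<psi> \<in> borel_measurable lebesgue"
    using F \<psi> by (auto simp: L2_field_iff)
  have k: "?k \<in> borel_measurable borel"
    by measurable
  have kl: "?k \<in> borel_measurable lebesgue"
    using k by (auto intro: measurable_completion)
  have ae: "AE z in lebesgue. \<bar>fst z\<bar> *\<^sub>R (F z * cnj (\<psi> z)) = ?k z"
    using eq by eventually_elim simp
  have "integrable lebesgue (\<lambda>z. \<bar>fst z\<bar> *\<^sub>R (F z * cnj (\<psi> z)))"
    by (intro integrable_field_measure L2_mult_cnj_integrable F \<psi>)
  then have "integrable lebesgue ?k"
    by (rule integrable_cong_AE_imp[OF _ kl]) (use ae in \<open>auto elim: eventually_mono\<close>)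
  then show int: "integrable (lborel \<Otimes>\<^sub>M lborel) ?k"
    using k by (simp add: lborel_prod integrable_completion)
  have "L2_inner field_measure F \<psi> = (\<integral>z. \<bar>fst z\<bar> *\<^sub>R (F z * cnj (\<psi> z)) \<partial>lebesgue)"
    unfolding L2_inner_def by (rule integral_field_measure) measurable
  also have "\<dots> = (\<integral>z. ?k z \<partial>lebesgue)"
    by (rule integral_cong_AE[OF _ kl ae]) measurable
  also have "\<dots> = (\<integral>z. ?k z \<partial>(lborel \<Otimes>\<^sub>M lborel))"
    using k by (simp add: lborel_prod integral_completion)
  also have "\<dots> = (\<integral>\<xi>. \<integral>t. \<bar>\<xi>\<bar> *\<^sub>R (F' (\<xi>, t) * cnj (\<psi>' (\<xi>, t))) \<partial>lborel \<partial>lborel)"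
    using lborel_pair.integral_fst'[OF int] by simp
  finally show "L2_inner field_measure F \<psi> = \<dots>" .
qed

lemma indicator_fst_measurable: "I \<in> sets lebesgue \<Longrightarrow> (\<lambda>z. indicator I (fst z) :: ennreal) \<in> borel_measurable (lebesgue :: (real \<times> real) measure)"
  by (rule measurable_compose[OF measurable_fst_lebesgue]) simp

lemma That_borel_measurable:
  assumes [measurable]: "g \<in> borel_measurable borel"
  shows "That k l m g \<in> borel_measurable borel"
proof -
  have "(\<lambda>z. cis (2 * pi * fst z * m) * cis (- 2 * pi * fst z * l * snd z) * g (fst z, snd z - k)) \<in> borel_measurable borel"
    by measurable
  then show ?thesis
    by (simp add: That_apply[abs_def])
qed

lemma lebesgue_ex_borel_set:
  assumes "A \<in> sets lebesgue"
  obtains B where "B \<in> sets borel" "B \<subseteq> A" "AE x in lborel. x \<in> A \<longleftrightarrow> x \<in> B"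
proof
  show "main_part lborel A \<in> sets borel"
    using main_part_sets[OF assms] by simp
  show "main_part lborel A \<subseteq> A"
    using main_part_null_part_Un[OF assms] by blast
  show "AE x in lborel. x \<in> A \<longleftrightarrow> x \<in> main_part lborel A"
    using AE_notin_null_part[OF assms]
    by eventually_elim (use main_part_null_part_Un[OF assms] in blast)
qed

text \<open>Write \<open>h p q\<close> for the fibrewise pairing of \<open>F\<close> with the time-frequency translate of \<open>g\<close>, integrated over \<open>t\<close>. The inner
  product is the \<open>m\<close>-th Fourier coefficient of \<open>h p q\<close>, so the sum over \<open>m\<close> is its squared norm, and the remaining
  sum over \<open>p\<close> and \<open>q\<close> can be carried out in each fibre.\<close>

theorem gabor_translates_sum:
  fixes \<alpha> \<beta> :: real
  assumes I: "I \<in> sets lebesgue"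
    and bound: "AE x in lborel. x \<in> I \<longrightarrow> x \<in> {- real N..<real N}"
    and disj: "\<And>n::int. n \<noteq> 0 \<Longrightarrow> AE x in lborel. \<not> (x \<in> I \<and> x + of_int n \<in> I)"
    and g: "gabor_field I \<alpha> \<beta> g" and F: "F \<in> L2 field_measure"
  shows "(\<integral>\<^sup>+(p :: int, q :: int, m :: int). ennreal ((cmod (L2_inner field_measure F
      (That (\<alpha> * of_int p) (\<beta> * of_int q) (of_int m) g)))\<^sup>2) \<partial>count_space UNIV) =
    (\<integral>\<^sup>+z. indicator I (fst z) * ennreal ((cmod (F z))\<^sup>2) \<partial>field_measure)"
proof -
  have gL: "g \<in> L2 field_measure" and g0: "AE z in lebesgue. fst z \<notin> I \<longrightarrow> g z = 0"
    and pf: "AE \<xi> in lborel. \<xi> \<in> I \<longrightarrow> parseval_frame lebesgue (\<lambda>(p :: int, q :: int) t.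
          of_real (\<bar>\<xi>\<bar> powr (1/2)) * cis (- 2 * pi * \<xi> * (\<beta> * of_int q) * t) * g (\<xi>, t - \<alpha> * of_int p))"
    using g unfolding gabor_field_def L2_over_def by (auto simp: AE_field_measure_iff AE_lebesgue_iff)
  obtain F' where F' [measurable]: "F' \<in> borel_measurable borel" and FF': "AE z in lborel. F z = F' z"
    by (rule lebesgue_ex_borel) (use F in \<open>auto simp: L2_field_iff\<close>)
  obtain g' where g' [measurable]: "g' \<in> borel_measurable borel" and gg': "AE z in lborel. g z = g' z"
    by (rule lebesgue_ex_borel) (use gL in \<open>auto simp: L2_field_iff\<close>)
  define \<Phi> where "\<Phi> \<xi> = (\<integral>\<^sup>+t. ennreal ((cmod (F' (\<xi>, t)))\<^sup>2) \<partial>lborel)" for \<xi>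
  define h where "h p q \<xi> = (\<integral>t. \<bar>\<xi>\<bar> *\<^sub>R (F' (\<xi>, t) *
      cnj (cis (- 2 * pi * \<xi> * (\<beta> * of_int q) * t) * g' (\<xi>, t - \<alpha> * of_int p))) \<partial>lborel)" for p q :: int and \<xi>
  have [measurable]: "\<Phi> \<in> borel_measurable borel"
    unfolding \<Phi>_def[abs_def] by measurable
  have That_eq: "AE z in lebesgue. That k l m g z = That k l m g' z" for k l m
    using AE_prod_affine[of 1 1 "\<lambda>z. g z = g' z" "- k"] gg'
    by (auto simp: AE_lebesgue_iff That_apply elim: eventually_mono)
  have fubini1: "integrable (lborel \<Otimes>\<^sub>M lborel) (\<lambda>z. \<bar>fst z\<bar> *\<^sub>R (F' z * cnj (That k l m g' z)))"
    and fubini2: "L2_inner field_measure F (That k l m g) =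
      (\<integral>\<xi>. \<integral>t. \<bar>\<xi>\<bar> *\<^sub>R (F' (\<xi>, t) * cnj (That k l m g' (\<xi>, t))) \<partial>lborel \<partial>lborel)" for k l m
    by (rule L2_inner_field_fubini[OF F That_L2[OF gL] F' That_borel_measurable[OF g']
        FF'[folded AE_lebesgue_iff] That_eq])+
  have h_int: "integrable lborel (h p q)" for p q
    using lborel_pair.integrable_fst'[OF fubini1[where k = "\<alpha> * of_int p" and l = "\<beta> * of_int q" and m = 0]]
    by (simp add: h_def[abs_def] That_apply)
  then have h_meas [measurable]: "h p q \<in> borel_measurable borel" for p q
    using borel_measurable_integrable by force
  have inner: "L2_inner field_measure F (That (\<alpha> * of_int p) (\<beta> * of_int q) (of_int m) g) =
      (\<integral>\<xi>. h p q \<xi> * cnj (fourier_char m \<xi>) \<partial>lborel)" for p q m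
  proof -
    have "(\<integral>t. \<bar>\<xi>\<bar> *\<^sub>R (F' (\<xi>, t) * cnj (That (\<alpha> * of_int p) (\<beta> * of_int q) (of_int m) g' (\<xi>, t))) \<partial>lborel) =
        h p q \<xi> * cnj (fourier_char m \<xi>)" for \<xi>
    proof -
      have "(\<integral>t. \<bar>\<xi>\<bar> *\<^sub>R (F' (\<xi>, t) * cnj (That (\<alpha> * of_int p) (\<beta> * of_int q) (of_int m) g' (\<xi>, t))) \<partial>lborel) =
          (\<integral>t. (\<bar>\<xi>\<bar> *\<^sub>R (F' (\<xi>, t) * cnj (cis (- 2 * pi * \<xi> * (\<beta> * of_int q) * t) * g' (\<xi>, t - \<alpha> * of_int p)))) *
            cnj (fourier_char m \<xi>) \<partial>lborel)"
        by (rule Bochner_Integration.integral_cong) (simp_all add: That_apply fourier_char_def mult_ac)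
      also have "\<dots> = h p q \<xi> * cnj (fourier_char m \<xi>)"
        unfolding h_def by (rule integral_mult_left_zero)
      finally show ?thesis .
    qed
    then show ?thesis
      using fubini2[where k = "\<alpha> * of_int p" and l = "\<beta> * of_int q" and m = "of_int m"] by simp
  qed
  have supp: "AE \<xi> in lborel. \<xi> \<notin> I \<longrightarrow> (\<forall>p q. h p q \<xi> = 0)"
  proof -
    have "AE z in lborel. fst z \<notin> I \<longrightarrow> g' z = 0"
      using g0 gg' unfolding AE_lebesgue_iff by eventually_elim simp
    from AE_lborel_sections[OF this] show ?thesis
    proof eventually_elim
      case (elim \<xi>)
      show ?case
      proof (intro impI allI)
        fix p q :: int assume "\<xi> \<notin> I"
        then have "AE t in lborel. g' (\<xi>, t) = 0"
          using elim by simp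
        from AE_lborel_shift[OF this, of "- (\<alpha> * of_int p)"]
        have "AE t in lborel. \<bar>\<xi>\<bar> *\<^sub>R (F' (\<xi>, t) *
            cnj (cis (- 2 * pi * \<xi> * (\<beta> * of_int q) * t) * g' (\<xi>, t - \<alpha> * of_int p))) = 0"
          by eventually_elim simp
        then show "h p q \<xi> = 0"
          unfolding h_def by (rule integral_eq_zero_AE)
      qed
    qed
  qed
  have field: "(\<integral>\<^sup>+z. ennreal \<bar>fst z\<bar> * ennreal ((cmod (F z))\<^sup>2) \<partial>lebesgue) = (\<integral>\<^sup>+\<xi>. ennreal \<bar>\<xi>\<bar> * \<Phi> \<xi> \<partial>lborel)"
  proof -
    have "(\<integral>\<^sup>+z. ennreal \<bar>fst z\<bar> * ennreal ((cmod (F z))\<^sup>2) \<partial>lebesgue) =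
        (\<integral>\<^sup>+z. ennreal \<bar>fst z\<bar> * ennreal ((cmod (F' z))\<^sup>2) \<partial>lebesgue)"
      by (rule nn_integral_cong_AE) (use FF' in \<open>auto simp: AE_lebesgue_iff elim: eventually_mono\<close>)
    then show ?thesis
      unfolding \<Phi>_def by (subst (asm) nn_integral_field_borel) auto
  qed
  have finite: "AE \<xi> in lborel. \<Phi> \<xi> < \<infinity>"
  proof -
    have "(\<integral>\<^sup>+\<xi>. ennreal \<bar>\<xi>\<bar> * \<Phi> \<xi> \<partial>lborel) \<noteq> \<infinity>"
      using F field by (auto simp: L2_field_iff)
    then have "AE \<xi> in lborel. ennreal \<bar>\<xi>\<bar> * \<Phi> \<xi> \<noteq> \<infinity>"
      by (intro nn_integral_PInf_AE) auto
    then show ?thesis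
      using AE_lborel_singleton[of "0::real"]
      by eventually_elim (auto simp: ennreal_mult_eq_top_iff less_top)
  qed
  have fiber: "AE \<xi> in lborel. (\<integral>\<^sup>+(p, q). ennreal ((cmod (h p q \<xi>))\<^sup>2) \<partial>count_space UNIV) =
      indicator I \<xi> * (ennreal \<bar>\<xi>\<bar> * \<Phi> \<xi>)"
    using supp finite pf AE_lborel_sections[OF gg']
  proof eventually_elim
    case (elim \<xi>)
    show ?case
    proof (cases "\<xi> \<in> I")
      case True
      have "(\<integral>\<^sup>+(p, q). ennreal ((cmod (h p q \<xi>))\<^sup>2) \<partial>count_space UNIV) = ennreal \<bar>\<xi>\<bar> * \<Phi> \<xi>"
        unfolding h_def \<Phi>_def
        by (rule gabor_fiber[where G = "\<lambda>t. g (\<xi>, t)" and G' = "\<lambda>t. g' (\<xi>, t)"])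
          (use elim True in \<open>simp_all add: \<Phi>_def\<close>)
      then show ?thesis using True by simp
    next
      case False
      then show ?thesis using elim by (simp add: case_prod_unfold)
    qed
  qed
  have translates: "(\<integral>\<^sup>+m. ennreal ((cmod (\<integral>\<xi>. h p q \<xi> * cnj (fourier_char m \<xi>) \<partial>lborel))\<^sup>2) \<partial>count_space UNIV) =
      (\<integral>\<^sup>+\<xi>. ennreal ((cmod (h p q \<xi>))\<^sup>2) \<partial>lborel)" for p q
  proof (rule parseval_disjoint_translates[OF h_int, where N = N])
    show "AE x in lborel. h p q x \<noteq> 0 \<longrightarrow> x \<in> {- real N..<real N}"
      using supp bound by eventually_elim auto
    show "AE x in lborel. h p q x = 0 \<or> h p q (x + of_int n) = 0" if "n \<noteq> 0" for n :: int
      using supp AE_lborel_shift[OF supp, of "of_int n"] disj[OF that] by eventually_elim auto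
  qed
  have [measurable]: "(\<lambda>z. indicator I (fst z) :: ennreal) \<in> borel_measurable (lebesgue :: (real \<times> real) measure)"
    by (rule indicator_fst_measurable[OF I])
  have "(\<integral>\<^sup>+(p :: int, q :: int, m :: int). ennreal ((cmod (L2_inner field_measure F
      (That (\<alpha> * of_int p) (\<beta> * of_int q) (of_int m) g)))\<^sup>2) \<partial>count_space UNIV) =
    (\<integral>\<^sup>+p. \<integral>\<^sup>+q. \<integral>\<^sup>+m. ennreal ((cmod (\<integral>\<xi>. h p q \<xi> * cnj (fourier_char m \<xi>) \<partial>lborel))\<^sup>2)
      \<partial>count_space UNIV \<partial>count_space UNIV \<partial>count_space UNIV)"
    by (simp add: nn_integral_count_space_Pair inner)
  also have "\<dots> = (\<integral>\<^sup>+p. \<integral>\<^sup>+q. \<integral>\<^sup>+\<xi>. ennreal ((cmod (h p q \<xi>))\<^sup>2) \<partial>lborel \<partial>count_space UNIV \<partial>count_space UNIV)"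
    by (simp only: translates)
  also have "\<dots> = (\<integral>\<^sup>+j. \<integral>\<^sup>+\<xi>. ennreal ((cmod (h (fst j) (snd j) \<xi>))\<^sup>2) \<partial>lborel \<partial>count_space UNIV)"
    by (simp add: nn_integral_count_space_Pair)
  also have "\<dots> = (\<integral>\<^sup>+\<xi>. \<integral>\<^sup>+j. ennreal ((cmod (h (fst j) (snd j) \<xi>))\<^sup>2) \<partial>count_space UNIV \<partial>lborel)"
    by (rule nn_integral_count_space_nn_integral[symmetric]) auto
  also have "\<dots> = (\<integral>\<^sup>+\<xi>. indicator I \<xi> * (ennreal \<bar>\<xi>\<bar> * \<Phi> \<xi>) \<partial>lborel)"
    by (rule nn_integral_cong_AE) (use fiber in \<open>simp add: case_prod_unfold\<close>)
  also have "\<dots> = (\<integral>\<^sup>+z. indicator I (fst z) * ennreal ((cmod (F z))\<^sup>2) \<partial>field_measure)"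
  proof -
    obtain B where B [measurable]: "B \<in> sets borel" and IB: "AE x in lborel. x \<in> I \<longleftrightarrow> x \<in> B"
      by (rule lebesgue_ex_borel_set[OF I])
    have "(\<integral>\<^sup>+z. indicator I (fst z) * ennreal ((cmod (F z))\<^sup>2) \<partial>field_measure) =
        (\<integral>\<^sup>+z. ennreal \<bar>fst z\<bar> * (indicator I (fst z) * ennreal ((cmod (F z))\<^sup>2)) \<partial>lebesgue)"
      by (rule nn_integral_field_measure) (use F in \<open>auto simp: L2_field_iff\<close>)
    also have "\<dots> = (\<integral>\<^sup>+z. ennreal \<bar>fst z\<bar> * (indicator B (fst z) * ennreal ((cmod (F' z))\<^sup>2)) \<partial>lebesgue)"
    proof (rule nn_integral_cong_AE)
      show "AE z in lebesgue. ennreal \<bar>fst z\<bar> * (indicator I (fst z) * ennreal ((cmod (F z))\<^sup>2)) =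
          ennreal \<bar>fst z\<bar> * (indicator B (fst z) * ennreal ((cmod (F' z))\<^sup>2))"
        using FF' AE_lborel_fst[OF IB] unfolding AE_lebesgue_iff
        by eventually_elim (auto simp: indicator_def)
    qed
    also have "\<dots> = (\<integral>\<^sup>+\<xi>. ennreal \<bar>\<xi>\<bar> * (\<integral>\<^sup>+t. indicator B \<xi> * ennreal ((cmod (F' (\<xi>, t)))\<^sup>2) \<partial>lborel) \<partial>lborel)"
      by (subst nn_integral_field_borel) auto
    also have "\<dots> = (\<integral>\<^sup>+\<xi>. indicator B \<xi> * (ennreal \<bar>\<xi>\<bar> * \<Phi> \<xi>) \<partial>lborel)"
      unfolding \<Phi>_def by (intro nn_integral_cong) (simp add: nn_integral_cmult mult_ac)
    also have "\<dots> = (\<integral>\<^sup>+\<xi>. indicator I \<xi> * (ennreal \<bar>\<xi>\<bar> * \<Phi> \<xi>) \<partial>lborel)"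
      by (rule nn_integral_cong_AE) (use IB in \<open>auto simp: indicator_def elim: eventually_mono\<close>)
    finally show ?thesis ..
  qed
  finally show ?thesis .
qed

section \<open>Gabor fields with an oriented window\<close>

lemma unit_window_tiling:
  assumes "\<sigma> \<in> {- 1, 1 :: real}"
  shows "(\<integral>\<^sup>+(p :: int). indicator {0..<1} (\<sigma> * (t - of_int p)) \<partial>count_space UNIV) = (1 :: ennreal)"
proof -
  have "\<exists>p0 :: int. \<forall>p :: int. \<sigma> * (t - of_int p) \<in> {0..<1} \<longleftrightarrow> p = p0"
  proof (cases "\<sigma> = 1")
    case True
    then show ?thesis
      by (intro exI[of _ "\<lfloor>t\<rfloor>"]) (auto, linarith+)
  next
    case False
    then have "\<sigma> = - 1" using assms by simp
    then show ?thesis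
      by (intro exI[of _ "\<lceil>t\<rceil>"]) (auto, linarith+)
  qed
  then obtain p0 :: int where "\<And>p :: int. \<sigma> * (t - of_int p) \<in> {0..<1} \<longleftrightarrow> p = p0"
    by blast
  then have "(\<integral>\<^sup>+(p :: int). indicator {0..<1} (\<sigma> * (t - of_int p)) \<partial>count_space UNIV) =
      (\<integral>\<^sup>+p. indicator {p0} p \<partial>count_space UNIV :: ennreal)"
    by (intro nn_integral_cong) (simp add: indicator_def)
  then show ?thesis by simp
qed

text \<open>After the substitution \<open>s = \<xi> t\<close> the modulations become the characters with integer frequencies, and the window becomes
  an interval of length \<open>|\<xi>| \<le> 1\<close>, whose integer translates are disjoint.\<close>

lemma unit_window_parseval:
  fixes \<xi> \<sigma> :: real and f :: "real \<Rightarrow> complex"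
  assumes \<xi>: "\<xi> \<noteq> 0" "\<bar>\<xi>\<bar> \<le> 1" and \<sigma>: "\<sigma> \<in> {- 1, 1}"
    and [measurable]: "f \<in> borel_measurable borel" and f2: "(\<integral>\<^sup>+t. ennreal ((cmod (f t))\<^sup>2) \<partial>lborel) < \<infinity>"
  shows "(\<integral>\<^sup>+(q :: int). ennreal ((cmod (\<integral>t. f t * cnj (of_real (\<bar>\<xi>\<bar> powr (1/2)) * cis (- 2 * pi * \<xi> * of_int q * t) *
      indicator {0..<1} (\<sigma> * (t - of_int p))) \<partial>lborel))\<^sup>2) \<partial>count_space UNIV) =
    (\<integral>\<^sup>+t. indicator {0..<1} (\<sigma> * (t - of_int p)) * ennreal ((cmod (f t))\<^sup>2) \<partial>lborel)" (is "?L = ?R")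
proof -
  \<comment> \<open>The conjugate matches the sign of the frequency in the system with the one in the Fourier coefficients.\<close>
  define H where "H s = cnj (f (s / \<xi>)) * indicator {0..<1} (\<sigma> * (s / \<xi> - of_int p))" for s
  have [measurable]: "H \<in> borel_measurable borel"
    unfolding H_def[abs_def] by measurable
  have supp: "\<bar>s / \<xi> - of_int p\<bar> < 1" if "H s \<noteq> 0" for s
    using that \<sigma> by (auto simp: H_def indicator_def split: if_splits)
  have scale: "(\<integral>\<^sup>+t. \<phi> t \<partial>lborel) = ennreal \<bar>1 / \<xi>\<bar> * (\<integral>\<^sup>+s. \<phi> (s / \<xi>) \<partial>lborel)"
    if "\<phi> \<in> borel_measurable borel" for \<phi> :: "real \<Rightarrow> ennreal"
    using nn_integral_real_affine[OF that, of "1 / \<xi>" 0] \<xi> by simp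
  have H2: "(\<integral>\<^sup>+s. ennreal ((cmod (H s))\<^sup>2) \<partial>lborel) = ennreal \<bar>\<xi>\<bar> * ?R"
  proof -
    have "?R = ennreal \<bar>1 / \<xi>\<bar> * (\<integral>\<^sup>+s. ennreal ((cmod (H s))\<^sup>2) \<partial>lborel)"
      by (subst scale) (auto simp: H_def norm_mult power_mult_distrib indicator_def
          intro!: arg_cong2[where f = "(*)"] nn_integral_cong)
    then have "ennreal \<bar>\<xi>\<bar> * ?R = (ennreal \<bar>\<xi>\<bar> * ennreal \<bar>1 / \<xi>\<bar>) * (\<integral>\<^sup>+s. ennreal ((cmod (H s))\<^sup>2) \<partial>lborel)"
      by (simp only: mult.assoc)
    also have "ennreal \<bar>\<xi>\<bar> * ennreal \<bar>1 / \<xi>\<bar> = 1"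
      using \<xi> by (simp add: ennreal_mult[symmetric])
    finally show ?thesis by simp
  qed
  define N where "N = nat \<bar>p\<bar> + 2"
  have range: "s \<in> {- real N..<real N}" if "H s \<noteq> 0" for s
  proof -
    have "\<bar>s / \<xi>\<bar> < real N"
      using supp[OF that] unfolding N_def by (auto simp: abs_less_iff)
    then have "\<bar>s\<bar> < \<bar>\<xi>\<bar> * real N"
      using \<xi>(1) by (simp add: abs_divide divide_less_eq mult.commute)
    also have "\<dots> \<le> 1 * real N"
      using \<xi> by (intro mult_right_mono) auto
    finally show ?thesis by auto
  qed
  have "H s = 0 \<or> H (s + of_int n) = 0" if n: "n \<noteq> 0" for n :: int and s
  proof (rule ccontr)
    assume "\<not> ?thesis"
    then have "H s \<noteq> 0" "H (s + of_int n) \<noteq> 0" by auto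
    then have "\<sigma> * (s / \<xi> - of_int p) \<in> {0..<1}" "\<sigma> * ((s + of_int n) / \<xi> - of_int p) \<in> {0..<1}"
      by (auto simp: H_def indicator_def split: if_splits)
    then have "\<bar>\<sigma> * ((s + of_int n) / \<xi> - of_int p) - \<sigma> * (s / \<xi> - of_int p)\<bar> < 1"
      by (simp add: abs_less_iff)
    also have "\<sigma> * ((s + of_int n) / \<xi> - of_int p) - \<sigma> * (s / \<xi> - of_int p) = \<sigma> * (of_int n / \<xi>)"
      by (simp add: add_divide_distrib algebra_simps)
    finally have "\<bar>of_int n / \<xi>\<bar> < 1"
      using \<sigma> by (auto simp: abs_mult)
    then have "\<bar>real_of_int n\<bar> < \<bar>\<xi>\<bar>"
      using \<xi>(1) by (simp add: abs_divide divide_less_eq)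
    then show False using \<xi>(2) n by linarith
  qed
  moreover have Hint: "integrable lborel H"
  proof (rule Bochner_Integration.integrable_bound)
    have "?R \<le> (\<integral>\<^sup>+t. ennreal ((cmod (f t))\<^sup>2) \<partial>lborel)"
      by (rule nn_integral_mono) (simp add: indicator_def)
    then have "?R < \<infinity>"
      using f2 by (rule le_less_trans)
    then have "(\<integral>\<^sup>+s. ennreal ((cmod (H s))\<^sup>2) \<partial>lborel) < \<infinity>"
      unfolding H2 by (simp add: ennreal_mult_less_top)
    then have "integrable lborel (\<lambda>s. (cmod (H s))\<^sup>2)"
      by (intro integrableI_bounded) auto
    then show "integrable lborel (\<lambda>s. indicator {- real N..real N} s + (cmod (H s))\<^sup>2)"
      by (intro Bochner_Integration.integrable_add integrable_real_indicator) auto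
    have "cmod (H s) \<le> indicator {- real N..real N} s + (cmod (H s))\<^sup>2" for s
    proof (cases "H s = 0")
      case False
      then have "s \<in> {- real N..real N}" using range[of s] by simp
      moreover have "cmod (H s) \<le> 1 + (cmod (H s))\<^sup>2"
        using sum_squares_bound[of "cmod (H s)" 1] norm_ge_zero[of "H s"] by (simp, linarith)
      ultimately show ?thesis by simp
    qed simp
    then show "AE s in lborel. cmod (H s) \<le> norm (indicator {- real N..real N} s + (cmod (H s))\<^sup>2)"
      by (intro AE_I2) (metis abs_ge_self order_trans real_norm_def)
  qed simp
  ultimately have parseval: "(\<integral>\<^sup>+ q. ennreal ((cmod (\<integral>s. H s * cnj (fourier_char q s) \<partial>lborel))\<^sup>2) \<partial>count_space UNIV)
    = (\<integral>\<^sup>+ s. ennreal ((cmod (H s))\<^sup>2) \<partial>lborel)"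
    using range by (intro parseval_disjoint_translates[where N = N]) auto
  have coeff: "ennreal ((cmod (\<integral>t. f t * cnj (of_real (\<bar>\<xi>\<bar> powr (1/2)) * cis (- 2 * pi * \<xi> * of_int q * t) *
      indicator {0..<1} (\<sigma> * (t - of_int p))) \<partial>lborel))\<^sup>2) =
      ennreal \<bar>1 / \<xi>\<bar> * ennreal ((cmod (\<integral>s. H s * cnj (fourier_char q s) \<partial>lborel))\<^sup>2)" (is "ennreal ((cmod ?I)\<^sup>2) = _") for q
  proof -
    have "?I = \<bar>1 / \<xi>\<bar> *\<^sub>R (\<integral>s. cnj (of_real (\<bar>\<xi>\<bar> powr (1/2)) * (H s * cnj (fourier_char q s))) \<partial>lborel)"
      using \<xi>(1)
      by (subst lborel_integral_real_affine[of "1 / \<xi>" _ 0])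
        (auto simp: H_def fourier_char_def cis_cnj mult_ac indicator_def
          intro!: arg_cong2[where f = scaleR] Bochner_Integration.integral_cong)
    also have "\<dots> = \<bar>1 / \<xi>\<bar> *\<^sub>R cnj (of_real (\<bar>\<xi>\<bar> powr (1/2)) * (\<integral>s. H s * cnj (fourier_char q s) \<partial>lborel))"
      by (simp only: Bochner_Integration.integral_cnj integral_mult_right_zero)
    finally have "(cmod ?I)\<^sup>2 = (\<bar>1 / \<xi>\<bar> * \<bar>1 / \<xi>\<bar> * \<bar>\<xi>\<bar>) * (cmod (\<integral>s. H s * cnj (fourier_char q s) \<partial>lborel))\<^sup>2"
      by (simp add: norm_mult power_mult_distrib powr_half_sqrt power2_eq_square)
    also have "\<bar>1 / \<xi>\<bar> * \<bar>1 / \<xi>\<bar> * \<bar>\<xi>\<bar> = \<bar>1 / \<xi>\<bar>"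
      using \<xi>(1) by (auto simp: abs_if)
    finally show ?thesis
      by (simp only: ennreal_mult abs_ge_zero zero_le_power2)
  qed
  have "?L = ennreal \<bar>1 / \<xi>\<bar> * (\<integral>\<^sup>+ q. ennreal ((cmod (\<integral>s. H s * cnj (fourier_char q s) \<partial>lborel))\<^sup>2) \<partial>count_space UNIV)"
    unfolding coeff by (rule nn_integral_cmult) simp
  also have "\<dots> = (ennreal \<bar>1 / \<xi>\<bar> * ennreal \<bar>\<xi>\<bar>) * ?R"
    unfolding parseval H2 by (simp only: mult.assoc)
  also have "ennreal \<bar>1 / \<xi>\<bar> * ennreal \<bar>\<xi>\<bar> = 1"
    using \<xi> by (simp add: ennreal_mult[symmetric])
  finally show ?thesis by simp
qed

lemma unit_window_frame:
  fixes \<xi> \<sigma> :: real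
  assumes \<xi>: "\<xi> \<noteq> 0" "\<bar>\<xi>\<bar> \<le> 1" and \<sigma>: "\<sigma> \<in> {- 1, 1}"
  shows "parseval_frame lebesgue (\<lambda>(p :: int, q :: int) t.
    of_real (\<bar>\<xi>\<bar> powr (1/2)) * cis (- 2 * pi * \<xi> * of_int q * t) * indicator {0..<1} (\<sigma> * (t - of_int p)))"
    (is "parseval_frame lebesgue ?\<psi>")
  unfolding parseval_frame_iff
proof (intro conjI allI ballI)
  have \<psi>_meas: "?\<psi> j \<in> borel_measurable borel" for j
    by (cases j) simp
  have \<psi>_leb: "?\<psi> j \<in> borel_measurable lebesgue" for j
    using \<psi>_meas[of j] by (intro measurable_completion) simp
  fix j :: "int \<times> int"
  obtain p q where j: "j = (p, q)" by (cases j)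
  have "(\<integral>\<^sup>+t. ennreal ((cmod (?\<psi> j t))\<^sup>2) \<partial>lborel) \<le> (\<integral>\<^sup>+t. indicator {real_of_int p - 1..real_of_int p + 1} t \<partial>lborel)"
  proof (rule nn_integral_mono)
    fix t
    have "(cmod (?\<psi> j t))\<^sup>2 = \<bar>\<xi>\<bar> * indicator {0..<1} (\<sigma> * (t - of_int p))"
      by (simp add: j norm_mult power_mult_distrib powr_half_sqrt indicator_def)
    then show "ennreal ((cmod (?\<psi> j t))\<^sup>2) \<le> indicator {real_of_int p - 1..real_of_int p + 1} t"
      using \<xi> \<sigma> by (auto simp: indicator_def)
  qed
  also have "\<dots> < \<infinity>"
    by simp
  finally show "?\<psi> j \<in> L2 lebesgue"
    using \<psi>_leb by (simp add: L2_iff nn_integral_completion)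
next
  fix f :: "real \<Rightarrow> complex" assume f: "f \<in> L2 lebesgue"
  have \<psi>_meas: "?\<psi> j \<in> borel_measurable borel" for j
    by (cases j) simp
  have \<psi>_leb: "?\<psi> j \<in> borel_measurable lebesgue" for j
    using \<psi>_meas[of j] by (intro measurable_completion) simp
  have fm: "f \<in> borel_measurable lebesgue"
    using f by (simp add: L2_iff)
  obtain f' where [measurable]: "f' \<in> borel_measurable borel" and ff': "AE t in lborel. f t = f' t"
    by (rule lebesgue_ex_borel[OF fm])
  have f2: "(\<integral>\<^sup>+t. ennreal ((cmod (f t))\<^sup>2) \<partial>lebesgue) = (\<integral>\<^sup>+t. ennreal ((cmod (f' t))\<^sup>2) \<partial>lborel)"
    unfolding nn_integral_completion by (rule nn_integral_cong_AE) (use ff' in \<open>auto elim: eventually_mono\<close>)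
  then have f'2: "(\<integral>\<^sup>+t. ennreal ((cmod (f' t))\<^sup>2) \<partial>lborel) < \<infinity>"
    using f by (simp add: L2_iff)
  have inner: "L2_inner lebesgue f (?\<psi> (p, q)) = (\<integral>t. f' t * cnj (of_real (\<bar>\<xi>\<bar> powr (1/2)) * cis (- 2 * pi * \<xi> * of_int q * t) *
      indicator {0..<1} (\<sigma> * (t - of_int p))) \<partial>lborel)" for p q
  proof -
    have "(\<integral>t. f t * cnj (?\<psi> (p, q) t) \<partial>lebesgue) = (\<integral>t. f' t * cnj (?\<psi> (p, q) t) \<partial>lebesgue)"
    proof (rule integral_cong_AE[rotated 2])
      show "AE t in lebesgue. f t * cnj (?\<psi> (p, q) t) = f' t * cnj (?\<psi> (p, q) t)"
        using ff' unfolding AE_lebesgue_iff by eventually_elim simp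
      show "(\<lambda>t. f t * cnj (?\<psi> (p, q) t)) \<in> borel_measurable lebesgue"
        using fm \<psi>_leb[of "(p, q)"] by (intro borel_measurable_times borel_measurable_cnj)
      show "(\<lambda>t. f' t * cnj (?\<psi> (p, q) t)) \<in> borel_measurable lebesgue"
        using \<psi>_meas[of "(p, q)"] by (intro measurable_completion borel_measurable_times borel_measurable_cnj) auto
    qed
    also have "\<dots> = (\<integral>t. f' t * cnj (?\<psi> (p, q) t) \<partial>lborel)"
      using \<psi>_meas[of "(p, q)"] by (intro integral_completion borel_measurable_times borel_measurable_cnj) auto
    finally show ?thesis
      by (simp add: L2_inner_def)
  qed
  have "(\<integral>\<^sup>+j. ennreal ((cmod (L2_inner lebesgue f (?\<psi> j)))\<^sup>2) \<partial>count_space UNIV) =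
      (\<integral>\<^sup>+(p::int). \<integral>\<^sup>+t. indicator {0..<1} (\<sigma> * (t - of_int p)) * ennreal ((cmod (f' t))\<^sup>2) \<partial>lborel \<partial>count_space UNIV)"
    unfolding nn_integral_count_space_Pair inner
    by (rule nn_integral_cong) (rule unit_window_parseval[OF \<xi> \<sigma> _ f'2], simp)
  also have "\<dots> = (\<integral>\<^sup>+t. \<integral>\<^sup>+(p::int). indicator {0..<1} (\<sigma> * (t - of_int p)) * ennreal ((cmod (f' t))\<^sup>2) \<partial>count_space UNIV \<partial>lborel)"
    by (rule nn_integral_count_space_nn_integral[symmetric]) auto
  also have "\<dots> = (\<integral>\<^sup>+t. ennreal ((cmod (f' t))\<^sup>2) \<partial>lborel)"
    by (intro nn_integral_cong) (simp add: nn_integral_multc unit_window_tiling[OF \<sigma>])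
  finally show "(\<integral>\<^sup>+j. ennreal ((cmod (L2_inner lebesgue f (?\<psi> j)))\<^sup>2) \<partial>count_space UNIV) =
      (\<integral>\<^sup>+t. ennreal ((cmod (f t))\<^sup>2) \<partial>lebesgue)"
    unfolding f2 .
qed

lemma parseval_frame_cmult:
  assumes "parseval_frame M \<psi>" "cmod c = 1"
  shows "parseval_frame M (\<lambda>j t. c * \<psi> j t)"
proof -
  have "L2_inner M f (\<lambda>t. c * \<psi> j t) = cnj c * L2_inner M f (\<psi> j)" for f j
    unfolding L2_inner_def by (simp add: mult.left_commute[of _ "cnj c"])
  moreover have "(\<lambda>t. c * \<psi> j t) \<in> L2 M" if "\<psi> j \<in> L2 M" for j
    using that assms(2) by (auto simp: L2_def norm_mult intro!: borel_measurable_times)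
  ultimately show ?thesis
    using assms by (simp add: parseval_frame_def norm_mult)
qed

text \<open>The Gabor field behind both consequences of the hypothesis: the indicator of \<open>[0,1)\<close> in \<open>t\<close> for \<open>\<xi> > 0\<close>, of \<open>(-1,0]\<close> for \<open>\<xi> < 0\<close>,
  with an additional phase \<open>e\<close> on the negative half-line. The value 0 at \<open>\<xi> = 0\<close> makes \<open>oriented_window_decomposition\<close> hold at every point.\<close>

definition oriented_window :: "complex \<Rightarrow> real set \<Rightarrow> real \<times> real \<Rightarrow> complex" where
  "oriented_window e I z = (if 0 < fst z then 1 else if fst z < 0 then e else 0) *
     (indicator I (fst z) * indicator {0..<1} (sgn (fst z) * snd z))"

lemma gabor_field_oriented_window:
  assumes I: "I \<in> sets lebesgue" and bound: "ae_subset I {-1..1}" and e: "cmod e = 1"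
  shows "gabor_field I 1 1 (oriented_window e I)"
  unfolding gabor_field_def
proof
  have "(\<lambda>z. indicator I (fst z) :: complex) \<in> borel_measurable (lebesgue :: (real \<times> real) measure)"
    by (rule measurable_compose[OF measurable_fst_lebesgue]) (use I in simp)
  moreover have "(\<lambda>z. indicator {0..<1} (sgn (fst z) * snd z) :: complex) \<in> borel_measurable (lebesgue :: (real \<times> real) measure)"
    by (rule measurable_completion) measurable
  moreover have "(\<lambda>z. if 0 < fst z then 1 else if fst z < 0 then e else 0) \<in> borel_measurable (lebesgue :: (real \<times> real) measure)"
    by (rule measurable_completion) measurable
  ultimately have meas: "oriented_window e I \<in> borel_measurable lebesgue"
    unfolding oriented_window_def[abs_def] by (intro borel_measurable_times)
  have "(\<integral>\<^sup>+z. ennreal \<bar>fst z\<bar> * ennreal ((cmod (oriented_window e I z))\<^sup>2) \<partial>lebesgue) \<le>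
      (\<integral>\<^sup>+z. indicator (cbox (- 1, - 1) (1, 1)) z \<partial>(lebesgue :: (real \<times> real) measure))"
  proof (rule nn_integral_mono_AE)
    show "AE z in lebesgue. ennreal \<bar>fst z\<bar> * ennreal ((cmod (oriented_window e I z))\<^sup>2) \<le> indicator (cbox (- 1, - 1) (1, 1)) z"
      using AE_lborel_fst[OF bound[unfolded ae_subset_def AE_lebesgue_iff]] unfolding AE_lebesgue_iff
    proof eventually_elim
      case (elim z)
      then show ?case
        using e by (cases z) (auto simp: oriented_window_def indicator_def sgn_if cbox_Pair_eq ennreal_mult[symmetric]
            split: if_splits)
    qed
  qed
  also have "\<dots> < \<infinity>"
    using emeasure_lborel_cbox_finite[of "(- 1, - 1) :: real \<times> real" "(1, 1)"]
    by (simp add: nn_integral_completion)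
  finally have "oriented_window e I \<in> L2 field_measure"
    using meas by (simp add: L2_field_iff)
  then show "oriented_window e I \<in> L2_over I"
    by (auto simp: L2_over_def oriented_window_def)
  let ?\<psi> = "\<lambda>\<xi> (p :: int, q :: int) t. of_real (\<bar>\<xi>\<bar> powr (1/2)) * cis (- 2 * pi * \<xi> * (1 * of_int q) * t) *
    oriented_window e I (\<xi>, t - 1 * of_int p)"
  show "AE \<xi> in lebesgue. \<xi> \<in> I \<longrightarrow> parseval_frame lebesgue (?\<psi> \<xi>)"
    using bound AE_lborel_singleton[of "0::real"] unfolding ae_subset_def AE_lebesgue_iff
  proof eventually_elim
    case (elim \<xi>)
    show ?case
    proof
      assume "\<xi> \<in> I"
      define c where "c = (if 0 < \<xi> then 1 else e)"
      have "cmod c = 1" using e by (simp add: c_def)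
      moreover have "sgn \<xi> \<in> {- 1, 1}" "\<bar>\<xi>\<bar> \<le> 1"
        using elim \<open>\<xi> \<in> I\<close> by (auto simp: sgn_if)
      ultimately have "parseval_frame lebesgue (\<lambda>j t. c * (case j of (p :: int, q :: int) \<Rightarrow> \<lambda>t.
          of_real (\<bar>\<xi>\<bar> powr (1/2)) * cis (- 2 * pi * \<xi> * of_int q * t) *
          indicator {0..<1} (sgn \<xi> * (t - of_int p))) t)"
        using elim by (intro parseval_frame_cmult unit_window_frame)
      also have "(\<lambda>j t. c * (case j of (p :: int, q :: int) \<Rightarrow> \<lambda>t.
          of_real (\<bar>\<xi>\<bar> powr (1/2)) * cis (- 2 * pi * \<xi> * of_int q * t) *
          indicator {0..<1} (sgn \<xi> * (t - of_int p))) t) = ?\<psi> \<xi>"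
        using elim \<open>\<xi> \<in> I\<close> by (auto simp: fun_eq_iff oriented_window_def c_def)
      finally show "parseval_frame lebesgue (?\<psi> \<xi>)" .
    qed
  qed
qed

section \<open>Dyadic dilation tiling\<close>

definition dilation_count :: "real set \<Rightarrow> real \<Rightarrow> ennreal" where
  "dilation_count S \<xi> = (\<integral>\<^sup>+(j::int). indicator S (2 powi j * \<xi>) \<partial>count_space UNIV)"

lemma dilation_count_eq_1_iff: "dilation_count S \<xi> = 1 \<longleftrightarrow> (\<exists>!j. 2 powi j * \<xi> \<in> S)"
proof -
  let ?A = "{j :: int. 2 powi j * \<xi> \<in> S}"
  have "dilation_count S \<xi> = (\<integral>\<^sup>+j. indicator ?A j \<partial>count_space UNIV)"
    unfolding dilation_count_def by (intro nn_integral_cong) (simp add: indicator_def)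
  also have "\<dots> = emeasure (count_space UNIV) ?A"
    by simp
  finally have "dilation_count S \<xi> = 1 \<longleftrightarrow> finite ?A \<and> card ?A = 1"
    by (auto simp: emeasure_count_space)
  also have "\<dots> \<longleftrightarrow> (\<exists>j. ?A = {j})"
    by (auto simp: card_1_singleton_iff)
  also have "\<dots> \<longleftrightarrow> (\<exists>!j. 2 powi j * \<xi> \<in> S)"
    unfolding Ex1_def set_eq_iff by auto
  finally show ?thesis .
qed

lemma dilation_indicator_measurable:
  assumes "S \<in> sets lebesgue" "a \<noteq> 0"
  shows "(\<lambda>z. indicator S (a * fst z) :: ennreal) \<in> borel_measurable (lebesgue :: (real \<times> real) measure)"
  using measurable_compose_prod_affine[OF assms(2), of 1 "\<lambda>z. indicator S (fst z) :: ennreal" 0]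
    indicator_fst_measurable[OF assms(1)] by simp

lemma dilation_count_measurable:
  assumes "S \<in> sets lebesgue"
  shows "(\<lambda>z. dilation_count S (fst z)) \<in> borel_measurable (lebesgue :: (real \<times> real) measure)"
proof -
  have "dilation_count S \<xi> = (\<Sum>n. indicator S (2 powi int_decode n * \<xi>))" for \<xi>
    unfolding dilation_count_def
    by (subst nn_integral_bij_count_space[OF bij_int_decode, symmetric]) (rule nn_integral_count_space_nat)
  moreover have [measurable]: "(\<lambda>z. indicator S (2 powi int_decode n * fst z) :: ennreal) \<in>
      borel_measurable (lebesgue :: (real \<times> real) measure)" for n
    by (rule dilation_indicator_measurable[OF assms]) simp
  ultimately show ?thesis
    by simp
qed

lemma Uhat_apply:
  "Uhat g \<alpha> \<beta> u (j, p, q, m) = Dhat u (2 powi j) (That (\<alpha> * of_int p) (\<beta> * of_int q) (of_int m) g)"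
  by (simp add: Uhat_def)

lemma Uhat_L2:
  assumes "g \<in> L2 field_measure" "unitary_multiplier u"
  shows "Uhat g \<alpha> \<beta> u i \<in> L2 field_measure"
  by (cases i) (auto simp: Uhat_apply intro!: Dhat_L2 That_L2 assms unimodular_weight_multiplier)

text \<open>The coefficients at level \<open>j\<close> are those of \<open>gabor_translates_sum\<close> for the adjoint dilate of \<open>f\<close>. Their sum depends
  on the modulus of this dilate, which is the same for all multipliers, and \<open>nn_integral_Dhat\<close> turns the integral over \<open>I\<close>
  into one of \<open>f\<close> over the dilate of \<open>I\<close> by \<open>1 / 2\<^sup>j\<close>.\<close>

theorem Uhat_sum:
  fixes \<alpha> \<beta> :: real
  assumes I: "I \<in> sets lebesgue"
    and bound: "AE x in lborel. x \<in> I \<longrightarrow> x \<in> {- real N..<real N}"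
    and disj: "\<And>n::int. n \<noteq> 0 \<Longrightarrow> AE x in lborel. \<not> (x \<in> I \<and> x + of_int n \<in> I)"
    and g: "gabor_field I \<alpha> \<beta> g" and u: "unitary_multiplier u" and f: "f \<in> L2 field_measure"
  shows "(\<integral>\<^sup>+i. ennreal ((cmod (L2_inner field_measure f (Uhat g \<alpha> \<beta> u i)))\<^sup>2) \<partial>count_space UNIV) =
    (\<integral>\<^sup>+z. dilation_count I (fst z) * ennreal ((cmod (f z))\<^sup>2) \<partial>field_measure)"
proof -
  have gL: "g \<in> L2 field_measure"
    using g by (auto simp: gabor_field_def L2_over_def)
  have fm [measurable]: "f \<in> borel_measurable lebesgue"
    using f by (simp add: L2_field_iff)
  have level: "(\<integral>\<^sup>+(p, q, m). ennreal ((cmod (L2_inner field_measure f (Uhat g \<alpha> \<beta> u (j, p, q, m))))\<^sup>2) \<partial>count_space UNIV) =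
      (\<integral>\<^sup>+z. indicator I (2 powi j * fst z) * ennreal ((cmod (f z))\<^sup>2) \<partial>field_measure)" for j
  proof -
    define a :: real where "a = 2 powi j"
    have a: "0 < a" by (simp add: a_def)
    have ua: "unimodular_weight (u a)"
      using u a by (rule unimodular_weight_multiplier)
    define v :: "real \<Rightarrow> real \<Rightarrow> complex" where "v = (\<lambda>_ \<xi>. cnj (u a (\<xi> / a)))"
    have va: "unimodular_weight (v (1 / a))"
      unfolding v_def by (rule unimodular_weight_adjoint[OF ua a])
    have "L2_inner field_measure f (Uhat g \<alpha> \<beta> u (j, p, q, m)) =
        L2_inner field_measure (Dhat v (1 / a) f) (That (\<alpha> * of_int p) (\<beta> * of_int q) (of_int m) g)" for p q m
      unfolding Uhat_apply v_def a_def[symmetric]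
      by (rule L2_inner_Dhat[where u = u, OF ua a fm]) (use That_L2[OF gL] in \<open>simp add: L2_field_iff\<close>)
    then have "(\<integral>\<^sup>+(p, q, m). ennreal ((cmod (L2_inner field_measure f (Uhat g \<alpha> \<beta> u (j, p, q, m))))\<^sup>2) \<partial>count_space UNIV) =
        (\<integral>\<^sup>+z. indicator I (fst z) * ennreal ((cmod (Dhat v (1 / a) f z))\<^sup>2) \<partial>field_measure)"
      using a by (simp add: gabor_translates_sum[OF I bound disj g Dhat_L2[where u = v, OF va _ f]])
    also have "\<dots> = (\<integral>\<^sup>+z. indicator I (fst z / (1 / a)) * ennreal ((cmod (f z))\<^sup>2) \<partial>field_measure)"
      using a by (intro nn_integral_Dhat[where u = v, OF va _ fm] indicator_fst_measurable[OF I]) simp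
    finally show ?thesis
      by (simp add: a_def mult.commute)
  qed
  have meas: "(\<lambda>z. indicator I (2 powi j * fst z) * ennreal ((cmod (f z))\<^sup>2)) \<in> borel_measurable lebesgue" for j :: int
  proof -
    have [measurable]: "(\<lambda>z. indicator I (2 powi j * fst z) :: ennreal) \<in> borel_measurable (lebesgue :: (real \<times> real) measure)"
      by (rule dilation_indicator_measurable[OF I]) simp
    show ?thesis by measurable
  qed
  have "(\<integral>\<^sup>+i. ennreal ((cmod (L2_inner field_measure f (Uhat g \<alpha> \<beta> u i)))\<^sup>2) \<partial>count_space UNIV) =
     (\<integral>\<^sup>+(j::int). \<integral>\<^sup>+z. indicator I (2 powi j * fst z) * ennreal ((cmod (f z))\<^sup>2) \<partial>field_measure \<partial>count_space UNIV)"
    by (subst nn_integral_count_space_Pair) (simp add: level[symmetric] case_prod_unfold)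
  also have "\<dots> = (\<integral>\<^sup>+(j::int). \<integral>\<^sup>+z. ennreal \<bar>fst z\<bar> * (indicator I (2 powi j * fst z) * ennreal ((cmod (f z))\<^sup>2)) \<partial>lebesgue \<partial>count_space UNIV)"
    using meas by (simp add: nn_integral_field_measure)
  also have "\<dots> = (\<integral>\<^sup>+z. \<integral>\<^sup>+(j::int). ennreal \<bar>fst z\<bar> * (indicator I (2 powi j * fst z) * ennreal ((cmod (f z))\<^sup>2)) \<partial>count_space UNIV \<partial>lebesgue)"
    using meas by (intro nn_integral_count_space_nn_integral[symmetric]) auto
  also have "\<dots> = (\<integral>\<^sup>+z. ennreal \<bar>fst z\<bar> * (dilation_count I (fst z) * ennreal ((cmod (f z))\<^sup>2)) \<partial>lebesgue)"
    unfolding dilation_count_def by (simp add: nn_integral_cmult nn_integral_multc)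
  also have "\<dots> = (\<integral>\<^sup>+z. dilation_count I (fst z) * ennreal ((cmod (f z))\<^sup>2) \<partial>field_measure)"
    using dilation_count_measurable[OF I] by (intro nn_integral_field_measure[symmetric]) auto
  finally show ?thesis .
qed

lemma trivial_multiplier: "unitary_multiplier (\<lambda>_ _. 1)"
  by (simp add: unitary_multiplier_def)

text \<open>A half of \<open>[-1,1]\<close> is an interval of length 1 without one of its endpoints.\<close>

lemma half_window_translates:
  assumes "AE x in lborel. x \<in> I \<longrightarrow> x \<in> {- 1..1 :: real}" and n: "n \<noteq> 0"
    and half: "I \<subseteq> {0<..} \<or> I \<subseteq> {..<0}"
  shows "AE x in lborel. \<not> (x \<in> I \<and> x + of_int n \<in> I)"
  using assms(1) AE_lborel_shift[OF assms(1), of "of_int n"]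
proof eventually_elim
  case (elim x)
  show ?case
  proof
    assume "x \<in> I \<and> x + of_int n \<in> I"
    then have "\<bar>real_of_int n\<bar> < 1"
      using elim half by (auto simp: abs_less_iff)
    then show False using n by linarith
  qed
qed

text \<open>Testing with indicators of sets shows that two measures with densities with respect to the field measure agree on every box
  \<open>Q n\<close>, where the first density is integrable; so the densities agree.\<close>

lemma AE_dilation_count_1:
  assumes I: "I \<in> sets lebesgue"
    and eq: "\<And>f. f \<in> L2 field_measure \<Longrightarrow>
      (\<integral>\<^sup>+z. dilation_count I (fst z) * ennreal ((cmod (f z))\<^sup>2) \<partial>field_measure) =
      (\<integral>\<^sup>+z. ennreal ((cmod (f z))\<^sup>2) \<partial>field_measure)"
  shows "AE \<xi> in lborel. dilation_count I \<xi> = 1"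
proof -
  define Q where "Q n = cbox (- real n, - real n) (real n, real n)" for n :: nat
  have Q: "Q n \<in> sets lebesgue" for n
    by (simp add: Q_def)
  have field_meas: "f \<in> borel_measurable lebesgue \<Longrightarrow> f \<in> borel_measurable field_measure" for f :: "real \<times> real \<Rightarrow> ennreal"
    by (simp add: field_measure_alt measurable_restrict_space1)
  have fin: "(\<integral>\<^sup>+z. indicator (A \<inter> Q n) z \<partial>field_measure) < \<infinity>" if A: "A \<in> sets lebesgue" for A n
  proof -
    have "(\<integral>\<^sup>+z. indicator (A \<inter> Q n) z \<partial>field_measure) = (\<integral>\<^sup>+z. ennreal \<bar>fst z\<bar> * indicator (A \<inter> Q n) z \<partial>lebesgue)"
      using A Q by (intro nn_integral_field_measure) auto
    also have "\<dots> \<le> (\<integral>\<^sup>+z. ennreal (real n) * indicator (Q n) z \<partial>lebesgue)"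
      by (intro nn_integral_mono) (auto simp: indicator_def Q_def cbox_Pair_eq)
    also have "\<dots> = ennreal (real n) * emeasure lborel (Q n)"
      by (simp add: nn_integral_cmult nn_integral_completion Q_def)
    also have "\<dots> < \<infinity>"
      using emeasure_lborel_cbox_finite[of "(- real n, - real n)" "(real n, real n)"]
      by (simp add: ennreal_mult_less_top Q_def)
    finally show ?thesis .
  qed
  have "AE z in lebesgue. indicator (Q n) z = dilation_count I (fst z) * indicator (Q n) z" for n
  proof -
    have "density field_measure (indicator (Q n)) = density field_measure (\<lambda>z. dilation_count I (fst z) * indicator (Q n) z)"
    proof (rule measure_eqI)
      fix A assume "A \<in> sets (density field_measure (indicator (Q n)))"
      then have A: "A \<in> sets field_measure" by simp
      then have AL: "A \<in> sets lebesgue"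
        using Lam_sets by (auto simp: field_measure_alt sets_restrict_space)
      define f :: "real \<times> real \<Rightarrow> complex" where "f = indicator (A \<inter> Q n)"
      have f: "ennreal ((cmod (f z))\<^sup>2) = indicator (Q n) z * indicator A z" for z
        by (simp add: f_def indicator_def)
      have "(\<integral>\<^sup>+z. ennreal ((cmod (f z))\<^sup>2) \<partial>field_measure) < \<infinity>"
        using fin[OF AL, of n] by (simp add: f indicator_inter_arith[symmetric] mult.commute)
      moreover have "f \<in> borel_measurable lebesgue"
        using AL Q[of n] by (simp add: f_def)
      ultimately have "f \<in> L2 field_measure"
        by (simp add: L2_iff borel_measurable_field_measure_iff)
      from eq[OF this] show "emeasure (density field_measure (indicator (Q n))) A =
          emeasure (density field_measure (\<lambda>z. dilation_count I (fst z) * indicator (Q n) z)) A"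
        using A Q[of n] dilation_count_measurable[OF I]
        by (subst (1 2) emeasure_density) (auto simp: f mult.assoc intro!: field_meas borel_measurable_times_ennreal)
    qed simp
    moreover have "(\<integral>\<^sup>+z. indicator (Q n) z \<partial>field_measure) \<noteq> \<infinity>"
      using fin[of UNIV n] by simp
    ultimately have "AE z in field_measure. indicator (Q n) z = dilation_count I (fst z) * indicator (Q n) z"
      using Q[of n] dilation_count_measurable[OF I]
      by (subst finite_density_unique[symmetric]) (auto intro!: field_meas borel_measurable_times_ennreal)
    then show ?thesis
      by (simp add: AE_field_measure_iff)
  qed
  then have "AE z in lborel. \<forall>n. indicator (Q n) z = dilation_count I (fst z) * indicator (Q n) z"
    by (simp add: AE_all_countable AE_lebesgue_iff)
  then have "AE z in (lborel :: (real \<times> real) measure). dilation_count I (fst z) = 1"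
  proof eventually_elim
    case (elim z)
    obtain n :: nat where "max \<bar>fst z\<bar> \<bar>snd z\<bar> \<le> real n"
      using real_arch_simple by blast
    then have "z \<in> Q n"
      by (cases z) (auto simp: Q_def cbox_Pair_eq)
    then show ?case
      using elim[rule_format, of n] by simp
  qed
  from AE_lborel_sections[OF this] show ?thesis
    by (auto elim!: eventually_mono simp: eventually_const_iff[of _ "ae_filter lborel"] ae_filter_eq_bot_iff)
qed

lemma oriented_window_decomposition:
  "oriented_window 1 I z = oriented_window 1 (I \<inter> {0<..}) z + oriented_window 1 (I \<inter> {..<0}) z"
  "oriented_window (- 1) I z = oriented_window 1 (I \<inter> {0<..}) z - oriented_window 1 (I \<inter> {..<0}) z"
  by (auto simp: oriented_window_def indicator_def)

lemma Uhat_add: "Uhat (\<lambda>z. g z + h z) \<alpha> \<beta> u i = (\<lambda>z. Uhat g \<alpha> \<beta> u i z + Uhat h \<alpha> \<beta> u i z)"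
  and Uhat_diff: "Uhat (\<lambda>z. g z - h z) \<alpha> \<beta> u i = (\<lambda>z. Uhat g \<alpha> \<beta> u i z - Uhat h \<alpha> \<beta> u i z)"
  by (cases i; simp add: fun_eq_iff Uhat_apply Dhat_apply That_apply algebra_simps)+

lemma L2_inner_add:
  assumes "f \<in> L2 M" "g \<in> L2 M" "h \<in> L2 M"
  shows "L2_inner M f (\<lambda>z. g z + h z) = L2_inner M f g + L2_inner M f h"
    and "L2_inner M f (\<lambda>z. g z - h z) = L2_inner M f g - L2_inner M f h"
  unfolding L2_inner_def using L2_mult_cnj_integrable[OF assms(1,2)] L2_mult_cnj_integrable[OF assms(1,3)]
  by (simp_all add: distrib_left right_diff_distrib)

text \<open>The sums for the windows with \<open>e = 1\<close> and \<open>e = -1\<close> add up to twice the sums for the two half-line windows, by the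
  parallelogram law; the cross terms between the half-lines, about which nothing is known yet, cancel.\<close>

theorem wavelet_dilation_tiling:
  assumes I: "I \<in> sets lebesgue" and bound: "ae_subset I {-1..1}"
    and wav: "\<And>g. gabor_field I 1 1 g \<Longrightarrow> is_wavelet I g"
  shows "AE \<xi> in lborel. \<exists>!j. 2 powi j * \<xi> \<in> I"
proof -
  define P where "P = I \<inter> {0<..}"
  define M where "M = I \<inter> {..<0}"
  have sets: "P \<in> sets lebesgue" "M \<in> sets lebesgue"
    using I by (auto simp: P_def M_def)
  have bound': "AE x in lborel. x \<in> I \<longrightarrow> x \<in> {-1..1}"
    using bound by (simp add: ae_subset_def AE_lebesgue_iff)
  have bounds: "AE x in lborel. x \<in> P \<longrightarrow> x \<in> {-1..1}" "AE x in lborel. x \<in> M \<longrightarrow> x \<in> {-1..1}"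
    using bound' by (auto simp: P_def M_def elim: eventually_mono)
  have bounds2: "AE x in lborel. x \<in> P \<longrightarrow> x \<in> {- real 2..<real 2}" "AE x in lborel. x \<in> M \<longrightarrow> x \<in> {- real 2..<real 2}"
    by (rule eventually_mono[OF bounds(1)], force) (rule eventually_mono[OF bounds(2)], force)
  have gab: "gabor_field P 1 1 (oriented_window 1 P)" "gabor_field M 1 1 (oriented_window 1 M)"
    using sets bounds by (auto intro!: gabor_field_oriented_window simp: ae_subset_def AE_lebesgue_iff)
  then have L2: "oriented_window 1 P \<in> L2 field_measure" "oriented_window 1 M \<in> L2 field_measure"
    by (auto simp: gabor_field_def L2_over_def)
  have pf: "parseval_frame field_measure (Uhat (oriented_window e I) 1 1 (\<lambda>_ _. 1))" if "cmod e = 1" for e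
    using wav[OF gabor_field_oriented_window[OF I bound that]] by (simp add: is_wavelet_def)
  have decomp: "oriented_window 1 I = (\<lambda>z. oriented_window 1 P z + oriented_window 1 M z)"
    "oriented_window (- 1) I = (\<lambda>z. oriented_window 1 P z - oriented_window 1 M z)"
    unfolding P_def M_def by (rule ext, rule oriented_window_decomposition)+
  have "AE \<xi> in lborel. dilation_count I \<xi> = 1"
  proof (rule AE_dilation_count_1[OF I])
    fix f assume f: "f \<in> L2 field_measure"
    let ?X = "\<integral>\<^sup>+z. ennreal ((cmod (f z))\<^sup>2) \<partial>field_measure"
    let ?c = "\<lambda>g i. L2_inner field_measure f (Uhat g 1 1 (\<lambda>_ _. 1) i)"
    let ?S = "\<lambda>g. \<integral>\<^sup>+i. ennreal ((cmod (?c g i))\<^sup>2) \<partial>count_space UNIV"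
    have [measurable]: "f \<in> borel_measurable lebesgue"
      using f by (simp add: L2_field_iff)
    note UL2 = Uhat_L2[OF L2(1) trivial_multiplier] Uhat_L2[OF L2(2) trivial_multiplier]
    have "ennreal ((cmod (?c (oriented_window 1 I) i))\<^sup>2) + ennreal ((cmod (?c (oriented_window (- 1) I) i))\<^sup>2) =
        2 * (ennreal ((cmod (?c (oriented_window 1 P) i))\<^sup>2) + ennreal ((cmod (?c (oriented_window 1 M) i))\<^sup>2))" for i
    proof -
      let ?a = "?c (oriented_window 1 P) i" and ?b = "?c (oriented_window 1 M) i"
      have "?c (oriented_window 1 I) i = ?a + ?b" "?c (oriented_window (- 1) I) i = ?a - ?b"
        unfolding decomp Uhat_add Uhat_diff by (intro L2_inner_add f UL2)+
      moreover have "(cmod (?a + ?b))\<^sup>2 + (cmod (?a - ?b))\<^sup>2 = 2 * ((cmod ?a)\<^sup>2 + (cmod ?b)\<^sup>2)"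
        unfolding cmod_power2 by (simp add: power2_eq_square algebra_simps)
      ultimately show ?thesis
        by (simp add: ennreal_plus[symmetric] ennreal_mult[symmetric] ennreal_numeral[symmetric]
            del: ennreal_plus ennreal_numeral)
    qed
    then have "?S (oriented_window 1 I) + ?S (oriented_window (- 1) I) =
        2 * (?S (oriented_window 1 P) + ?S (oriented_window 1 M))"
      by (simp add: nn_integral_add[symmetric] nn_integral_cmult[symmetric])
    moreover have "?S (oriented_window e I) = ?X" if "cmod e = 1" for e
      using pf[OF that] f unfolding parseval_frame_iff by blast
    ultimately have "2 * ?X = 2 * (?S (oriented_window 1 P) + ?S (oriented_window 1 M))"
      by (simp add: mult_2)
    then have "?X = ?S (oriented_window 1 P) + ?S (oriented_window 1 M)"
      by (subst (asm) ennreal_mult_cancel_left) simp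
    also have "\<dots> = (\<integral>\<^sup>+z. dilation_count P (fst z) * ennreal ((cmod (f z))\<^sup>2) \<partial>field_measure) +
        (\<integral>\<^sup>+z. dilation_count M (fst z) * ennreal ((cmod (f z))\<^sup>2) \<partial>field_measure)"
    proof -
      have "AE x in lborel. \<not> (x \<in> P \<and> x + of_int n \<in> P)" "AE x in lborel. \<not> (x \<in> M \<and> x + of_int n \<in> M)"
        if "n \<noteq> 0" for n
        using half_window_translates[OF bounds(1) that] half_window_translates[OF bounds(2) that]
        by (auto simp: P_def M_def)
      then show ?thesis
        by (simp add: Uhat_sum[OF sets(1) bounds2(1) _ gab(1) trivial_multiplier f]
          Uhat_sum[OF sets(2) bounds2(2) _ gab(2) trivial_multiplier f])
    qed
    also have "\<dots> = (\<integral>\<^sup>+z. dilation_count P (fst z) * ennreal ((cmod (f z))\<^sup>2) +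
        dilation_count M (fst z) * ennreal ((cmod (f z))\<^sup>2) \<partial>field_measure)"
      using dilation_count_measurable[OF sets(1)] dilation_count_measurable[OF sets(2)]
      by (intro nn_integral_add[symmetric])
        (auto simp: field_measure_alt intro!: borel_measurable_times_ennreal measurable_restrict_space1)
    also have "\<dots> = (\<integral>\<^sup>+z. dilation_count I (fst z) * ennreal ((cmod (f z))\<^sup>2) \<partial>field_measure)"
    proof (rule nn_integral_cong_AE)
      have split: "dilation_count P \<xi> + dilation_count M \<xi> = dilation_count I \<xi>" if "\<xi> \<noteq> 0" for \<xi>
      proof -
        have pos: "\<not> 2 powi j < (0 :: real)" for j :: int
          by (simp add: not_less)
        show ?thesis
          unfolding dilation_count_def
          by (subst nn_integral_add[symmetric])
            (use that pos in \<open>auto simp: P_def M_def indicator_def zero_less_mult_iff mult_less_0_iff intro!: nn_integral_cong\<close>)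
      qed
      show "AE z in field_measure. dilation_count P (fst z) * ennreal ((cmod (f z))\<^sup>2) +
        dilation_count M (fst z) * ennreal ((cmod (f z))\<^sup>2) = dilation_count I (fst z) * ennreal ((cmod (f z))\<^sup>2)"
        unfolding AE_field_measure_iff using AE_fst_nonzero
        by eventually_elim (simp add: distrib_right[symmetric] split)
    qed
    finally show "(\<integral>\<^sup>+z. dilation_count I (fst z) * ennreal ((cmod (f z))\<^sup>2) \<partial>field_measure) = ?X" ..
  qed
  then show ?thesis
    by (simp add: dilation_count_eq_1_iff)
qed

section \<open>Integer translation packing\<close>

definition char_integral :: "int \<Rightarrow> real \<Rightarrow> complex" where
  "char_integral q r = (\<integral>s. (if 0 < s \<and> s < r then fourier_char q s else 0) \<partial>lborel)"

lemma char_integral_bound: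
  assumes "r \<le> 1"
  shows "cmod (char_integral q r) \<le> 1"
proof -
  have "cmod (char_integral q r) \<le> (\<integral>s. cmod (if 0 < s \<and> s < r then fourier_char q s else 0) \<partial>lborel)"
    unfolding char_integral_def by (rule integral_norm_bound)
  also have "\<dots> = (\<integral>s. indicator {0<..<r} s \<partial>lborel)"
    by (rule Bochner_Integration.integral_cong) (auto simp: indicator_def)
  also have "\<dots> = measure lborel {0<..<r}"
    by simp
  also have "\<dots> \<le> 1"
    using assms by (cases "0 \<le> r") auto
  finally show ?thesis .
qed

lemma char_integral_measurable [measurable]: "char_integral q \<in> borel_measurable borel"
  unfolding char_integral_def[abs_def] by measurable

lemma char_integral_dilate:
  assumes "\<xi> \<noteq> 0"
  shows "(\<integral>t. \<bar>\<xi>\<bar> *\<^sub>R ((if 0 < sgn \<xi> * t \<and> sgn \<xi> * t < 1 - \<bar>\<xi>\<bar> then 1 else 0) * fourier_char q (\<xi> * t)) \<partial>lborel) =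
    char_integral q (\<bar>\<xi>\<bar> * (1 - \<bar>\<xi>\<bar>))"
proof -
  have window: "0 < \<xi> * t \<and> \<xi> * t < \<bar>\<xi>\<bar> * (1 - \<bar>\<xi>\<bar>) \<longleftrightarrow> 0 < sgn \<xi> * t \<and> sgn \<xi> * t < 1 - \<bar>\<xi>\<bar>" for t
  proof -
    have eq: "\<xi> * t = \<bar>\<xi>\<bar> * (sgn \<xi> * t)"
      by (simp add: sgn_if)
    have pos: "0 < \<bar>\<xi>\<bar>"
      using assms by simp
    show ?thesis
      unfolding eq using mult_less_cancel_left_pos[OF pos, of 0 "sgn \<xi> * t"]
        mult_less_cancel_left_pos[OF pos, of "sgn \<xi> * t" "1 - \<bar>\<xi>\<bar>"] by (simp only: mult_zero_right)
  qed
  have "char_integral q (\<bar>\<xi>\<bar> * (1 - \<bar>\<xi>\<bar>)) = \<bar>\<xi>\<bar> *\<^sub>R (\<integral>t. (if 0 < \<xi> * t \<and> \<xi> * t < \<bar>\<xi>\<bar> * (1 - \<bar>\<xi>\<bar>)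
      then fourier_char q (\<xi> * t) else 0) \<partial>lborel)"
    unfolding char_integral_def using lborel_integral_real_affine[OF assms, of _ 0] by simp
  also have "\<dots> = (\<integral>t. \<bar>\<xi>\<bar> *\<^sub>R ((if 0 < sgn \<xi> * t \<and> sgn \<xi> * t < 1 - \<bar>\<xi>\<bar> then 1 else 0) * fourier_char q (\<xi> * t)) \<partial>lborel)"
    unfolding window integral_scaleR_right[symmetric] by (rule Bochner_Integration.integral_cong) auto
  finally show ?thesis ..
qed

text \<open>It takes the values \<open>1\<close> over \<open>B + 1\<close> and \<open>-1\<close> over \<open>B\<close>. In the variable \<open>s = \<xi> t\<close> the interval in \<open>t\<close> is
  \<open>(0, |\<xi>| (1 - |\<xi>|))\<close>, whose length is the same for \<open>\<xi>\<close> in \<open>(-1,0)\<close> and for \<open>\<xi> + 1\<close>.\<close>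

definition orthogonal_field :: "real set \<Rightarrow> real \<times> real \<Rightarrow> complex" where
  "orthogonal_field B z = (indicator B (fst z - 1) - indicator B (fst z)) *
     (if 0 < sgn (fst z) * snd z \<and> sgn (fst z) * snd z < 1 - \<bar>fst z\<bar> then 1 else 0)"

lemma orthogonal_field_measurable [measurable]:
  assumes [measurable]: "B \<in> sets borel"
  shows "orthogonal_field B \<in> borel_measurable borel"
  unfolding orthogonal_field_def[abs_def] by measurable

lemma orthogonal_field_L2:
  assumes B: "B \<in> sets borel" "B \<subseteq> {-1<..<0}"
  shows "orthogonal_field B \<in> L2 field_measure"
proof -
  have "(\<integral>\<^sup>+z. ennreal \<bar>fst z\<bar> * ennreal ((cmod (orthogonal_field B z))\<^sup>2) \<partial>lebesgue) \<le>
      (\<integral>\<^sup>+z. indicator (cbox (- 1, - 1) (1, 1)) z \<partial>(lebesgue :: (real \<times> real) measure))"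
  proof (rule nn_integral_mono)
    fix z :: "real \<times> real"
    show "ennreal \<bar>fst z\<bar> * ennreal ((cmod (orthogonal_field B z))\<^sup>2) \<le> indicator (cbox (- 1, - 1) (1, 1)) z"
    proof (cases "orthogonal_field B z = 0")
      case False
      then have "fst z \<in> B \<or> fst z - 1 \<in> B" "0 < sgn (fst z) * snd z" "sgn (fst z) * snd z < 1 - \<bar>fst z\<bar>"
        by (auto simp: orthogonal_field_def indicator_def split: if_splits)
      then have "\<bar>fst z\<bar> \<le> 1" "z \<in> cbox (- 1, - 1) (1, 1)" "(cmod (orthogonal_field B z))\<^sup>2 \<le> 1"
        using B(2) by (cases z; force simp: sgn_if cbox_Pair_eq orthogonal_field_def indicator_def split: if_splits)+
      then show ?thesis
        by (simp add: ennreal_mult[symmetric] mult_le_one)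
    qed simp
  qed
  also have "\<dots> < \<infinity>"
    using emeasure_lborel_cbox_finite[of "(- 1, - 1) :: real \<times> real" "(1, 1)"]
    by (simp add: nn_integral_completion)
  finally show ?thesis
    using orthogonal_field_measurable[OF B(1)] by (simp add: L2_field_iff measurable_completion)
qed

lemma Uhat_level_0: "Uhat g 1 1 (\<lambda>_ _. 1) (0, p, q, m) = That (of_int p) (of_int q) (of_int m) g"
  by (simp add: fun_eq_iff Uhat_apply Dhat_apply)

text \<open>At levels \<open>j \<noteq> 0\<close> the supports are disjoint because \<open>I\<close> meets each dyadic orbit once, and for \<open>p \<noteq> 0\<close> because
  distinct integer translates of the window are disjoint. In the remaining case the integrand over \<open>\<xi>\<close> is \<open>R (\<xi> - 1) - R \<xi>\<close>,
  whose integral is zero.\<close>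

lemma orthogonal_field_inner:
  assumes I: "I \<in> sets lebesgue" and bound: "ae_subset I {-1..1}"
    and tiling: "AE \<xi> in lborel. \<exists>!j. 2 powi j * \<xi> \<in> I"
    and B0 [measurable]: "B0 \<in> sets borel" and B0I: "B0 \<subseteq> I" "AE x in lborel. x \<in> I \<longleftrightarrow> x \<in> B0"
    and B [measurable]: "B \<in> sets borel" and BB: "\<And>x. x \<in> B \<Longrightarrow> x \<in> B0 \<and> x + 1 \<in> B0 \<and> x \<in> {-1<..<0}"
  shows "L2_inner field_measure (orthogonal_field B) (Uhat (oriented_window 1 I) 1 1 (\<lambda>_ _. 1) i) = 0"
proof -
  obtain j p q m where i: "i = (j, p, q, m)" by (cases i)
  let ?f = "orthogonal_field B"
  have B1: "B \<subseteq> {-1<..<0}" using BB by blast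
  have f_I: "fst z \<in> B0" if "?f z \<noteq> 0" for z
  proof -
    have "fst z \<in> B \<or> fst z - 1 \<in> B"
      using that by (auto simp: orthogonal_field_def indicator_def)
    then show ?thesis
      using BB[of "fst z"] BB[of "fst z - 1"] by auto
  qed
  have fL2: "?f \<in> L2 field_measure"
    using B B1 by (rule orthogonal_field_L2)
  have gL2: "oriented_window 1 I \<in> L2 field_measure"
    using gabor_field_oriented_window[OF I bound, of 1] by (simp add: gabor_field_def L2_over_def)
  show ?thesis
  proof (cases "j = 0")
    case False
    have "AE z in field_measure. ?f z * cnj (Uhat (oriented_window 1 I) 1 1 (\<lambda>_ _. 1) i z) = 0"
      unfolding AE_field_measure_iff AE_lebesgue_iff using AE_lborel_fst[OF tiling]
    proof eventually_elim
      case (elim z)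
      show ?case
      proof (rule ccontr)
        assume nz: "\<not> ?thesis"
        then have "2 powi 0 * fst z \<in> I"
          using f_I[of z] B0I(1) by auto
        moreover have "2 powi j * fst z \<in> I"
          using nz by (auto simp: i Uhat_apply Dhat_apply That_apply oriented_window_def indicator_def split: if_splits)
        ultimately show False
          using elim False by blast
      qed
    qed
    then show ?thesis
      unfolding L2_inner_def by (rule integral_eq_zero_AE)
  next
    case True
    let ?\<psi> = "That (of_int p) (of_int q) (of_int m) (oriented_window 1 B0)"
    have w0_meas: "oriented_window 1 B0 \<in> borel_measurable borel"
      unfolding oriented_window_def[abs_def] by measurable
    have "AE z in lebesgue. That (of_int p) (of_int q) (of_int m) (oriented_window 1 I) z = ?\<psi> z"
      unfolding AE_lebesgue_iff using AE_lborel_fst[OF B0I(2)]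
      by eventually_elim (simp add: That_apply oriented_window_def indicator_def)
    then have "L2_inner field_measure ?f (Uhat (oriented_window 1 I) 1 1 (\<lambda>_ _. 1) i) =
        (\<integral>\<xi>. \<integral>t. \<bar>\<xi>\<bar> *\<^sub>R (?f (\<xi>, t) * cnj (?\<psi> (\<xi>, t))) \<partial>lborel \<partial>lborel)"
      unfolding i True Uhat_level_0
      by (intro L2_inner_field_fubini(2) fL2 That_L2 gL2 That_borel_measurable w0_meas orthogonal_field_measurable B) auto
    also have "\<dots> = 0"
    proof (cases "p = 0")
      case False
      have "?f (\<xi>, t) * cnj (?\<psi> (\<xi>, t)) = 0" for \<xi> t
      proof (rule ccontr)
        assume nz: "\<not> ?thesis"
        then have "sgn \<xi> * t \<in> {0<..<1}" "sgn \<xi> * (t - of_int p) \<in> {0..<1}" "\<bar>sgn \<xi>\<bar> = 1"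
          by (auto simp: orthogonal_field_def That_apply oriented_window_def indicator_def sgn_if split: if_splits)
        then have "\<bar>sgn \<xi> * of_int p\<bar> < 1"
          by (auto simp: abs_less_iff algebra_simps)
        then have "\<bar>real_of_int p\<bar> < 1"
          using \<open>\<bar>sgn \<xi>\<bar> = 1\<close> by (simp add: abs_mult)
        then show False using False by linarith
      qed
      then show ?thesis
        by (simp only: scaleR_zero_right Bochner_Integration.integral_zero)
    next
      case True
      define \<rho> where "\<rho> \<eta> = indicator B \<eta> * char_integral q (\<bar>\<eta>\<bar> * (1 - \<bar>\<eta>\<bar>))" for \<eta> :: real
      define R where "R \<xi> = \<rho> \<xi> * cnj (fourier_char m \<xi>)" for \<xi>
      have [measurable]: "R \<in> borel_measurable borel"
        unfolding R_def[abs_def] \<rho>_def[abs_def] by measurable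
      have R_int: "integrable lborel R"
      proof (rule Bochner_Integration.integrable_bound)
        show "integrable lborel (indicator {-1..0} :: real \<Rightarrow> real)"
          by (rule integrable_real_indicator) auto
        have "cmod (R \<xi>) \<le> indicator {-1..0} \<xi>" for \<xi>
        proof (cases "\<xi> \<in> B")
          case True
          then have "\<xi> \<in> {-1<..<0}" using B1 by blast
          moreover from this have "\<bar>\<xi>\<bar> * (1 - \<bar>\<xi>\<bar>) \<le> 1"
            by (intro mult_le_one) auto
          ultimately show ?thesis
            using True by (simp add: R_def \<rho>_def norm_mult char_integral_bound)
        qed (simp add: R_def \<rho>_def)
        then show "AE \<xi> in lborel. cmod (R \<xi>) \<le> norm (indicator {-1..0} \<xi> :: real)"
          by simp
      qed simp
      have "(\<integral>t. \<bar>\<xi>\<bar> *\<^sub>R (?f (\<xi>, t) * cnj (?\<psi> (\<xi>, t))) \<partial>lborel) = R (\<xi> - 1) - R \<xi>" for \<xi>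
      proof (cases "\<xi> = 0")
        case False
        define c :: complex where "c = (indicator B (\<xi> - 1) - indicator B \<xi>) * cnj (fourier_char m \<xi>)"
        have "\<bar>\<xi>\<bar> *\<^sub>R (?f (\<xi>, t) * cnj (?\<psi> (\<xi>, t))) = c * (\<bar>\<xi>\<bar> *\<^sub>R
            ((if 0 < sgn \<xi> * t \<and> sgn \<xi> * t < 1 - \<bar>\<xi>\<bar> then 1 else 0) * fourier_char q (\<xi> * t)))" for t
        proof (cases "?f (\<xi>, t) = 0")
          case True
          then show ?thesis by (auto simp: orthogonal_field_def c_def)
        next
          case nz: False
          then have "oriented_window 1 B0 (\<xi>, t) = 1"
            using f_I[OF nz] by (auto simp: orthogonal_field_def oriented_window_def sgn_if split: if_splits)
          then have "cnj (?\<psi> (\<xi>, t)) = cnj (fourier_char m \<xi>) * fourier_char q (\<xi> * t)"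
            using \<open>p = 0\<close> by (simp add: That_apply fourier_char_def cis_cnj mult_ac)
          then show ?thesis
            by (simp add: orthogonal_field_def c_def mult_ac)
        qed
        then have "(\<integral>t. \<bar>\<xi>\<bar> *\<^sub>R (?f (\<xi>, t) * cnj (?\<psi> (\<xi>, t))) \<partial>lborel) = c * char_integral q (\<bar>\<xi>\<bar> * (1 - \<bar>\<xi>\<bar>))"
          by (simp only: integral_mult_right_zero char_integral_dilate[OF False])
        also have "\<dots> = R (\<xi> - 1) - R \<xi>"
        proof -
          have "\<bar>\<xi>\<bar> * (1 - \<bar>\<xi>\<bar>) = \<bar>\<xi> - 1\<bar> * (1 - \<bar>\<xi> - 1\<bar>)" if "\<xi> - 1 \<in> B"
            using that B1 by (force simp: abs_if)
          then show ?thesis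
            using fourier_char_diff_int[of m \<xi> 1] by (simp add: R_def \<rho>_def c_def indicator_def)
        qed
        finally show ?thesis .
      next
        case True
        then show ?thesis
          using B1 by (auto simp: R_def \<rho>_def indicator_def)
      qed
      then have "(\<integral>\<xi>. \<integral>t. \<bar>\<xi>\<bar> *\<^sub>R (?f (\<xi>, t) * cnj (?\<psi> (\<xi>, t))) \<partial>lborel \<partial>lborel) = (\<integral>\<xi>. R (\<xi> - 1) - R \<xi> \<partial>lborel)"
        by simp
      also have "\<dots> = (\<integral>\<xi>. R (\<xi> - 1) \<partial>lborel) - (\<integral>\<xi>. R \<xi> \<partial>lborel)"
        using lborel_integrable_real_affine[OF R_int, of 1 "- 1"] R_int
        by (intro Bochner_Integration.integral_diff) auto
      also have "\<dots> = 0"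
        using lborel_integral_real_affine[of 1 R "- 1"] by simp
      finally show ?thesis .
    qed
    finally show ?thesis .
  qed
qed

text \<open>Only \<open>n = 1\<close> and \<open>n = -1\<close> are in question, since two points of \<open>[-1,1]\<close> at a distance of at least 2 are the endpoints.
  If the set \<open>B\<close> of all \<open>x\<close> in \<open>(-1,0)\<close> with \<open>x\<close> and \<open>x + 1\<close> in \<open>I\<close> had positive measure, \<open>orthogonal_field B\<close> would be a nonzero field
  orthogonal to a Parseval frame.\<close>

theorem wavelet_translation_packing:
  assumes I: "I \<in> sets lebesgue" and bound: "ae_subset I {-1..1}"
    and wav: "\<And>g. gabor_field I 1 1 g \<Longrightarrow> is_wavelet I g" and n: "n \<noteq> (0 :: int)"
  shows "AE x in lborel. \<not> (x \<in> I \<and> x + of_int n \<in> I)"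
proof -
  have bound': "AE x in lborel. x \<in> I \<longrightarrow> x \<in> {-1..1}"
    using bound by (simp add: ae_subset_def AE_lebesgue_iff)
  \<comment> \<open>A Borel subset of \<open>I\<close> of full measure keeps \<open>B\<close>, and with it the test field, Borel measurable.\<close>
  obtain B0 where B0 [measurable]: "B0 \<in> sets borel" and B0I: "B0 \<subseteq> I" "AE x in lborel. x \<in> I \<longleftrightarrow> x \<in> B0"
    by (rule lebesgue_ex_borel_set[OF I])
  define B where "B = {x. x \<in> B0 \<and> x + 1 \<in> B0 \<and> x \<in> {-1<..<0}}"
  have B [measurable]: "B \<in> sets borel"
    unfolding B_def by measurable
  have BB: "x \<in> B \<Longrightarrow> x \<in> B0 \<and> x + 1 \<in> B0 \<and> x \<in> {-1<..<0}" for x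
    by (simp add: B_def)
  let ?f = "orthogonal_field B"
  have fL2: "?f \<in> L2 field_measure"
    by (rule orthogonal_field_L2[OF B]) (auto simp: B_def)
  have "(\<integral>\<^sup>+z. ennreal ((cmod (?f z))\<^sup>2) \<partial>field_measure) = 0"
  proof -
    have "parseval_frame field_measure (Uhat (oriented_window 1 I) 1 1 (\<lambda>_ _. 1))"
      using wav[OF gabor_field_oriented_window[OF I bound]] by (simp add: is_wavelet_def)
    then have "(\<integral>\<^sup>+z. ennreal ((cmod (?f z))\<^sup>2) \<partial>field_measure) =
        (\<integral>\<^sup>+i. ennreal ((cmod (L2_inner field_measure ?f (Uhat (oriented_window 1 I) 1 1 (\<lambda>_ _. 1) i)))\<^sup>2) \<partial>count_space UNIV)"
      using fL2 unfolding parseval_frame_iff by metis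
    then show ?thesis
      by (simp add: orthogonal_field_inner[OF I bound wavelet_dilation_tiling[OF I bound wav] B0 B0I B BB])
  qed
  then have "AE z in field_measure. ennreal ((cmod (?f z))\<^sup>2) = 0"
    using fL2 by (subst (asm) nn_integral_0_iff_AE) (auto simp: L2_def)
  then have "AE z in lborel. ?f z = 0"
    by (simp add: AE_field_measure_iff AE_lebesgue_iff)
  from AE_lborel_sections[OF this] have "AE \<xi> in lborel. \<xi> \<notin> B"
  proof eventually_elim
    case (elim \<xi>)
    show ?case
    proof
      assume "\<xi> \<in> B"
      then have \<xi>: "\<xi> \<in> {-1<..<0}" "\<xi> - 1 \<notin> B" by (auto simp: B_def)
      have "AE t in lborel. t \<notin> {- 1 - \<xi><..<0}"
        using elim by eventually_elim (use \<xi> \<open>\<xi> \<in> B\<close> in \<open>auto simp: orthogonal_field_def sgn_if split: if_splits\<close>)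
      then have "emeasure lborel {- 1 - \<xi><..<0} = 0"
        by (subst (asm) AE_iff_measurable[of "{- 1 - \<xi><..<0}"]) auto
      then show False
        using \<xi>(1) by simp
    qed
  qed
  then have one: "AE x in lborel. \<not> (x \<in> I \<and> x + 1 \<in> I)"
    using B0I(2) AE_lborel_shift[OF B0I(2), of 1] bound' AE_lborel_shift[OF bound', of 1]
      AE_lborel_singleton[of "- 1 :: real"] AE_lborel_singleton[of "0 :: real"]
    by eventually_elim (auto simp: B_def)
  consider "n = 1" | "n = - 1" | "2 \<le> \<bar>n\<bar>" using n by linarith
  then show ?thesis
  proof cases
    case 1
    then show ?thesis using one by simp
  next
    case 2
    then show ?thesis
      using AE_lborel_shift[OF one, of "- 1"] by (auto elim: eventually_mono)
  next
    case 3
    then have n2: "2 \<le> \<bar>real_of_int n\<bar>" by linarith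
    show ?thesis
      using bound' AE_lborel_shift[OF bound', of "of_int n"]
        AE_lborel_singleton[of "- 1 :: real"] AE_lborel_singleton[of "1 :: real"]
      by eventually_elim (use n2 in auto)
  qed
qed

section \<open>Dilation congruence with the Shannon set\<close>

text \<open>Both halves of the Shannon set are half-open intervals whose endpoints have ratio 2, the positive one closed on the
  left and the negative one, seen after reflection, closed on the right; hence floor in one case and ceiling in the other.\<close>

lemma shannon_set_dilation_tiling:
  assumes "\<xi> \<noteq> 0"
  shows "\<exists>!j::int. 2 powi j * \<xi> \<in> shannon_set"
proof -
  have window: "\<exists>!j::int. lo (2 powi j * x)" 
    if x: "0 < x" and ex: "\<exists>j::int. lo (2 powi j * x)" and sep: "\<And>y z :: real. lo y \<Longrightarrow> lo z \<Longrightarrow> z < 2 * y"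
    for x and lo :: "real \<Rightarrow> bool"
  proof -
    have "\<not> (lo (2 powi i * x) \<and> lo (2 powi j * x))" if "i < j" for i j :: int
    proof
      assume "lo (2 powi i * x) \<and> lo (2 powi j * x)"
      then have "2 powi j * x < 2 * (2 powi i * x)" using sep by blast
      also have "\<dots> = 2 powi (i + 1) * x"
        by (simp add: power_int_add)
      finally have "2 powi j < (2 :: real) powi (i + 1)"
        using x by simp
      moreover have "(2 :: real) powi (i + 1) \<le> 2 powi j"
        using that by (intro power_int_increasing) auto
      ultimately show False by simp
    qed
    then show ?thesis
      using ex by (metis linorder_neqE)
  qed
  have pow: "2 powi j = (2 :: real) powr of_int j" for j
    by (simp add: powr_real_of_int')
  show ?thesis
  proof (cases "0 < \<xi>")
    case True
    have "2 powi (- \<lfloor>log 2 \<xi>\<rfloor> - 1) * \<xi> \<in> {1/2..<1}"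
    proof -
      have "2 powi (- \<lfloor>log 2 \<xi>\<rfloor> - 1) * \<xi> = 2 powr (of_int (- \<lfloor>log 2 \<xi>\<rfloor> - 1) + log 2 \<xi>)"
        unfolding pow using True by (simp add: powr_add)
      moreover have "2 powr (of_int (- \<lfloor>log 2 \<xi>\<rfloor> - 1) + log 2 \<xi>) < 2 powr 0"
        by (rule powr_less_mono) (simp_all, linarith)
      moreover have "2 powr (- 1) \<le> 2 powr (of_int (- \<lfloor>log 2 \<xi>\<rfloor> - 1) + log 2 \<xi>)"
        by (rule powr_mono) (simp_all)
      ultimately show ?thesis by (simp add: powr_minus)
    qed
    then have "\<exists>!j::int. 2 powi j * \<xi> \<in> {1/2..<1}"
      by (intro window[OF True]) auto
    moreover have "2 powi j * \<xi> \<in> shannon_set \<longleftrightarrow> 2 powi j * \<xi> \<in> {1/2..<1}" for j :: int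
    proof -
      have "0 < 2 powi j * \<xi>" using True by simp
      then show ?thesis unfolding shannon_set_def by auto
    qed
    ultimately show ?thesis by simp
  next
    case False
    then have neg: "0 < - \<xi>" using assms by simp
    have "2 powi (- \<lceil>log 2 (- \<xi>)\<rceil>) * - \<xi> \<in> {1/2<..1}"
    proof -
      have "2 powi (- \<lceil>log 2 (- \<xi>)\<rceil>) * - \<xi> = 2 powr (of_int (- \<lceil>log 2 (- \<xi>)\<rceil>) + log 2 (- \<xi>))"
        unfolding pow powr_add using neg by simp
      moreover have "2 powr (of_int (- \<lceil>log 2 (- \<xi>)\<rceil>) + log 2 (- \<xi>)) \<le> 2 powr 0"
        by (rule powr_mono) (simp_all)
      moreover have "2 powr (- 1) < 2 powr (of_int (- \<lceil>log 2 (- \<xi>)\<rceil>) + log 2 (- \<xi>))"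
        by (rule powr_less_mono) (simp_all, linarith)
      ultimately show ?thesis by (simp add: powr_minus)
    qed
    then have "\<exists>!j::int. 2 powi j * - \<xi> \<in> {1/2<..1}"
      by (intro window[OF neg]) auto
    moreover have "2 powi j * \<xi> \<in> shannon_set \<longleftrightarrow> 2 powi j * - \<xi> \<in> {1/2<..1}" for j :: int
    proof -
      have "0 < 2 powi j * - \<xi>"
        by (rule mult_pos_pos) (use neg in auto)
      then show ?thesis unfolding shannon_set_def by auto
    qed
    ultimately show ?thesis by simp
  qed
qed

lemma power_int_2_mult_shift: "2 powi i * (2 powi j * \<xi>) = 2 powi (i + j) * (\<xi> :: real)"
  by (simp add: power_int_add)

lemma dilation_tiling_invariant:
  fixes \<xi> :: real
  assumes "\<exists>!j::int. 2 powi j * \<xi> \<in> S"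
  shows "\<exists>!j::int. 2 powi j * (2 powi k * \<xi>) \<in> S"
proof -
  obtain j where j: "2 powi j * \<xi> \<in> S" "\<And>i. 2 powi i * \<xi> \<in> S \<Longrightarrow> i = j"
    using assms by blast
  show ?thesis
    unfolding power_int_2_mult_shift
  proof (rule ex1I[of _ "j - k"])
    show "2 powi (j - k + k) * \<xi> \<in> S" using j(1) by simp
    show "i = j - k" if "2 powi (i + k) * \<xi> \<in> S" for i
      using j(2)[OF that] by simp
  qed
qed

text \<open>On the set \<open>U\<close> of points whose orbit meets \<open>I\<close> exactly once, \<open>I\<close> and the Shannon set are both sections of the dyadic orbits, and the
  bijection sends a point to the point of the Shannon set on the same orbit. The set \<open>U\<close> is invariant under dilation by powers of 2
  and has full measure, so intersecting with it gives admissible representatives.\<close>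

theorem dilation_tiling_imp_congruent:
  assumes I: "I \<in> sets lebesgue" and tiling: "AE \<xi> in lborel. \<exists>!j::int. 2 powi j * \<xi> \<in> I"
  shows "dilation_congruent I shannon_set"
proof -
  define U where "U = {\<xi> :: real. \<xi> \<noteq> 0 \<and> (\<exists>!j::int. 2 powi j * \<xi> \<in> I)}"
  have AEU: "AE \<xi> in lborel. \<xi> \<in> U"
    using tiling AE_lborel_singleton[of "0::real"] by eventually_elim (simp add: U_def)
  have U: "U \<in> sets lebesgue"
  proof (rule completion.in_sets_AE)
    show "AE \<xi> in lebesgue. (\<xi> \<in> UNIV) = (\<xi> \<in> U)"
      using AEU by (simp add: AE_lebesgue_iff)
  qed auto
  have shannon: "shannon_set \<in> sets lebesgue"
    by (simp add: shannon_set_def)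
  have Uinv: "2 powi k * \<xi> \<in> U" if "\<xi> \<in> U" for k \<xi>
    using that dilation_tiling_invariant[of \<xi> I k] by (simp add: U_def)
  define I' where "I' = I \<inter> U"
  define J' where "J' = shannon_set \<inter> U"
  define j where "j \<xi> = (THE j::int. 2 powi j * \<xi> \<in> shannon_set)" for \<xi> :: real
  define \<delta> where "\<delta> \<xi> = 2 powi (j \<xi>) * \<xi>" for \<xi> :: real
  have j_iff: "2 powi k * \<xi> \<in> shannon_set \<longleftrightarrow> k = j \<xi>" if "\<xi> \<noteq> 0" for k \<xi>
    using theI'[OF shannon_set_dilation_tiling[OF that]] shannon_set_dilation_tiling[OF that]
    unfolding j_def by blast
  have sets': "I' \<in> sets lebesgue" "J' \<in> sets lebesgue"
    using I U shannon by (auto simp: I'_def J'_def)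
  have j_meas: "j \<in> measurable (lebesgue_on I') (count_space UNIV)"
    unfolding measurable_count_space_eq2_countable
  proof (intro conjI ballI)
    fix k :: int
    have "(\<lambda>\<xi>. 2 powi k * \<xi>) -` shannon_set \<inter> space lborel \<in> sets (lborel :: real measure)"
      by (rule measurable_sets[where A = borel]) (auto simp: shannon_set_def)
    then have "I' \<inter> (\<lambda>\<xi>. 2 powi k * \<xi>) -` shannon_set \<in> sets lebesgue"
      using sets'(1) by auto
    also have "I' \<inter> (\<lambda>\<xi>. 2 powi k * \<xi>) -` shannon_set = j -` {k} \<inter> I'"
      using j_iff by (auto simp: I'_def U_def)
    finally show "j -` {k} \<inter> space (lebesgue_on I') \<in> sets (lebesgue_on I')"
      using sets'(1) by (auto simp: sets_restrict_space_iff)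
  qed simp
  have \<delta>_meas: "\<delta> \<in> borel_measurable (lebesgue_on I')"
  proof -
    have "(\<lambda>\<xi>. 2 powi (j \<xi>) :: real) \<in> borel_measurable (lebesgue_on I')"
      by (rule measurable_compose[OF j_meas]) simp
    moreover have "(\<lambda>\<xi>. \<xi>) \<in> borel_measurable (lebesgue_on I')"
      by (intro measurable_restrict_space1 measurable_completion) simp
    ultimately show ?thesis
      unfolding \<delta>_def[abs_def] by (rule borel_measurable_times)
  qed
  have bij: "bij_betw \<delta> I' J'"
  proof (rule bij_betw_imageI)
    show "inj_on \<delta> I'"
    proof (rule inj_onI)
      fix \<xi> \<eta> assume *: "\<xi> \<in> I'" "\<eta> \<in> I'" "\<delta> \<xi> = \<delta> \<eta>"
      have "\<eta> = 2 powi (- j \<eta>) * (2 powi j \<eta> * \<eta>)"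
        unfolding power_int_2_mult_shift by simp
      also have "2 powi j \<eta> * \<eta> = 2 powi j \<xi> * \<xi>"
        using *(3) by (simp add: \<delta>_def)
      finally have \<eta>: "\<eta> = 2 powi (- j \<eta> + j \<xi>) * \<xi>"
        unfolding power_int_2_mult_shift .
      have "2 powi 0 * \<xi> \<in> I" "2 powi (- j \<eta> + j \<xi>) * \<xi> \<in> I"
        using *(1,2) \<eta> by (simp_all add: I'_def)
      then have "- j \<eta> + j \<xi> = 0"
        using *(1) unfolding I'_def U_def by blast
      then show "\<xi> = \<eta>"
        using \<eta> by simp
    qed
    show "\<delta> ` I' = J'"
    proof
      show "\<delta> ` I' \<subseteq> J'"
      proof
        fix \<eta> assume "\<eta> \<in> \<delta> ` I'"
        then obtain \<xi> where \<xi>: "\<xi> \<in> I'" "\<eta> = 2 powi j \<xi> * \<xi>" by (auto simp: \<delta>_def)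
        then have "\<xi> \<noteq> 0" "\<xi> \<in> U" by (auto simp: I'_def U_def)
        then show "\<eta> \<in> J'"
          using j_iff[of \<xi> "j \<xi>"] Uinv[of \<xi> "j \<xi>"] \<xi>(2) by (simp add: J'_def)
      qed
      show "J' \<subseteq> \<delta> ` I'"
      proof
        fix \<eta> assume \<eta>: "\<eta> \<in> J'"
        then obtain k where k: "2 powi k * \<eta> \<in> I" by (auto simp: J'_def U_def)
        define \<xi> where "\<xi> = 2 powi k * \<eta>"
        have \<xi>: "\<xi> \<in> I'" "\<xi> \<noteq> 0"
          using k Uinv[of \<eta> k] \<eta> by (auto simp: \<xi>_def I'_def J'_def U_def)
        have \<eta>_eq: "2 powi (- k) * \<xi> = \<eta>"
          unfolding \<xi>_def power_int_2_mult_shift by simp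
        then have "- k = j \<xi>"
          using j_iff[OF \<xi>(2), of "- k"] \<eta> by (simp add: J'_def)
        then have "\<delta> \<xi> = \<eta>"
          using \<eta>_eq by (simp add: \<delta>_def)
        then show "\<eta> \<in> \<delta> ` I'"
          using \<xi>(1) by blast
      qed
    qed
  qed
  have "ae_eq I' I" "ae_eq J' shannon_set"
    using AEU by (auto simp: ae_eq_def AE_lebesgue_iff I'_def J'_def elim: eventually_mono)
  moreover have "\<forall>\<xi>\<in>I'. \<delta> \<xi> = 2 powi (j \<xi>) * \<xi>"
    by (simp add: \<delta>_def)
  ultimately show ?thesis
    unfolding dilation_congruent_def using sets' j_meas \<delta>_meas bij by blast
qed

theorem lemma4p4:
  fixes I :: "real set"
  assumes "I \<in> sets lebesgue"
    and "ae_subset I {-1..1}"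
    and "\<And>g. gabor_field I 1 1 g \<Longrightarrow> is_wavelet I g"
  shows "dilation_congruent I shannon_set \<and>
    (\<forall>\<alpha> \<beta> g u. \<alpha> > 0 \<longrightarrow> \<beta> > 0 \<longrightarrow> ae_subset I {- 1 / (\<alpha> * \<beta>)..1 / (\<alpha> * \<beta>)} \<longrightarrow>
       gabor_field I \<alpha> \<beta> g \<longrightarrow> unitary_multiplier u \<longrightarrow>
       parseval_frame field_measure (Uhat g \<alpha> \<beta> u))"
proof (intro conjI allI impI)
  have tiling: "AE \<xi> in lborel. \<exists>!j. 2 powi j * \<xi> \<in> I"
    by (rule wavelet_dilation_tiling[OF assms(1,2)]) (rule assms(3))
  have packing: "AE x in lborel. \<not> (x \<in> I \<and> x + of_int n \<in> I)" if "n \<noteq> 0" for n :: int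
    by (rule wavelet_translation_packing[OF assms(1,2) _ that]) (rule assms(3))
  show "dilation_congruent I shannon_set"
    by (rule dilation_tiling_imp_congruent[OF assms(1) tiling])
  fix \<alpha> \<beta> :: real and g u
  assume g: "gabor_field I \<alpha> \<beta> g" and u: "unitary_multiplier u"
  have bound: "AE x in lborel. x \<in> I \<longrightarrow> x \<in> {- real 2..<real 2}"
    using assms(2) by (auto simp: ae_subset_def AE_lebesgue_iff elim!: eventually_mono)
  have "(\<integral>\<^sup>+i. ennreal ((cmod (L2_inner field_measure f (Uhat g \<alpha> \<beta> u i)))\<^sup>2) \<partial>count_space UNIV) =
      (\<integral>\<^sup>+z. ennreal ((cmod (f z))\<^sup>2) \<partial>field_measure)" if f: "f \<in> L2 field_measure" for f
  proof -
    have "(\<integral>\<^sup>+i. ennreal ((cmod (L2_inner field_measure f (Uhat g \<alpha> \<beta> u i)))\<^sup>2) \<partial>count_space UNIV) =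
        (\<integral>\<^sup>+z. dilation_count I (fst z) * ennreal ((cmod (f z))\<^sup>2) \<partial>field_measure)"
      by (rule Uhat_sum[OF assms(1) bound packing g u f])
    also have "\<dots> = (\<integral>\<^sup>+z. ennreal ((cmod (f z))\<^sup>2) \<partial>field_measure)"
    proof (rule nn_integral_cong_AE)
      show "AE z in field_measure. dilation_count I (fst z) * ennreal ((cmod (f z))\<^sup>2) = ennreal ((cmod (f z))\<^sup>2)"
        unfolding AE_field_measure_iff AE_lebesgue_iff using AE_lborel_fst[OF tiling]
        by eventually_elim (simp add: dilation_count_eq_1_iff[symmetric])
    qed
    finally show ?thesis .
  qed
  moreover have "g \<in> L2 field_measure"
    using g by (simp add: gabor_field_def L2_over_def)
  ultimately show "parseval_frame field_measure (Uhat g \<alpha> \<beta> u)"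
    unfolding parseval_frame_iff using Uhat_L2[OF _ u] by blast
qed

end
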